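(* Let $f\in L^2_{\mathrm{loc}}(\mathbb{R})$. (a) The function $f$ is differentiable at almost every point $x\in\mathbb{R}$ where the following two conditions hold: $$\limsup_{|h|\to0}\Big|\frac{f(x+2h)-f(x)}{2h}-\frac{f(x+h)-f(x)}{h}\Big|<\infty,$$ and there exists $\delta=\delta(x)>0$ such that $$\iint_{|s|+|t|<\delta}\Big|\frac{f(x+s)-f(x)}{s}-\frac{f(x+t)-f(x)}{t}\Big|^2\frac{ds\,dt}{|s-t|^2}<\infty.$$ (b) For almost every point $x\in\mathbb{R}$ where $f$ is differentiable and $$\limsup_{|t|\to0}\ \sup_{1<|m|\le2}\ \frac{\Big|\frac{f(x+mt)-f(x)}{mt}-\frac{f(x+t)-f(x)}{t}\Big|}{|m-1|\,\big(1+\big|\log\frac{1}{|m-1|}\big|\big)}<\infty,$$ there exists $\delta=\delta(x)>0$ such that $$\iint_{|s|+|t|<\delta}\Big|\frac{f(x+s)-f(x)}{s}-\frac{f(x+t)-f(x)}{t}\Big|^2\frac{ds\,dt}{|s-t|^2}<\infty.$$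
   Context: $f$ is a (pointwise defined) locally square integrable function on $\mathbb{R}$; "almost every" refers to Lebesgue measure. In (b), $m$ ranges over real numbers with $1<|m|\le 2$. *)

theory Defs
  imports "HOL-Analysis.Analysis"
begin

text \<open>Membership in \<open>L\<^sup>2\<^sub>l\<^sub>o\<^sub>c(\<real>)\<close> is stated for a pointwise defined function, not for
  an equivalence class: differentiability at a point and the pointwise conditions of the theorem
  depend on the values of \<open>f\<close> everywhere.\<close>

definition locally_L2 :: "(real \<Rightarrow> real) \<Rightarrow> bool" where
  "locally_L2 f \<longleftrightarrow> f \<in> borel_measurable lebesgue \<and>
     (\<forall>K. compact K \<longrightarrow> set_integrable lebesgue K (\<lambda>x. (f x)\<^sup>2))"

definition diff_quot :: "(real \<Rightarrow> real) \<Rightarrow> real \<Rightarrow> real \<Rightarrow> real" where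
  "diff_quot f x h = (f (x + h) - f x) / h"

text \<open>The integral is taken in \<open>[0, \<infinity>]\<close> with respect to planar Lebesgue measure. On the null set
  where \<open>s = 0\<close>, \<open>t = 0\<close> or \<open>s = t\<close>, division by zero makes the integrand finite, which does not
  affect the integral.\<close>

definition square_integral :: "(real \<Rightarrow> real) \<Rightarrow> real \<Rightarrow> real \<Rightarrow> ennreal" where
  "square_integral f x \<delta> =
     (\<integral>\<^sup>+ p \<in> {(s, t). \<bar>s\<bar> + \<bar>t\<bar> < \<delta>}.
        (case p of (s, t) \<Rightarrow>
          ennreal (\<bar>diff_quot f x s - diff_quot f x t\<bar>\<^sup>2 / \<bar>s - t\<bar>\<^sup>2)) \<partial>lebesgue)"

end

theory Submission
  imports Defs
begin

text \<open>The integrand of the square integral is the squared second divided difference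
  \<open>f[x, x+s, x+t]\<^sup>2\<close>, which is symmetric in its three nodes.

  For (a), lay down a dyadic grid with random origin and mesh. The slopes of \<open>f\<close> over the nested
  cells around \<open>x\<close> form a martingale with predictable increments, and its square function is
  controlled by the square integral on average over the grids. Hence at almost every \<open>x\<close> the
  difference quotient at \<open>x\<close> is bounded except on sets of small relative measure. At a point of
  density of such points, the doubling condition at nearby points \<open>x'\<close>, with \<open>y\<close> the midpoint of \<open>x'\<close> and
  \<open>2y - x'\<close>, turns this into a bound for all small increments, and Stepanov's theorem applies.

  For (b), write \<open>f = g + b\<close> near the points of uniform Lipschitz behaviour, with \<open>g\<close> Lipschitz and
  \<open>\<bar>b\<bar>\<close> at most the distance to those points. For \<open>g\<close> the divided differences are summed by
  Melnikov's symmetrisation: with \<open>e(w)\<close> the squared \<open>L\<^sup>2\<close> norm of the difference quotient of step \<open>w\<close>,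
  integration in \<open>x\<close> gives
  \<open>e(s-t)/(st) - e(s)/(t(s-t)) + e(t)/(s(s-t))\<close>, and over a symmetric truncation the three terms
  contribute equally, with a kernel of bounded positive part. The terms with \<open>b\<close> are bounded by a
  Marcinkiewicz integral, the hypothesis on the difference quotients being used only very close to
  the diagonal \<open>s = t\<close>.\<close>

section \<open>Differentiability of Lipschitz functions\<close>

text \<open>Boundedness of a martingale is known for one grid and almost every x, while the square
  integral concerns one x and almost every grid; Fubini exchanges the two. Two grid parameters are
  needed because the square integral is planar: at each generation the origin spreads the left end s
  of the cell over its length u, and the mesh spreads u over a dyadic shell, which recovers the
  measure ds du / u^2. All information gained in this way holds off small sets only; the doubling
  condition is what reaches the single increments. In (b) the obstacle is cancellation: separately
  the three symmetrised terms are in general not absolutely integrable, so s, t and s - t are cut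
  off at a common level \<eta>, and the bound must not depend on \<eta>. A bound from one side is
  enough since the integrand is nonnegative. The size of b alone leaves 1/(s - t)^2, which is not
  integrable across the diagonal; there the logarithmic modulus \<theta>(1 + |log(1/\<theta>)|)
  \<le> 4 \<theta>^(3/4) provides an exponent above the critical 1/2.\<close>

lemma AE_has_real_derivative_of_has_integral:
  fixes h F :: "real \<Rightarrow> real"
  assumes h: "\<And>a b. a \<le> b \<Longrightarrow> (h has_integral (F b - F a)) {a..b}"
  shows "AE x in lebesgue. (F has_real_derivative h x) (at x)"
proof -
  have int: "h integrable_on cbox a b" for a b :: real
    using h[of a b] by (cases "a \<le> b") (auto intro: has_integral_integrable)
  \<comment> \<open>Averages over intervals to the right of a point give the right derivative only;
    for the left one the same theorem is applied to the reflected function at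
    \<open>- x\<close>.\<close>
  have intm: "(\<lambda>x. h (- x)) integrable_on cbox a b" for a b :: real
    using int[of "-b" "-a"] Henstock_Kurzweil_Integration.integrable_reflect_real[where f=h and a="-b" and b="-a"] by simp
  from integrable_ccontinuous_explicit[OF int] obtain N where N: "negligible N"
    "\<And>x e. \<lbrakk>x \<notin> N; 0 < e\<rbrakk> \<Longrightarrow> \<exists>d>0. \<forall>t. 0 < t \<and> t < d \<longrightarrow>
        norm(integral (cbox x (x + t *\<^sub>R One)) h /\<^sub>R t ^ DIM(real) - h x) < e"
    by metis
  from integrable_ccontinuous_explicit[OF intm] obtain N' where N': "negligible N'"
    "\<And>x e. \<lbrakk>x \<notin> N'; 0 < e\<rbrakk> \<Longrightarrow> \<exists>d>0. \<forall>t. 0 < t \<and> t < d \<longrightarrow>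
        norm(integral (cbox x (x + t *\<^sub>R One)) (\<lambda>x. h (- x)) /\<^sub>R t ^ DIM(real) - h (- x)) < e"
    by metis
  have neg: "negligible (uminus ` N')"
    by (intro negligible_differentiable_image_negligible N'(1)) (auto simp: differentiable_on_def)
  have main: "(F has_real_derivative h x) (at x)" if x: "x \<notin> N" "- x \<notin> N'" for x
  proof -
    have right: "\<exists>d>0. \<forall>t. 0 < t \<and> t < d \<longrightarrow> \<bar>(F (x + t) - F x) / t - h x\<bar> < e" if "e > 0" for e
    proof -
      obtain d where "d > 0" and d: "\<And>t. 0 < t \<and> t < d \<Longrightarrow>
          norm(integral (cbox x (x + t *\<^sub>R One)) h /\<^sub>R t ^ DIM(real) - h x) < e"
        using N(2)[OF x(1) \<open>e > 0\<close>] by blast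
      have "\<bar>(F (x + t) - F x) / t - h x\<bar> < e" if "0 < t \<and> t < d" for t
        using d[OF that] integral_unique[OF h[of x "x + t"]] that
        by (simp add: divide_inverse mult.commute)
      with \<open>d > 0\<close> show ?thesis by blast
    qed
    have left: "\<exists>d>0. \<forall>t. 0 < t \<and> t < d \<longrightarrow> \<bar>(F (x - t) - F x) / (- t) - h x\<bar> < e" if "e > 0" for e
    proof -
      obtain d where "d > 0" and d: "\<And>t. 0 < t \<and> t < d \<Longrightarrow>
          norm(integral (cbox (-x) (-x + t *\<^sub>R One)) (\<lambda>x. h (- x)) /\<^sub>R t ^ DIM(real) - h (- (- x))) < e"
        using N'(2)[OF x(2) \<open>e > 0\<close>] by blast
      have "\<bar>(F (x - t) - F x) / (- t) - h x\<bar> < e" if "0 < t \<and> t < d" for t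
      proof -
        have "((\<lambda>x. h (- x)) has_integral (F x - F (x - t))) {-x..-x+t}"
          using h[of "x - t" x] that has_integral_reflect_real[of h "F x - F (x - t)" x "x - t"] by simp
        then have "integral {-x..-x+t} (\<lambda>x. h (- x)) = F x - F (x - t)"
          by (rule integral_unique)
        then have "\<bar>(F x - F (x - t)) / t - h x\<bar> < e"
          using d[OF that] that by (simp add: divide_inverse mult.commute)
        moreover have "(F (x - t) - F x) / (- t) = (F x - F (x - t)) / t"
          by (simp add: minus_divide_left[symmetric] diff_divide_distrib)
        ultimately show ?thesis by simp
      qed
      with \<open>d > 0\<close> show ?thesis by blast
    qed
    show ?thesis
      unfolding DERIV_def LIM_eq
    proof (intro allI impI)
      fix e :: real assume "e > 0"
      obtain d1 where d1: "d1 > 0" "\<And>t. 0 < t \<and> t < d1 \<Longrightarrow> \<bar>(F (x + t) - F x) / t - h x\<bar> < e"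
        using right[OF \<open>e > 0\<close>] by blast
      obtain d2 where d2: "d2 > 0" "\<And>t. 0 < t \<and> t < d2 \<Longrightarrow> \<bar>(F (x - t) - F x) / (- t) - h x\<bar> < e"
        using left[OF \<open>e > 0\<close>] by blast
      have "\<bar>(F (x + t) - F x) / t - h x\<bar> < e" if "t \<noteq> 0" "\<bar>t\<bar> < min d1 d2" for t
      proof (cases "t > 0")
        case True then show ?thesis using d1(2)[of t] that by auto
      next
        case False then show ?thesis using d2(2)[of "-t"] that by auto
      qed
      then show "\<exists>s>0. \<forall>xa. xa \<noteq> 0 \<and> norm (xa - 0) < s \<longrightarrow> norm ((F (x + xa) - F x) / xa - h x) < e"
        using d1(1) d2(1) by (intro exI[of _ "min d1 d2"]) auto
    qed
  qed
  have "negligible (N \<union> uminus ` N')"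
    using N(1) neg by (rule negligible_Un)
  then have "AE x in lebesgue. x \<notin> N \<union> uminus ` N'"
    unfolding negligible_iff_null_sets by (rule AE_not_in)
  then show ?thesis
  proof (rule AE_mp, intro AE_I2 impI)
    fix x assume "x \<notin> N \<union> uminus ` N'"
    then have "x \<notin> N" "- x \<notin> N'"
      by (auto simp: image_iff)
    then show "(F has_real_derivative h x) (at x)" by (rule main)
  qed
qed

text \<open>Since \<open>F + G\<close> is the identity, the Stieltjes measures of \<open>F\<close>
  and \<open>G\<close> add up to Lebesgue measure, which is recognised by its values on boxes; each
  summand is therefore dominated by it. Continuity ensures that the right end of an interval carries
  no mass.\<close>

lemma interval_measure_le_lborel:
  assumes F: "mono F" "continuous_on UNIV F"
    and G: "mono G" "continuous_on UNIV G" and FG: "\<And>x::real. F x + G x = x"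
    and A: "A \<in> sets borel"
  shows "emeasure (interval_measure F) A \<le> emeasure lborel A"
proof -
  let ?m = "interval_measure F" and ?n = "interval_measure G"
  define S where "S = measure_of UNIV (sets borel) (\<lambda>A. emeasure ?m A + emeasure ?n A)"
  have setsS[simp]: "sets S = sets borel"
    unfolding S_def using sigma_algebra.sets_measure_of_eq[OF sets.sigma_algebra_axioms[of borel]]
    by (metis space_borel)
  have emS: "emeasure S A = emeasure ?m A + emeasure ?n A" if "A \<in> sets borel" for A
    unfolding S_def
  proof (rule emeasure_measure_of_sigma[OF _ _ _ that])
    show "sigma_algebra UNIV (sets borel :: real set set)"
      using sets.sigma_algebra_axioms[of "borel :: real measure"] by simp
    show "positive (sets borel) (\<lambda>A. emeasure ?m A + emeasure ?n A)"
      by (simp add: positive_def)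
    show "countably_additive (sets borel) (\<lambda>A. emeasure ?m A + emeasure ?n A)"
    proof (rule countably_additiveI)
      fix B :: "nat \<Rightarrow> real set" assume B: "range B \<subseteq> sets borel" "disjoint_family B" "\<Union> (range B) \<in> sets borel"
      have "(\<Sum>i. emeasure ?m (B i) + emeasure ?n (B i)) = (\<Sum>i. emeasure ?m (B i)) + (\<Sum>i. emeasure ?n (B i))"
        by (intro suminf_add[symmetric]) auto
      also have "\<dots> = emeasure ?m (\<Union> (range B)) + emeasure ?n (\<Union> (range B))"
        using B by (intro arg_cong2[where f="(+)"] suminf_emeasure) auto
      finally show "(\<Sum>i. emeasure ?m (B i) + emeasure ?n (B i)) = emeasure ?m (\<Union> (range B)) + emeasure ?n (\<Union> (range B))" .
    qed
  qed
  have Ioo: "emeasure (interval_measure H) {l<..<u} = H u - H l"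
    if H: "mono H" "continuous_on UNIV H" and lu: "l \<le> u" for H and l u :: real
  proof -
    have mono: "\<And>x y. x \<le> y \<Longrightarrow> H x \<le> H y" using H(1) by (simp add: mono_def)
    have cr: "\<And>a. continuous (at_right a) H"
      using H(2) by (simp add: continuous_on_eq_continuous_at continuous_at_imp_continuous_at_within)
    have sing: "emeasure (interval_measure H) {u} = 0"
      using emeasure_interval_measure_Icc[of u u H] mono H(2) by (simp add: continuous_on_subset)
    show ?thesis
    proof (cases "l = u")
      case False
      then have eq: "{l<..u} = {l<..<u} \<union> {u}" using lu by auto
      have "emeasure (interval_measure H) {l<..u} = emeasure (interval_measure H) {l<..<u} + emeasure (interval_measure H) {u}"
        unfolding eq by (rule plus_emeasure[symmetric]) auto
      then show ?thesis using sing emeasure_interval_measure_Ioc[OF lu mono cr] by simp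
    qed auto
  qed
  have "lborel = S"
  proof (rule lborel_eqI)
    fix l u :: real assume "\<And>b. b \<in> Basis \<Longrightarrow> l \<bullet> b \<le> u \<bullet> b"
    then have lu: "l \<le> u" by simp
    have "F l \<le> F u" "G l \<le> G u" using lu F(1) G(1) by (auto simp: mono_def)
    then show "emeasure S (box l u) = ennreal (\<Prod>b\<in>Basis. (u - l) \<bullet> b)"
      using FG[of l] FG[of u]
      by (simp add: emS box_real Ioo[OF F lu] Ioo[OF G lu] ennreal_plus[symmetric] algebra_simps del: ennreal_plus)
  qed simp
  then show ?thesis using emS[OF A] by simp
qed

text \<open>Domination by Lebesgue measure makes the Stieltjes measure of \<open>F\<close>
  absolutely continuous, so \<open>F\<close> is the indefinite integral of a Radon-Nikodym density
  and Lebesgue differentiation applies.\<close>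

lemma monotone_pair_AE_differentiable:
  assumes F: "mono F" "continuous_on UNIV F"
    and G: "mono G" "continuous_on UNIV G" and FG: "\<And>x::real. F x + G x = x"
  shows "AE x in lebesgue. F differentiable (at x)"
proof -
  let ?m = "interval_measure F"
  have mono: "\<And>x y. x \<le> y \<Longrightarrow> F x \<le> F y" using F(1) by (simp add: mono_def)
  have "absolutely_continuous lborel ?m"
    unfolding absolutely_continuous_def
  proof
    fix A assume "A \<in> null_sets (lborel :: real measure)"
    then show "A \<in> null_sets ?m"
      using interval_measure_le_lborel[OF assms, of A] by (auto simp: null_sets_def)
  qed
  then obtain h where h[measurable]: "h \<in> borel_measurable lborel" and hd: "density lborel h = ?m"
    using sigma_finite_measure.Radon_Nikodym[OF sigma_finite_lborel, of ?m] by auto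
  have Icc: "(\<integral>\<^sup>+x. h x * indicator {a..b} x \<partial>lborel) = ennreal (F b - F a)" if "a \<le> b" for a b
  proof -
    have "(\<integral>\<^sup>+x. h x * indicator {a..b} x \<partial>lborel) = emeasure (density lborel h) {a..b}"
      by (subst emeasure_density) auto
    also have "\<dots> = ennreal (F b - F a)"
      unfolding hd using emeasure_interval_measure_Icc[OF that mono] F(2) by (simp add: continuous_on_subset)
    finally show ?thesis .
  qed
  \<comment> \<open>The density takes values in [0, \<infinity>]; it has to be finite almost
    everywhere before \<open>enn2real\<close> can be applied without changing its integrals.\<close>
  have fin: "AE x in lborel. h x \<noteq> \<infinity>"
  proof -
    have "AE x in lborel. \<forall>n::nat. h x * indicator {- real n..real n} x \<noteq> \<infinity>"
      unfolding AE_all_countable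
    proof
      fix n :: nat
      show "AE x in lborel. h x * indicator {- real n..real n} x \<noteq> \<infinity>"
        by (rule nn_integral_PInf_AE) (use Icc[of "- real n" "real n"] in auto)
    qed
    then show ?thesis
    proof (rule AE_mp, intro AE_I2 impI)
      fix x :: real assume *: "\<forall>n::nat. h x * indicator {- real n..real n} x \<noteq> \<infinity>"
      obtain n where "\<bar>x\<bar> \<le> real n" using real_arch_simple by blast
      then have "indicator {- real n..real n} x = (1::ennreal)" by (auto simp: indicator_def)
      then show "h x \<noteq> \<infinity>" using *[rule_format, of n] by simp
    qed
  qed
  define h' where "h' x = enn2real (h x)" for x
  have hI: "(h' has_integral (F b - F a)) {a..b}" if "a \<le> b" for a b
  proof -
    have "((\<lambda>x. h' x * indicator {a..b} x) has_integral (F b - F a)) UNIV"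
    proof (intro nn_integral_has_integral)
      have "(\<integral>\<^sup>+x. ennreal (h' x * indicator {a..b} x) \<partial>lborel) = (\<integral>\<^sup>+x. h x * indicator {a..b} x \<partial>lborel)"
        by (rule nn_integral_cong_AE) (use fin in eventually_elim, auto simp: h'_def indicator_def top.not_eq_extremum)
      then show "(\<integral>\<^sup>+x. ennreal (h' x * indicator {a..b} x) \<partial>lborel) = ennreal (F b - F a)"
        using Icc[OF that] by simp
    qed (use mono that in \<open>auto simp: h'_def\<close>)
    then have "((\<lambda>x. if x \<in> {a..b} then h' x else 0) has_integral (F b - F a)) UNIV"
      by (rule has_integral_eq[rotated]) (auto simp: indicator_def)
    then show ?thesis by (simp only: has_integral_restrict_UNIV)
  qed
  have "AE x in lebesgue. (F has_real_derivative h' x) (at x)"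
    by (rule AE_has_real_derivative_of_has_integral[OF hI])
  then show ?thesis
    by eventually_elim (auto simp: real_differentiable_def)
qed

text \<open>For a positive Lipschitz constant \<open>K\<close> of \<open>u\<close>, both x + u(x)/K
  and x - u(x)/K are nondecreasing, and their halves add up to x. The maximum with 1 makes
  \<open>K\<close> positive.\<close>

lemma lipschitz_AE_differentiable:
  fixes u :: "real \<Rightarrow> real"
  assumes L: "\<And>x y. \<bar>u x - u y\<bar> \<le> L * \<bar>x - y\<bar>"
  shows "AE x in lebesgue. u differentiable (at x)"
proof -
  define K where "K = max L 1"
  have "K > 0" by (auto simp: K_def)
  have K: "\<bar>u x - u y\<bar> \<le> K * \<bar>x - y\<bar>" for x y
    using L[of x y] mult_right_mono[of L K "\<bar>x - y\<bar>"] by (auto simp: K_def)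
  define F where "F x = (x + u x / K) / 2" for x
  define G where "G x = (x - u x / K) / 2" for x
  have cu: "continuous_on UNIV u"
    using K \<open>K > 0\<close> by (intro lipschitz_on_continuous_on[of K]) (auto simp: lipschitz_on_def dist_real_def)
  have b: "\<bar>u x / K - u y / K\<bar> \<le> \<bar>x - y\<bar>" for x y
    using K[of x y] \<open>K > 0\<close> by (simp add: diff_divide_distrib[symmetric] abs_divide divide_le_eq mult.commute)
  have "mono F" "mono G"
  proof -
    show "mono F"
    proof
      fix x y :: real assume "x \<le> y"
      then have "x + u x / K \<le> y + u y / K" using b[of x y] by (simp add: abs_le_iff)
      then show "F x \<le> F y" by (simp only: F_def divide_right_mono)
    qed
    show "mono G"
    proof
      fix x y :: real assume "x \<le> y"
      then have "x - u x / K \<le> y - u y / K" using b[of x y] by (simp add: abs_le_iff)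
      then show "G x \<le> G y" by (simp only: G_def divide_right_mono)
    qed
  qed
  moreover have "continuous_on UNIV F" "continuous_on UNIV G"
    unfolding F_def G_def using cu \<open>K > 0\<close> by (auto intro!: continuous_intros)
  moreover have "F x + G x = x" for x by (simp add: F_def G_def field_simps)
  ultimately have "AE x in lebesgue. F differentiable (at x)"
    by (intro monotone_pair_AE_differentiable[of F G])
  then show ?thesis
  proof eventually_elim
    case (elim x)
    have "u = (\<lambda>x. K * (2 * F x - x))"
      using \<open>K > 0\<close> by (auto simp: F_def field_simps)
    moreover have "(\<lambda>x. K * (2 * F x - x)) differentiable (at x)"
      using elim by (auto intro!: derivative_intros)
    ultimately show ?case by simp
  qed
qed

section \<open>Stepanov's theorem\<close>

text \<open>This is McShane's infimal convolution of \<open>f\<close> with the cone of slope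
  \<open>n\<close>. One point \<open>x0\<close> with the bound keeps the infimum finite; at any such
  point the downward cone from its value stays below \<open>f\<close>, so \<open>u\<close> touches
  \<open>f\<close> there.\<close>

lemma lipschitz_minorant:
  fixes f :: "real \<Rightarrow> real"
  assumes x0: "x0 \<in> J" "\<And>z. z \<in> J \<Longrightarrow> \<bar>f z - f x0\<bar> \<le> n * \<bar>z - x0\<bar>" and n: "0 \<le> n"
  obtains u where "\<And>y y'. \<bar>u y - u y'\<bar> \<le> n * \<bar>y - y'\<bar>" "\<And>y. y \<in> J \<Longrightarrow> u y \<le> f y"
    "\<And>x. x \<in> J \<Longrightarrow> (\<And>z. z \<in> J \<Longrightarrow> \<bar>f z - f x\<bar> \<le> n * \<bar>z - x\<bar>) \<Longrightarrow> u x = f x"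
proof -
  define u where "u y = (INF z\<in>J. f z + n * \<bar>y - z\<bar>)" for y
  have tri: "n * \<bar>y - y'\<bar> \<le> n * \<bar>y - z\<bar> + n * \<bar>z - y'\<bar>" for y y' z
    using n by (simp add: distrib_left[symmetric] mult_left_mono)
  have lower: "f x - n * \<bar>y - x\<bar> \<le> f z + n * \<bar>y - z\<bar>"
    if "x \<in> J" "\<And>z. z \<in> J \<Longrightarrow> \<bar>f z - f x\<bar> \<le> n * \<bar>z - x\<bar>" "z \<in> J" for x y z
    using that(2)[OF that(3)] tri[of z x y] by (simp add: abs_le_iff abs_minus_commute)
  have bdd: "bdd_below ((\<lambda>z. f z + n * \<bar>y - z\<bar>) ` J)" for y
    using lower[OF x0] by (intro bdd_belowI2)
  have half: "u y \<le> u y' + n * \<bar>y - y'\<bar>" for y y'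
  proof -
    have "u y - n * \<bar>y - y'\<bar> \<le> u y'"
      unfolding u_def[of y']
    proof (rule cINF_greatest)
      fix z assume z: "z \<in> J"
      have "u y \<le> f z + n * \<bar>y - z\<bar>"
        unfolding u_def by (rule cINF_lower[OF bdd z])
      then show "u y - n * \<bar>y - y'\<bar> \<le> f z + n * \<bar>y' - z\<bar>"
        using tri[of y z y'] by simp
    qed (use x0 in auto)
    then show ?thesis by simp
  qed
  have "\<bar>u y - u y'\<bar> \<le> n * \<bar>y - y'\<bar>" for y y'
    using half[of y y'] half[of y' y] by (simp add: abs_le_iff abs_minus_commute)
  moreover have uf: "u y \<le> f y" if "y \<in> J" for y
    using cINF_lower[OF bdd that, of y] by (simp add: u_def)
  moreover have "u x = f x" if "x \<in> J" "\<And>z. z \<in> J \<Longrightarrow> \<bar>f z - f x\<bar> \<le> n * \<bar>z - x\<bar>" for x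
  proof (rule antisym[OF uf[OF that(1)]])
    show "f x \<le> u x"
      unfolding u_def using lower[OF that, of _ x] that(1) by (intro cINF_greatest) auto
  qed
  ultimately show ?thesis using that by blast
qed

text \<open>\<open>v - u\<close> is nonnegative near \<open>x\<close> and vanishes at
  \<open>x\<close>, so the two derivatives agree; the difference quotient of \<open>f\<close> lies
  between those of \<open>u\<close> and \<open>v\<close>, in reversed order for negative
  increments.\<close>

lemma sandwich_differentiable:
  fixes f u v :: "real \<Rightarrow> real"
  assumes u: "u differentiable (at x)" and v: "v differentiable (at x)"
    and J: "open J" "x \<in> J" and eq: "u x = f x" "v x = f x"
    and le: "\<And>y. y \<in> J \<Longrightarrow> u y \<le> f y" "\<And>y. y \<in> J \<Longrightarrow> f y \<le> v y"
  shows "f differentiable (at x)"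
proof -
  obtain D where D: "(u has_real_derivative D) (at x)" using u by (auto simp: real_differentiable_def)
  obtain E where E: "(v has_real_derivative E) (at x)" using v by (auto simp: real_differentiable_def)
  obtain d where d: "d > 0" "ball x d \<subseteq> J" using J openE by blast
  have J': "y \<in> J" if "\<bar>x - y\<bar> < d" for y
    using d(2) that by (auto simp: dist_real_def)
  have "E - D = 0"
  proof (rule DERIV_local_min[OF DERIV_diff[OF E D] d(1)], intro allI impI)
    fix y assume "\<bar>x - y\<bar> < d"
    then show "v x - u x \<le> v y - u y" using le[of y] J'[of y] eq by simp
  qed
  with E have E: "(v has_real_derivative D) (at x)" by simp
  let ?q = "\<lambda>g h. (g (x + h) - g x) / h"
  have u0: "(\<lambda>h. ?q u h - D) \<midarrow>0\<rightarrow> 0" and v0: "(\<lambda>h. ?q v h - D) \<midarrow>0\<rightarrow> 0"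
    using D E unfolding DERIV_def by (simp_all add: LIM_zero_iff)
  have "(\<lambda>h. \<bar>?q u h - D\<bar> + \<bar>?q v h - D\<bar>) \<midarrow>0\<rightarrow> \<bar>0\<bar> + \<bar>0\<bar>"
    by (intro tendsto_add tendsto_rabs u0 v0)
  then have lim: "(\<lambda>h. \<bar>?q u h - D\<bar> + \<bar>?q v h - D\<bar>) \<midarrow>0\<rightarrow> 0" by simp
  have "(\<lambda>h. ?q f h - D) \<midarrow>0\<rightarrow> 0"
  proof (rule Lim_null_comparison[OF _ lim])
    show "\<forall>\<^sub>F h in at 0. norm (?q f h - D) \<le> \<bar>?q u h - D\<bar> + \<bar>?q v h - D\<bar>"
      unfolding eventually_at
    proof (intro exI[of _ d] conjI ballI impI d(1))
      fix h :: real assume h: "h \<noteq> 0 \<and> dist h 0 < d"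
      then have J: "x + h \<in> J" using J'[of "x + h"] by (simp add: dist_real_def)
      have a: "u (x + h) - u x \<le> f (x + h) - f x" "f (x + h) - f x \<le> v (x + h) - v x"
        using le[OF J] eq by auto
      have "?q u h \<le> ?q f h \<and> ?q f h \<le> ?q v h \<or> ?q v h \<le> ?q f h \<and> ?q f h \<le> ?q u h"
      proof (cases "h > 0")
        case True then show ?thesis using a by (intro disjI1 conjI divide_right_mono) auto
      next
        case False then show ?thesis using a by (intro disjI2 conjI divide_right_mono_neg) auto
      qed
      then show "norm (?q f h - D) \<le> \<bar>?q u h - D\<bar> + \<bar>?q v h - D\<bar>" by auto
    qed
  qed
  then have "(f has_real_derivative D) (at x)"
    unfolding DERIV_def by (simp add: LIM_zero_iff)
  then show ?thesis by (auto simp: real_differentiable_def)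
qed

text \<open>The Lipschitz minorants of \<open>f\<close> and of \<open>- f\<close> enclose
  \<open>f\<close> on the interval and touch it at every point with the bound, and both are
  differentiable almost everywhere.\<close>

lemma AE_differentiable_of_uniform_bound:
  fixes f :: "real \<Rightarrow> real"
  assumes n: "0 \<le> n"
  shows "AE x in lebesgue. x \<in> {a<..<b} \<and> (\<forall>z\<in>{a<..<b}. \<bar>f z - f x\<bar> \<le> n * \<bar>z - x\<bar>)
    \<longrightarrow> f differentiable (at x)"
proof (cases "\<exists>x0\<in>{a<..<b}. \<forall>z\<in>{a<..<b}. \<bar>f z - f x0\<bar> \<le> n * \<bar>z - x0\<bar>")
  case True
  then obtain x0 where x0: "x0 \<in> {a<..<b}" "\<And>z. z \<in> {a<..<b} \<Longrightarrow> \<bar>f z - f x0\<bar> \<le> n * \<bar>z - x0\<bar>"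
    by blast
  obtain u where u: "\<And>y y'. \<bar>u y - u y'\<bar> \<le> n * \<bar>y - y'\<bar>" "\<And>y. y \<in> {a<..<b} \<Longrightarrow> u y \<le> f y"
    "\<And>x. x \<in> {a<..<b} \<Longrightarrow> (\<And>z. z \<in> {a<..<b} \<Longrightarrow> \<bar>f z - f x\<bar> \<le> n * \<bar>z - x\<bar>) \<Longrightarrow> u x = f x"
    by (rule lipschitz_minorant[OF x0 n]) blast+
  have x0': "\<And>z. z \<in> {a<..<b} \<Longrightarrow> \<bar>- f z - - f x0\<bar> \<le> n * \<bar>z - x0\<bar>"
    using x0(2) by (simp add: abs_minus_commute)
  obtain w where w: "\<And>y y'. \<bar>w y - w y'\<bar> \<le> n * \<bar>y - y'\<bar>" "\<And>y. y \<in> {a<..<b} \<Longrightarrow> w y \<le> - f y"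
    "\<And>x. x \<in> {a<..<b} \<Longrightarrow> (\<And>z. z \<in> {a<..<b} \<Longrightarrow> \<bar>- f z - - f x\<bar> \<le> n * \<bar>z - x\<bar>) \<Longrightarrow> w x = - f x"
    by (rule lipschitz_minorant[OF x0(1) x0' n]) blast+
  from lipschitz_AE_differentiable[OF u(1)] lipschitz_AE_differentiable[OF w(1)]
  show ?thesis
  proof eventually_elim
    case (elim x)
    show ?case
    proof
      assume x: "x \<in> {a<..<b} \<and> (\<forall>z\<in>{a<..<b}. \<bar>f z - f x\<bar> \<le> n * \<bar>z - x\<bar>)"
      have wx: "w x = - f x" by (rule w(3)) (use x in \<open>auto simp: abs_minus_commute\<close>)
      show "f differentiable (at x)"
      proof (rule sandwich_differentiable[OF elim(1), of "\<lambda>y. - w y" "{a<..<b}"])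
        show "(\<lambda>y. - w y) differentiable (at x)" using elim(2) by (rule differentiable_minus)
        show "u x = f x" using x u(3) by blast
        show "f y \<le> - w y" if "y \<in> {a<..<b}" for y using w(2)[OF that] by simp
      qed (use x u(2) wx in auto)
    qed
  qed
next
  case False
  then show ?thesis by (intro AE_I2) blast
qed

definition locally_lipschitz_at :: "(real \<Rightarrow> real) \<Rightarrow> real \<Rightarrow> bool" where
  "locally_lipschitz_at f x \<longleftrightarrow> (\<exists>C d. 0 < d \<and> (\<forall>z. \<bar>z - x\<bar> < d \<longrightarrow> \<bar>f z - f x\<bar> \<le> C * \<bar>z - x\<bar>))"

lemma locally_lipschitz_at_rational_interval:
  assumes "locally_lipschitz_at f x" "0 < r"
  obtains a b :: real and n :: nat where "a \<in> \<rat>" "b \<in> \<rat>" "x \<in> {a<..<b}" "b - a < r"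
    "\<forall>z\<in>{a<..<b}. \<bar>f z - f x\<bar> \<le> real n * \<bar>z - x\<bar>"
proof -
  obtain C d where d: "0 < d" "\<And>z. \<bar>z - x\<bar> < d \<Longrightarrow> \<bar>f z - f x\<bar> \<le> C * \<bar>z - x\<bar>"
    using assms(1) by (auto simp: locally_lipschitz_at_def)
  define e where "e = min d (r / 2)"
  have e: "0 < e" "e \<le> d" "e \<le> r / 2" using d(1) assms(2) by (auto simp: e_def)
  obtain a where a: "a \<in> \<rat>" "x - e < a" "a < x" using Rats_dense_in_real[of "x - e" x] e by auto
  obtain b where b: "b \<in> \<rat>" "x < b" "b < x + e" using Rats_dense_in_real[of x "x + e"] e by auto
  obtain n :: nat where n: "C \<le> real n" using real_arch_simple by blast
  have "\<bar>f z - f x\<bar> \<le> real n * \<bar>z - x\<bar>" if "z \<in> {a<..<b}" for z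
    using d(2)[of z] that a b e mult_right_mono[OF n, of "\<bar>z - x\<bar>"] by (auto simp: abs_less_iff)
  then show ?thesis using that[of a b n] a b e by auto
qed

text \<open>A local Lipschitz bound at x holds on an interval with rational ends around x and with a
  natural number as constant, so countably many instances of the uniform case suffice.\<close>

theorem stepanov:
  fixes f :: "real \<Rightarrow> real"
  shows "AE x in lebesgue. locally_lipschitz_at f x \<longrightarrow> f differentiable (at x)"
proof -
  have "AE x in lebesgue. \<forall>a\<in>\<rat>. \<forall>b\<in>\<rat>. \<forall>n::nat. x \<in> {a<..<b} \<and> (\<forall>z\<in>{a<..<b}. \<bar>f z - f x\<bar> \<le> real n * \<bar>z - x\<bar>)
    \<longrightarrow> f differentiable (at x)"
    by (intro AE_ball_countable' AE_all_countable[THEN iffD2] allI AE_differentiable_of_uniform_bound countable_rat) auto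
  then show ?thesis
  proof eventually_elim
    case (elim x)
    show ?case
    proof
      assume "locally_lipschitz_at f x"
      then obtain a b :: real and n :: nat where "a \<in> \<rat>" "b \<in> \<rat>" "x \<in> {a<..<b}"
        "\<forall>z\<in>{a<..<b}. \<bar>f z - f x\<bar> \<le> real n * \<bar>z - x\<bar>"
        using locally_lipschitz_at_rational_interval[of f x 1] by (metis zero_less_one)
      then show "f differentiable (at x)" using elim by blast
    qed
  qed
qed

section \<open>Slopes over dyadic cells\<close>

definition slope :: "(real \<Rightarrow> real) \<Rightarrow> real \<Rightarrow> real \<Rightarrow> real" where
  "slope f a b = (f b - f a) / (b - a)"

fun dyadic_cell :: "nat \<Rightarrow> real \<Rightarrow> real \<Rightarrow> real \<Rightarrow> real \<times> real" where
  "dyadic_cell 0 a b x = (a, b)"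
| "dyadic_cell (Suc k) a b x =
    (if x < (a + b) / 2 then dyadic_cell k a ((a + b) / 2) x else dyadic_cell k ((a + b) / 2) b x)"

definition cell_slope :: "(real \<Rightarrow> real) \<Rightarrow> nat \<Rightarrow> real \<Rightarrow> real \<Rightarrow> real \<Rightarrow> real" where
  "cell_slope f k a b x = slope f (fst (dyadic_cell k a b x)) (snd (dyadic_cell k a b x))"

text \<open>The points where, within \<open>n\<close> halvings, some slope exceeds \<open>L\<close> before the sum of the squared slope
  increments exceeds \<open>N\<close>. Both halves of a cell have the same squared increment, so whether the budget
  \<open>N\<close> is exhausted is known before the cell is halved.\<close>

fun dyadic_bad :: "(real \<Rightarrow> real) \<Rightarrow> real \<Rightarrow> nat \<Rightarrow> real \<Rightarrow> real \<Rightarrow> real \<Rightarrow> real set" where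
  "dyadic_bad f L 0 a b N = (if L < \<bar>slope f a b\<bar> then {a..<b} else {})"
| "dyadic_bad f L (Suc n) a b N =
    (if L < \<bar>slope f a b\<bar> then {a..<b}
     else if N < (slope f a ((a + b) / 2) - slope f a b)\<^sup>2 then {}
     else dyadic_bad f L n a ((a + b) / 2) (N - (slope f a ((a + b) / 2) - slope f a b)\<^sup>2) \<union>
          dyadic_bad f L n ((a + b) / 2) b (N - (slope f a ((a + b) / 2) - slope f a b)\<^sup>2))"

lemma sets_dyadic_bad [measurable]: "dyadic_bad f L n a b N \<in> sets borel"
  by (induction n arbitrary: a b N) auto

lemma dyadic_bad_Suc: "dyadic_bad f L n a b N \<subseteq> dyadic_bad f L (Suc n) a b N"
proof (induction n arbitrary: a b N)
  case (Suc n)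
  let ?m = "(a + b) / 2" and ?d = "slope f a ((a + b) / 2) - slope f a b"
  note unf = dyadic_bad.simps(2)[of f L _ a b N]
  show ?case
    unfolding unf[of n] unf[of "Suc n"]
    using Suc[of a ?m "N - ?d\<^sup>2"] Suc[of ?m b "N - ?d\<^sup>2"]
    by (auto simp del: dyadic_bad.simps)
qed auto

text \<open>The slope of a cell is the mean of the slopes of its halves. The opposite signs give the
  martingale property, and the equal absolute values make the squared increment known before a half
  is chosen.\<close>

lemma slope_midpoint:
  assumes "a < b"
  shows "slope f ((a + b) / 2) b - slope f a b = - (slope f a ((a + b) / 2) - slope f a b)"
proof -
  have *: "b - (a + b) / 2 = (b - a) / 2" "(a + b) / 2 - a = (b - a) / 2" by (auto simp: field_simps)
  show ?thesis unfolding slope_def * using assms by (simp add: divide_simps)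
qed

text \<open>A maximal inequality of Kolmogorov type. The potential (length) * (slope^2 + remaining
  budget) is conserved by halving: with slopes M + d and M - d of the halves the mean square grows
  by d^2, exactly what the budget loses. On a cell that is declared bad the potential is at least
  L^2 times the length.\<close>

lemma emeasure_dyadic_bad:
  assumes "0 < L" "0 \<le> N" "a < b"
  shows "emeasure lborel (dyadic_bad f L n a b N) \<le> ennreal ((b - a) * ((slope f a b)\<^sup>2 + N) / L\<^sup>2)"
  using assms(2,3)
proof (induction n arbitrary: a b N)
  have large: "emeasure lborel {a..<b} \<le> ennreal ((b - a) * ((slope f a b)\<^sup>2 + N) / L\<^sup>2)"
    if "a < b" "0 \<le> N" "L < \<bar>slope f a b\<bar>" for a b N
  proof -
    have "L\<^sup>2 \<le> (slope f a b)\<^sup>2" using that(3) assms(1) by (simp add: abs_le_square_iff[symmetric])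
    then have "1 \<le> ((slope f a b)\<^sup>2 + N) / L\<^sup>2" using that(2) assms(1) by simp
    then have "(b - a) * 1 \<le> (b - a) * (((slope f a b)\<^sup>2 + N) / L\<^sup>2)" using that(1) by (intro mult_left_mono) auto
    then show ?thesis using that(1) by (simp add: ennreal_leI)
  qed
  {
    case 0
    then show ?case using large[of a b N] by auto
  next
    case (Suc n)
    let ?m = "(a + b) / 2" and ?d = "slope f a ((a + b) / 2) - slope f a b"
    show ?case
    proof (cases "L < \<bar>slope f a b\<bar> \<or> N < ?d\<^sup>2")
      case True
      then show ?thesis using large[of a b N] Suc.prems by auto
    next
      case False
      have m: "a < ?m" "?m < b" using Suc.prems by auto
      have N: "0 \<le> N - ?d\<^sup>2" using False by auto
      have "emeasure lborel (dyadic_bad f L (Suc n) a b N) =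
          emeasure lborel (dyadic_bad f L n a ?m (N - ?d\<^sup>2) \<union> dyadic_bad f L n ?m b (N - ?d\<^sup>2))"
        using False by auto
      also have "\<dots> \<le> emeasure lborel (dyadic_bad f L n a ?m (N - ?d\<^sup>2)) + emeasure lborel (dyadic_bad f L n ?m b (N - ?d\<^sup>2))"
        by (rule emeasure_subadditive) auto
      also have "\<dots> \<le> ennreal ((?m - a) * ((slope f a ?m)\<^sup>2 + (N - ?d\<^sup>2)) / L\<^sup>2) + ennreal ((b - ?m) * ((slope f ?m b)\<^sup>2 + (N - ?d\<^sup>2)) / L\<^sup>2)"
        by (intro add_mono Suc.IH N m)
      also have "\<dots> = ennreal ((?m - a) * ((slope f a ?m)\<^sup>2 + (N - ?d\<^sup>2)) / L\<^sup>2 + (b - ?m) * ((slope f ?m b)\<^sup>2 + (N - ?d\<^sup>2)) / L\<^sup>2)"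
        using m N assms(1) by (intro ennreal_plus[symmetric] divide_nonneg_nonneg mult_nonneg_nonneg add_nonneg_nonneg) auto
      also have "(?m - a) * ((slope f a ?m)\<^sup>2 + (N - ?d\<^sup>2)) / L\<^sup>2 + (b - ?m) * ((slope f ?m b)\<^sup>2 + (N - ?d\<^sup>2)) / L\<^sup>2
          = (b - a) * ((slope f a b)\<^sup>2 + N) / L\<^sup>2"
      proof -
        obtain M d where M: "slope f a b = M" and d: "?d = d" by blast
        have a1: "slope f a ?m = M + d" using M d by simp
        have a2: "slope f ?m b = M - d" using slope_midpoint[OF Suc.prems(2), of f] M d by simp
        have h: "?m - a = (b - a) / 2" "b - ?m = (b - a) / 2" by (auto simp: field_simps)
        show ?thesis unfolding d a1 a2 h M
          using assms(1) by (simp add: field_simps power2_eq_square)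
      qed
      finally show ?thesis .
    qed
  }
qed

lemma mem_dyadic_bad:
  assumes "x \<in> {a..<b}" "k \<le> n" "L < \<bar>cell_slope f k a b x\<bar>"
    "(\<Sum>j<k. (cell_slope f (Suc j) a b x - cell_slope f j a b x)\<^sup>2) \<le> N"
  shows "x \<in> dyadic_bad f L n a b N"
  using assms
proof (induction n arbitrary: k a b N)
  case 0
  then show ?case by (auto simp: cell_slope_def)
next
  case (Suc n)
  let ?m = "(a + b) / 2" and ?d = "slope f a ((a + b) / 2) - slope f a b"
  show ?case
  proof (cases "L < \<bar>slope f a b\<bar>")
    case True
    then show ?thesis using Suc.prems(1) by auto
  next
    case False
    then obtain k' where k': "k = Suc k'" using Suc.prems(3) by (cases k) (auto simp: cell_slope_def)
    have ab: "a < b" using Suc.prems(1) by auto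
    define a' b' where "a' = (if x < ?m then a else ?m)" and "b' = (if x < ?m then ?m else b)"
    have shift: "cell_slope f (Suc j) a b x = cell_slope f j a' b' x" for j
      by (auto simp: cell_slope_def a'_def b'_def)
    \<comment> \<open>The recursion records the increment into the left half; its square does not
      depend on which half contains \<open>x\<close>.\<close>
    have first: "(cell_slope f (Suc 0) a b x - cell_slope f 0 a b x)\<^sup>2 = ?d\<^sup>2"
      using slope_midpoint[OF ab, of f] by (simp add: cell_slope_def power2_commute[of _ "slope f a b"] flip: power2_minus[of "slope f a ?m - slope f a b"])
    have sum: "?d\<^sup>2 + (\<Sum>j<k'. (cell_slope f (Suc j) a' b' x - cell_slope f j a' b' x)\<^sup>2) \<le> N"
      using Suc.prems(4) unfolding k' sum.lessThan_Suc_shift first by (simp only: shift)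
    have "0 \<le> (\<Sum>j<k'. (cell_slope f (Suc j) a' b' x - cell_slope f j a' b' x)\<^sup>2)"
      by (intro sum_nonneg) auto
    then have dN: "\<not> N < ?d\<^sup>2" using sum by linarith
    have "x \<in> dyadic_bad f L n a' b' (N - ?d\<^sup>2)"
    proof (rule Suc.IH)
      show "x \<in> {a'..<b'}" using Suc.prems(1) by (auto simp: a'_def b'_def)
      show "k' \<le> n" using Suc.prems(2) k' by simp
      show "L < \<bar>cell_slope f k' a' b' x\<bar>" using Suc.prems(3) k' shift by simp
    qed (use sum in simp)
    then show ?thesis using False dN by (auto simp: a'_def b'_def split: if_splits)
  qed
qed

text \<open>For a fixed budget \<open>N\<close> the points with a slope beyond \<open>L\<close> form
  a set of measure O(1/L^2), so the points that are bad for every \<open>L\<close> are null. Natural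
  numbers \<open>N\<close> exhaust all finite sums of squared increments.\<close>

lemma AE_cell_slope_bounded:
  assumes "a < b"
  shows "AE x in lborel. x \<in> {a..<b} \<and>
      (\<Sum>k. ennreal ((cell_slope f (Suc k) a b x - cell_slope f k a b x)\<^sup>2)) < \<infinity>
    \<longrightarrow> (\<exists>B::nat. \<forall>k. \<bar>cell_slope f k a b x\<bar> \<le> real B)"
proof -
  define U where "U L N = (\<Union>n. dyadic_bad f L n a b N)" for L N
  have [measurable]: "U L N \<in> sets borel" for L N unfolding U_def by auto
  have U: "emeasure lborel (U L N) \<le> ennreal ((b - a) * ((slope f a b)\<^sup>2 + N) / L\<^sup>2)" if "0 < L" "0 \<le> N" for L N
  proof -
    have "emeasure lborel (U L N) = (SUP n. emeasure lborel (dyadic_bad f L n a b N))"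
      unfolding U_def
      by (intro SUP_emeasure_incseq[symmetric] incseq_SucI dyadic_bad_Suc) auto
    also have "\<dots> \<le> ennreal ((b - a) * ((slope f a b)\<^sup>2 + N) / L\<^sup>2)"
      by (intro SUP_least emeasure_dyadic_bad that assms)
    finally show ?thesis .
  qed
  have null: "AE x in lborel. x \<notin> (\<Inter>L::nat. U (real (Suc L)) (real N))" for N :: nat
  proof (rule AE_not_in, rule null_setsI)
    let ?I = "\<Inter>L::nat. U (real (Suc L)) (real N)"
    define c where "c = (b - a) * ((slope f a b)\<^sup>2 + real N)"
    have "(\<lambda>n. ennreal (c / (real (Suc n))\<^sup>2)) \<longlonglongrightarrow> ennreal 0"
    proof (rule tendsto_ennrealI)
      have "(\<lambda>n. c * (inverse (real (Suc n)))\<^sup>2) \<longlonglongrightarrow> c * 0\<^sup>2"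
        by (intro tendsto_intros LIMSEQ_inverse_real_of_nat)
      then show "(\<lambda>n. c / (real (Suc n))\<^sup>2) \<longlonglongrightarrow> 0" by (simp add: divide_inverse power_inverse)
    qed
    moreover have "emeasure lborel ?I \<le> ennreal (c / (real (Suc n))\<^sup>2)" for n
    proof -
      have "emeasure lborel ?I \<le> emeasure lborel (U (real (Suc n)) (real N))"
        by (intro emeasure_mono) auto
      also have "\<dots> \<le> ennreal (c / (real (Suc n))\<^sup>2)"
        unfolding c_def by (intro U) auto
      finally show ?thesis .
    qed
    ultimately have "emeasure lborel ?I \<le> ennreal 0"
      by (intro LIMSEQ_le_const) auto
    then show "emeasure lborel ?I = 0" by simp
  qed auto
  then have "AE x in lborel. \<forall>N::nat. x \<notin> (\<Inter>L::nat. U (real (Suc L)) (real N))"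
    by (simp only: AE_all_countable) blast
  then show ?thesis
  proof eventually_elim
    case (elim x)
    show ?case
    proof (intro impI)
      assume *: "x \<in> {a..<b} \<and> (\<Sum>k. ennreal ((cell_slope f (Suc k) a b x - cell_slope f k a b x)\<^sup>2)) < \<infinity>"
      let ?t = "\<lambda>k. (cell_slope f (Suc k) a b x - cell_slope f k a b x)\<^sup>2"
      have sm: "summable ?t" using * by (intro summable_suminf_not_top) auto
      obtain N :: nat where N: "suminf ?t \<le> real N" using real_arch_simple by blast
      have partial: "(\<Sum>j<k. ?t j) \<le> real N" for k
        using sum_le_suminf[OF sm, of "{..<k}"] N by auto
      obtain L :: nat where L: "x \<notin> U (real (Suc L)) (real N)" using elim by blast
      have "\<bar>cell_slope f k a b x\<bar> \<le> real (Suc L)" for k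
      proof (rule ccontr)
        assume "\<not> \<bar>cell_slope f k a b x\<bar> \<le> real (Suc L)"
        then have "x \<in> dyadic_bad f (real (Suc L)) k a b (real N)"
          using * partial by (intro mem_dyadic_bad[of x a b k k]) auto
        then show False using L by (auto simp: U_def)
      qed
      then show "\<exists>B::nat. \<forall>k. \<bar>cell_slope f k a b x\<bar> \<le> real B" by blast
    qed
  qed
qed

text \<open>If \<open>v\<close> is the distance from the origin of a grid of mesh \<open>w\<close> to a point, then \<open>grid_pt w v\<close> is the
  displacement from that point to the left end of its cell. Below \<open>l\<close> is the mesh of generation \<open>0\<close>.\<close>

definition grid_pt :: "real \<Rightarrow> real \<Rightarrow> real" where
  "grid_pt w v = w * of_int \<lfloor>v / w\<rfloor> - v"

lemma grid_pt_bounds: "0 < w \<Longrightarrow> - w < grid_pt w v" "0 < w \<Longrightarrow> grid_pt w v \<le> 0"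
proof -
  assume w: "0 < w"
  have "w * (v / w) < w * (of_int \<lfloor>v / w\<rfloor> + 1)" using w floor_correct[of "v / w"] by (intro mult_strict_left_mono) auto
  then show "- w < grid_pt w v" using w by (simp add: grid_pt_def algebra_simps)
  have "w * of_int \<lfloor>v / w\<rfloor> \<le> w * (v / w)" using w by (intro mult_left_mono) auto
  then show "grid_pt w v \<le> 0" using w by (simp add: grid_pt_def)
qed

text \<open>The cell depends only on the position of \<open>x\<close> modulo the mesh. Entering the
  right half moves the origin by 2^k meshes of the finer grid, which shifts the floor by an integer
  and leaves \<open>grid_pt\<close> unchanged.\<close>

lemma dyadic_cell_eq:
  assumes "a \<le> x" "x < b"
  shows "dyadic_cell k a b x = (x + grid_pt ((b - a) / 2 ^ k) (x - a), x + grid_pt ((b - a) / 2 ^ k) (x - a) + (b - a) / 2 ^ k)"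
  using assms
proof (induction k arbitrary: a b)
  case 0
  have "\<lfloor>(x - a) / (b - a)\<rfloor> = 0" using 0 by (intro floor_unique) (auto simp: field_simps)
  then show ?case by (simp add: grid_pt_def)
next
  case (Suc k)
  let ?m = "(a + b) / 2"
  define w where "w = (b - a) / 2 ^ Suc k"
  have w: "w > 0" using Suc.prems by (simp add: w_def)
  have w1: "(?m - a) / 2 ^ k = w" "(b - ?m) / 2 ^ k = w"
    by (auto simp: w_def field_simps)
  show ?case
  proof (cases "x < ?m")
    case True
    then show ?thesis
      unfolding w_def[symmetric] using Suc.IH[of a ?m, unfolded w1] Suc.prems(1) by simp
  next
    case False
    have shift: "x - ?m = (x - a) - w * of_int (2 ^ k)" by (simp add: w_def field_simps)
    from shift have "(x - ?m) / w = ((x - a) - w * of_int (2 ^ k)) / w" by (simp only:)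
    also have "\<dots> = (x - a) / w - of_int (2 ^ k)"
      using w by (simp add: diff_divide_distrib)
    finally have "(x - ?m) / w = (x - a) / w - of_int (2 ^ k)" .
    then have fl: "\<lfloor>(x - ?m) / w\<rfloor> = \<lfloor>(x - a) / w\<rfloor> - 2 ^ k"
      by (simp only: floor_diff_of_int)
    have "grid_pt w (x - ?m) = grid_pt w (x - a)"
      unfolding grid_pt_def fl of_int_diff unfolding shift by (simp add: right_diff_distrib)
    show ?thesis
      unfolding w_def[symmetric] using False Suc.IH[of ?m b, unfolded w1] Suc.prems
        \<open>grid_pt w (x - ?m) = grid_pt w (x - a)\<close> by simp
  qed
qed

lemma grid_pt_half:
  assumes "0 < w"
  shows "grid_pt (w / 2) v = grid_pt w v \<or> grid_pt (w / 2) v = grid_pt w v + w / 2"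
proof -
  have e: "v / (w / 2) = 2 * (v / w)" by simp
  have "\<lfloor>2 * (v / w)\<rfloor> = 2 * \<lfloor>v / w\<rfloor> \<or> \<lfloor>2 * (v / w)\<rfloor> = 2 * \<lfloor>v / w\<rfloor> + 1" by linarith
  then show ?thesis unfolding grid_pt_def e using assms by (auto simp: field_simps)
qed

section \<open>Random grids\<close>

lemma measurable_grid_pt [measurable (raw)]:
  assumes [measurable]: "f \<in> borel_measurable M" "g \<in> borel_measurable M"
  shows "(\<lambda>x. grid_pt (f x) (g x)) \<in> borel_measurable M"
  unfolding grid_pt_def by measurable

text \<open>\<open>grid_pt w\<close> has period \<open>w\<close> and runs through
  \<open>{-w<..0}\<close> once in each period, so \<open>J\<close> periods contribute
  \<open>J\<close> equal integrals. The next two estimates compare the unit interval with a whole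
  number of periods.\<close>

lemma nn_integral_grid_pt:
  fixes G :: "real \<Rightarrow> ennreal"
  assumes [measurable]: "G \<in> borel_measurable borel" and w: "0 < w"
  shows "(\<integral>\<^sup>+v. G (grid_pt w v) * indicator {0..<real J * w} v \<partial>lborel) =
    of_nat J * (\<integral>\<^sup>+s. G s * indicator {-w<..0} s \<partial>lborel)"
proof (induction J)
  case (Suc J)
  have split: "G (grid_pt w v) * indicator {0..<real (Suc J) * w} v =
      G (grid_pt w v) * indicator {0..<real J * w} v + G (real J * w - v) * indicator {real J * w..<real (Suc J) * w} v" for v
  proof (cases "v \<in> {real J * w..<real (Suc J) * w}")
    case True
    have "\<lfloor>v / w\<rfloor> = int J"
      using True w by (intro floor_unique) (auto simp: field_simps)
    then have "grid_pt w v = real J * w - v" by (simp add: grid_pt_def)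
    moreover have "v \<notin> {0..<real J * w}" "v \<in> {0..<real (Suc J) * w}"
      using True order_trans[of 0 "real J * w" v] w by auto
    ultimately show ?thesis using True by simp
  next
    case False
    then have "v \<in> {0..<real (Suc J) * w} \<longleftrightarrow> v \<in> {0..<real J * w}"
      using w by (auto simp: algebra_simps)
    then show ?thesis using False by (simp add: indicator_def)
  qed
  have "(\<integral>\<^sup>+s. G s * indicator {-w<..0} s \<partial>lborel) =
      (\<integral>\<^sup>+v. G (real J * w - v) * indicator {-w<..0} (real J * w - v) \<partial>lborel)"
    using nn_integral_real_affine[of "\<lambda>s. G s * indicator {-w<..0} s" "-1" "real J * w"] by simp
  also have "\<dots> = (\<integral>\<^sup>+v. G (real J * w - v) * indicator {real J * w..<real (Suc J) * w} v \<partial>lborel)"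
    by (intro nn_integral_cong) (auto simp: indicator_def algebra_simps)
  finally show ?case
    unfolding split by (subst nn_integral_add) (simp_all add: Suc distrib_right add.commute)
qed simp

lemma nn_integral_grid_pt_le:
  fixes G :: "real \<Rightarrow> ennreal"
  assumes [measurable]: "G \<in> borel_measurable borel" and l: "1 \<le> l"
  shows "(\<integral>\<^sup>+v. G (grid_pt (l / 2 ^ k) v) * indicator {0..<1} v \<partial>lborel) \<le>
    2 ^ k * (\<integral>\<^sup>+s. G s * indicator {-(l / 2 ^ k)<..0} s \<partial>lborel)"
proof -
  have "(\<integral>\<^sup>+v. G (grid_pt (l / 2 ^ k) v) * indicator {0..<1} v \<partial>lborel)
     \<le> (\<integral>\<^sup>+v. G (grid_pt (l / 2 ^ k) v) * indicator {0..<real (2 ^ k) * (l / 2 ^ k)} v \<partial>lborel)"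
    using l by (intro nn_integral_mono mult_left_mono) (auto simp: indicator_def)
  also have "\<dots> = of_nat (2 ^ k) * (\<integral>\<^sup>+s. G s * indicator {-(l / 2 ^ k)<..0} s \<partial>lborel)"
    using l by (intro nn_integral_grid_pt) auto
  finally show ?thesis by simp
qed

text \<open>Here whole periods have to fit into the unit interval. Since \<open>l\<close> may be as
  large as 2, the 2^k periods are taken from generation \<open>Suc k\<close>, where their total
  length is l/2.\<close>

lemma nn_integral_grid_pt_ge:
  fixes G :: "real \<Rightarrow> ennreal"
  assumes [measurable]: "G \<in> borel_measurable borel" and l: "0 < l" "l \<le> 2"
  shows "2 ^ k * (\<integral>\<^sup>+s. G s * indicator {-(l / 2 ^ Suc k)<..0} s \<partial>lborel) \<le>
    (\<integral>\<^sup>+v. G (grid_pt (l / 2 ^ Suc k) v) * indicator {0..<1} v \<partial>lborel)"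
proof -
  have "2 ^ k * (\<integral>\<^sup>+s. G s * indicator {-(l / 2 ^ Suc k)<..0} s \<partial>lborel) =
      of_nat (2 ^ k) * (\<integral>\<^sup>+s. G s * indicator {-(l / 2 ^ Suc k)<..0} s \<partial>lborel)" by simp
  also have "\<dots> = (\<integral>\<^sup>+v. G (grid_pt (l / 2 ^ Suc k) v) * indicator {0..<real (2 ^ k) * (l / 2 ^ Suc k)} v \<partial>lborel)"
    using l by (intro nn_integral_grid_pt[symmetric]) auto
  also have "\<dots> \<le> (\<integral>\<^sup>+v. G (grid_pt (l / 2 ^ Suc k) v) * indicator {0..<1} v \<partial>lborel)"
    using l by (intro nn_integral_mono mult_left_mono) (auto simp: indicator_def)
  finally show ?thesis .
qed

section \<open>Mean square jumps over random grids and the local Sobolev seminorm of order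
  1/2\<close>

definition gagliardo :: "(real \<Rightarrow> real) \<Rightarrow> real \<Rightarrow> ennreal" where
  "gagliardo \<phi> \<delta> = (\<integral>\<^sup>+s. \<integral>\<^sup>+t. ennreal (\<bar>\<phi> s - \<phi> t\<bar>\<^sup>2 / \<bar>s - t\<bar>\<^sup>2) * indicator {p. \<bar>fst p\<bar> + \<bar>snd p\<bar> < \<delta>} (s, t) \<partial>lborel \<partial>lborel)"

text \<open>The arguments of \<open>\<phi>\<close> are the displacements from a point to the two
  ends of its cell of generation \<open>k\<close>; later \<open>\<phi>\<close> is the difference
  quotient based at that point.\<close>

definition grid_jump :: "(real \<Rightarrow> real) \<Rightarrow> nat \<Rightarrow> real \<Rightarrow> real \<Rightarrow> real" where
  "grid_jump \<phi> k l v = \<phi> (grid_pt (l / 2 ^ k) v) - \<phi> (grid_pt (l / 2 ^ k) v + l / 2 ^ k)"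

lemma measurable_grid_jump [measurable (raw)]:
  assumes [measurable]: "\<phi> \<in> borel_measurable borel" "f \<in> borel_measurable M" "g \<in> borel_measurable M"
  shows "(\<lambda>x. grid_jump \<phi> k (f x) (g x)) \<in> borel_measurable M"
  unfolding grid_jump_def by measurable

lemma disjoint_dyadic_shells: "disjoint_family (\<lambda>k. {1 / 2 ^ k..<2 / 2 ^ k :: real})"
  unfolding disjoint_family_on_def
proof (intro ballI impI)
  fix m n :: nat assume "m \<noteq> n"
  have *: "{1 / 2 ^ m..<2 / 2 ^ m :: real} \<inter> {1 / 2 ^ n..<2 / 2 ^ n} = {}" if "m < n" for m n :: nat
  proof -
    have "(2::real) * 2 ^ m \<le> 2 ^ n" using power_increasing[of "Suc m" n "2::real"] that by simp
    then have "2 / 2 ^ n \<le> (1 / 2 ^ m :: real)" by (simp add: field_simps)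
    then show ?thesis by auto
  qed
  show "{1 / 2 ^ m..<2 / 2 ^ m :: real} \<inter> {1 / 2 ^ n..<2 / 2 ^ n} = {}"
    using *[of m n] *[of n m] \<open>m \<noteq> n\<close> by (cases "m < n") auto
qed

text \<open>For fixed \<open>l\<close>, averaging over \<open>v\<close> produces a factor 2^k, and
  the substitution u = l/2^k produces another one. On the shell u < 2/2^k the product 4^k is at most
  4/u^2, the singular kernel on the right.\<close>

lemma nn_integral_grid_jump_le:
  assumes \<phi>[measurable]: "\<phi> \<in> borel_measurable borel"
  shows "(\<integral>\<^sup>+l. \<integral>\<^sup>+v. ennreal ((grid_jump \<phi> k l v)\<^sup>2) * indicator {0..<1} v * indicator {1..<2} l \<partial>lborel \<partial>lborel)
    \<le> (\<integral>\<^sup>+u. (\<integral>\<^sup>+s. 4 * ennreal (\<bar>\<phi> s - \<phi> (s + u)\<bar>\<^sup>2 / \<bar>u\<bar>\<^sup>2) * indicator {-u<..0} s \<partial>lborel) * indicator {1 / 2 ^ k..<2 / 2 ^ k} u \<partial>lborel)"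
proof -
  define H where "H u = (\<integral>\<^sup>+s. (if - u < s \<and> s \<le> 0 then ennreal ((\<phi> s - \<phi> (s + u))\<^sup>2) else 0) \<partial>lborel)" for u
  have [measurable]: "H \<in> borel_measurable borel"
    unfolding H_def by measurable
  have "(\<integral>\<^sup>+l. \<integral>\<^sup>+v. ennreal ((grid_jump \<phi> k l v)\<^sup>2) * indicator {0..<1} v * indicator {1..<2} l \<partial>lborel \<partial>lborel)
     \<le> (\<integral>\<^sup>+l. 2 ^ k * (H (0 + (1 / 2 ^ k) * l) * indicator {1 / 2 ^ k..<2 / 2 ^ k} (0 + (1 / 2 ^ k) * l)) \<partial>lborel)"
  proof (intro nn_integral_mono)
    fix l :: real
    show "(\<integral>\<^sup>+v. ennreal ((grid_jump \<phi> k l v)\<^sup>2) * indicator {0..<1} v * indicator {1..<2} l \<partial>lborel)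
       \<le> 2 ^ k * (H (0 + (1 / 2 ^ k) * l) * indicator {1 / 2 ^ k..<2 / 2 ^ k} (0 + (1 / 2 ^ k) * l))"
    proof (cases "l \<in> {1..<2}")
      case True
      then have "(\<integral>\<^sup>+v. ennreal ((grid_jump \<phi> k l v)\<^sup>2) * indicator {0..<1} v * indicator {1..<2} l \<partial>lborel)
        = (\<integral>\<^sup>+v. ennreal ((\<phi> (grid_pt (l / 2 ^ k) v) - \<phi> (grid_pt (l / 2 ^ k) v + l / 2 ^ k))\<^sup>2) * indicator {0..<1} v \<partial>lborel)"
        by (simp add: grid_jump_def)
      also have "\<dots> \<le> 2 ^ k * (\<integral>\<^sup>+s. ennreal ((\<phi> s - \<phi> (s + l / 2 ^ k))\<^sup>2) * indicator {-(l / 2 ^ k)<..0} s \<partial>lborel)"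
        using True by (intro nn_integral_grid_pt_le) auto
      also have "(\<integral>\<^sup>+s. ennreal ((\<phi> s - \<phi> (s + l / 2 ^ k))\<^sup>2) * indicator {-(l / 2 ^ k)<..0} s \<partial>lborel) = H (l / 2 ^ k)"
        unfolding H_def by (intro nn_integral_cong) (auto simp: indicator_def)
      finally show ?thesis using True by (simp add: indicator_def divide_right_mono divide_strict_right_mono)
    qed simp
  qed
  also have "\<dots> = 2 ^ k * (\<integral>\<^sup>+l. H (0 + (1 / 2 ^ k) * l) * indicator {1 / 2 ^ k..<2 / 2 ^ k} (0 + (1 / 2 ^ k) * l) \<partial>lborel)"
    by (rule nn_integral_cmult) measurable
  also have "(\<integral>\<^sup>+l. H (0 + (1 / 2 ^ k) * l) * indicator {1 / 2 ^ k..<2 / 2 ^ k} (0 + (1 / 2 ^ k) * l) \<partial>lborel)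
     = 2 ^ k * (\<integral>\<^sup>+u. H u * indicator {1 / 2 ^ k..<2 / 2 ^ k} u \<partial>lborel)"
  proof -
    let ?I = "\<integral>\<^sup>+l. H (0 + (1 / 2 ^ k) * l) * indicator {1 / 2 ^ k..<2 / 2 ^ k} (0 + (1 / 2 ^ k) * l) \<partial>lborel"
    have "(\<integral>\<^sup>+u. H u * indicator {1 / 2 ^ k..<2 / 2 ^ k} u \<partial>lborel) = ennreal (1 / 2 ^ k) * ?I"
      using nn_integral_real_affine[of "\<lambda>u. H u * indicator {1 / 2 ^ k..<2 / 2 ^ k} u" "1 / 2 ^ k" 0] by simp
    then have "2 ^ k * (\<integral>\<^sup>+u. H u * indicator {1 / 2 ^ k..<2 / 2 ^ k} u \<partial>lborel) = ennreal (2 ^ k) * ennreal (1 / 2 ^ k) * ?I"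
      by (simp add: mult.assoc ennreal_power[symmetric])
    also have "ennreal (2 ^ k) * ennreal (1 / 2 ^ k) = 1"
      by (simp add: ennreal_mult[symmetric])
    finally show ?thesis by simp
  qed
  also have "2 ^ k * (2 ^ k * (\<integral>\<^sup>+u. H u * indicator {1 / 2 ^ k..<2 / 2 ^ k} u \<partial>lborel))
      = (\<integral>\<^sup>+u. 4 ^ k * (H u * indicator {1 / 2 ^ k..<2 / 2 ^ k} u) \<partial>lborel)"
    by (subst nn_integral_cmult) (auto simp: mult.assoc[symmetric] power_mult_distrib[symmetric])
  also have "\<dots> \<le> (\<integral>\<^sup>+u. (\<integral>\<^sup>+s. 4 * ennreal (\<bar>\<phi> s - \<phi> (s + u)\<bar>\<^sup>2 / \<bar>u\<bar>\<^sup>2) * indicator {-u<..0} s \<partial>lborel) * indicator {1 / 2 ^ k..<2 / 2 ^ k} u \<partial>lborel)"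
  proof (intro nn_integral_mono)
    fix u :: real
    show "4 ^ k * (H u * indicator {1 / 2 ^ k..<2 / 2 ^ k} u) \<le>
       (\<integral>\<^sup>+s. 4 * ennreal (\<bar>\<phi> s - \<phi> (s + u)\<bar>\<^sup>2 / \<bar>u\<bar>\<^sup>2) * indicator {-u<..0} s \<partial>lborel) * indicator {1 / 2 ^ k..<2 / 2 ^ k} u"
    proof (cases "u \<in> {1 / 2 ^ k..<2 / 2 ^ k}")
      case True
      then have u: "0 < u" "u * 2 ^ k < 2"
        using less_le_trans[of 0 "1 / 2 ^ k" u] by (auto simp: field_simps)
      have "(u * 2 ^ k)\<^sup>2 \<le> 2\<^sup>2" using u by (intro power_mono) auto
      then have "u\<^sup>2 * 4 ^ k \<le> 4" by (simp add: power_mult_distrib power2_eq_square power_mult_distrib[symmetric] mult_ac)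
      then have 4: "4 ^ k \<le> 4 / u\<^sup>2" using u by (simp add: field_simps)
      have "4 ^ k * H u = (\<integral>\<^sup>+s. 4 ^ k * ((if - u < s \<and> s \<le> 0 then ennreal ((\<phi> s - \<phi> (s + u))\<^sup>2) else 0)) \<partial>lborel)"
        unfolding H_def by (rule nn_integral_cmult[symmetric]) measurable
      also have "\<dots> \<le> (\<integral>\<^sup>+s. 4 * ennreal (\<bar>\<phi> s - \<phi> (s + u)\<bar>\<^sup>2 / \<bar>u\<bar>\<^sup>2) * indicator {-u<..0} s \<partial>lborel)"
      proof (intro nn_integral_mono)
        fix s
        have "(4::ennreal) ^ k * ennreal ((\<phi> s - \<phi> (s + u))\<^sup>2) = ennreal (4 ^ k * (\<phi> s - \<phi> (s + u))\<^sup>2)"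
          by (simp add: ennreal_mult ennreal_power[symmetric])
        also have "\<dots> \<le> ennreal (4 / u\<^sup>2 * (\<phi> s - \<phi> (s + u))\<^sup>2)"
          by (intro ennreal_leI mult_right_mono 4) auto
        also have "\<dots> = ennreal (4 * (\<bar>\<phi> s - \<phi> (s + u)\<bar>\<^sup>2 / \<bar>u\<bar>\<^sup>2))" by simp
        also have "\<dots> = 4 * ennreal (\<bar>\<phi> s - \<phi> (s + u)\<bar>\<^sup>2 / \<bar>u\<bar>\<^sup>2)" by (subst ennreal_mult) auto
        finally show "4 ^ k * ((if - u < s \<and> s \<le> 0 then ennreal ((\<phi> s - \<phi> (s + u))\<^sup>2) else 0)) \<le>
           4 * ennreal (\<bar>\<phi> s - \<phi> (s + u)\<bar>\<^sup>2 / \<bar>u\<bar>\<^sup>2) * indicator {-u<..0} s"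
          by (auto simp: indicator_def)
      qed
      finally show ?thesis using True by simp
    qed simp
  qed
  finally show ?thesis .
qed

text \<open>For -u < s \<le> 0 the ends s and s + u lie on both sides of 0, hence |s| + |s + u| = u:
  the pair is in the domain of the seminorm exactly when u < \<delta>, which holds on all shells
  from \<open>k0\<close> on. The shells are disjoint, so their sum is a single integral.\<close>

lemma shell_sum_le_gagliardo:
  assumes \<phi>[measurable]: "\<phi> \<in> borel_measurable borel" and k0: "2 / 2 ^ k0 \<le> \<delta>"
  shows "(\<Sum>k. \<integral>\<^sup>+u. (\<integral>\<^sup>+s. 4 * ennreal (\<bar>\<phi> s - \<phi> (s + u)\<bar>\<^sup>2 / \<bar>u\<bar>\<^sup>2) * indicator {-u<..0} s \<partial>lborel) * indicator {1 / 2 ^ (k + k0)..<2 / 2 ^ (k + k0)} u \<partial>lborel)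
    \<le> 4 * gagliardo \<phi> \<delta>"
proof -
  define R where "R u s = (if - u < s \<and> s \<le> 0 then ennreal (\<bar>\<phi> s - \<phi> (s + u)\<bar>\<^sup>2 / \<bar>u\<bar>\<^sup>2) else 0)" for u s
  have R[measurable (raw)]: "(\<lambda>x. R (f x) (g x)) \<in> borel_measurable M"
    if [measurable]: "f \<in> borel_measurable M" "g \<in> borel_measurable M" for f g and M :: "'m measure"
    unfolding R_def by measurable
  have disj: "disjoint_family (\<lambda>k. {1 / 2 ^ (k + k0)..<2 / 2 ^ (k + k0) :: real})"
    unfolding disjoint_family_on_def
    by (intro ballI impI disjoint_family_onD[OF disjoint_dyadic_shells]) simp_all
  have sub: "(\<Union>k. {1 / 2 ^ (k + k0)..<2 / 2 ^ (k + k0) :: real}) \<subseteq> {0<..<\<delta>}"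
  proof
    fix u :: real assume "u \<in> (\<Union>k. {1 / 2 ^ (k + k0)..<2 / 2 ^ (k + k0)})"
    then obtain k where k: "1 / 2 ^ (k + k0) \<le> u" "u < 2 / 2 ^ (k + k0)" by auto
    have "(0::real) < 1 / 2 ^ (k + k0)" by simp
    moreover have "2 / 2 ^ (k + k0) \<le> (2 / 2 ^ k0 :: real)" by (intro divide_left_mono power_increasing) auto
    ultimately show "u \<in> {0<..<\<delta>}" using k k0 by simp
  qed
  have "(\<Sum>k. \<integral>\<^sup>+u. (\<integral>\<^sup>+s. 4 * ennreal (\<bar>\<phi> s - \<phi> (s + u)\<bar>\<^sup>2 / \<bar>u\<bar>\<^sup>2) * indicator {-u<..0} s \<partial>lborel) * indicator {1 / 2 ^ (k + k0)..<2 / 2 ^ (k + k0)} u \<partial>lborel)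
     = (\<Sum>k. \<integral>\<^sup>+u. 4 * (\<integral>\<^sup>+s. R u s \<partial>lborel) * indicator {1 / 2 ^ (k + k0)..<2 / 2 ^ (k + k0)} u \<partial>lborel)"
  proof -
    have "(\<integral>\<^sup>+s. 4 * ennreal (\<bar>\<phi> s - \<phi> (s + u)\<bar>\<^sup>2 / \<bar>u\<bar>\<^sup>2) * indicator {-u<..0} s \<partial>lborel) = 4 * (\<integral>\<^sup>+s. R u s \<partial>lborel)" for u
    proof -
      have "(\<integral>\<^sup>+s. 4 * ennreal (\<bar>\<phi> s - \<phi> (s + u)\<bar>\<^sup>2 / \<bar>u\<bar>\<^sup>2) * indicator {-u<..0} s \<partial>lborel) = (\<integral>\<^sup>+s. 4 * R u s \<partial>lborel)"
        by (intro nn_integral_cong) (auto simp: R_def indicator_def)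
      also have "\<dots> = 4 * (\<integral>\<^sup>+s. R u s \<partial>lborel)"
        by (rule nn_integral_cmult) measurable
      finally show ?thesis .
    qed
    then show ?thesis by simp
  qed
  also have "\<dots> = (\<integral>\<^sup>+u. (\<Sum>k. 4 * (\<integral>\<^sup>+s. R u s \<partial>lborel) * indicator {1 / 2 ^ (k + k0)..<2 / 2 ^ (k + k0)} u) \<partial>lborel)"
    by (rule nn_integral_suminf[symmetric]) measurable
  also have "\<dots> = (\<integral>\<^sup>+u. 4 * (\<integral>\<^sup>+s. R u s \<partial>lborel) * indicator (\<Union>k. {1 / 2 ^ (k + k0)..<2 / 2 ^ (k + k0)}) u \<partial>lborel)"
    by (simp only: ennreal_suminf_cmult suminf_indicator[OF disj])
  also have "\<dots> \<le> (\<integral>\<^sup>+u. 4 * ((\<integral>\<^sup>+s. R u s * indicator {0<..<\<delta>} u \<partial>lborel)) \<partial>lborel)"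
  proof (intro nn_integral_mono)
    fix u
    show "4 * (\<integral>\<^sup>+s. R u s \<partial>lborel) * indicator (\<Union>k. {1 / 2 ^ (k + k0)..<2 / 2 ^ (k + k0)}) u \<le> 4 * (\<integral>\<^sup>+s. R u s * indicator {0<..<\<delta>} u \<partial>lborel)"
    proof (cases "u \<in> {0<..<\<delta>}")
      case False
      then have "u \<notin> (\<Union>k. {1 / 2 ^ (k + k0)..<2 / 2 ^ (k + k0)})" using sub by blast
      then have "indicator (\<Union>k. {1 / 2 ^ (k + k0)..<2 / 2 ^ (k + k0)}) u = (0::ennreal)"
        by (rule indicator_simps(2))
      then show ?thesis by (simp only: mult_zero_right zero_le)
    qed (simp add: indicator_def)
  qed
  also have "\<dots> = 4 * (\<integral>\<^sup>+u. \<integral>\<^sup>+s. R u s * indicator {0<..<\<delta>} u \<partial>lborel \<partial>lborel)"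
    by (rule nn_integral_cmult) measurable
  also have "(\<integral>\<^sup>+u. \<integral>\<^sup>+s. R u s * indicator {0<..<\<delta>} u \<partial>lborel \<partial>lborel) = (\<integral>\<^sup>+s. \<integral>\<^sup>+u. R u s * indicator {0<..<\<delta>} u \<partial>lborel \<partial>lborel)"
    by (rule lborel_pair.Fubini'[symmetric]) measurable
  also have "\<dots> \<le> gagliardo \<phi> \<delta>"
    unfolding gagliardo_def
  proof (rule nn_integral_mono)
    fix s
    have "(\<integral>\<^sup>+u. R u s * indicator {0<..<\<delta>} u \<partial>lborel) \<le>
       (\<integral>\<^sup>+u. ennreal (\<bar>\<phi> s - \<phi> (s + 1 * u)\<bar>\<^sup>2 / \<bar>s - (s + 1 * u)\<bar>\<^sup>2) * indicator {p. \<bar>fst p\<bar> + \<bar>snd p\<bar> < \<delta>} (s, s + 1 * u) \<partial>lborel)"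
      by (intro nn_integral_mono) (auto simp: R_def indicator_def)
    also have "\<dots> = (\<integral>\<^sup>+t. ennreal (\<bar>\<phi> s - \<phi> t\<bar>\<^sup>2 / \<bar>s - t\<bar>\<^sup>2) * indicator {p. \<bar>fst p\<bar> + \<bar>snd p\<bar> < \<delta>} (s, t) \<partial>lborel)"
      using nn_integral_real_affine[of "\<lambda>t. ennreal (\<bar>\<phi> s - \<phi> t\<bar>\<^sup>2 / \<bar>s - t\<bar>\<^sup>2) * indicator {p. \<bar>fst p\<bar> + \<bar>snd p\<bar> < \<delta>} (s, t)" 1 s]
      by simp
    finally show "(\<integral>\<^sup>+u. R u s * indicator {0<..<\<delta>} u \<partial>lborel) \<le>
       (\<integral>\<^sup>+t. ennreal (\<bar>\<phi> s - \<phi> t\<bar>\<^sup>2 / \<bar>s - t\<bar>\<^sup>2) * indicator {p. \<bar>fst p\<bar> + \<bar>snd p\<bar> < \<delta>} (s, t) \<partial>lborel)" .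
  qed
  finally show ?thesis by (simp add: mult_left_mono)
qed

text \<open>The mean over the grids of the sum of squared jumps is finite once the first
  \<open>k0\<close> generations, whose cells may leave the domain of integration, are omitted;
  finitely many terms do not affect summability.\<close>

lemma AE_grid_jump_summable:
  assumes \<phi>[measurable]: "\<phi> \<in> borel_measurable borel" and fin: "gagliardo \<phi> \<delta> < \<infinity>" and d: "0 < \<delta>"
  shows "AE l in lborel. AE v in lborel. 1 \<le> l \<and> l < 2 \<and> 0 \<le> v \<and> v < 1 \<longrightarrow> (\<Sum>k. ennreal ((grid_jump \<phi> k l v)\<^sup>2)) < \<infinity>"
proof -
  obtain k0 where k0: "2 / \<delta> < 2 ^ k0"
    using real_arch_pow[of 2 "2 / \<delta>"] by auto
  then have k0: "2 / 2 ^ k0 \<le> \<delta>" using d by (simp add: field_simps)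
  define T where "T l v = (\<Sum>k. ennreal ((grid_jump \<phi> (k + k0) l v)\<^sup>2) * indicator {0..<1} v * indicator {1..<2} l)" for l v
  have T: "(\<lambda>x. T (f x) (g x)) \<in> borel_measurable M"
    if [measurable]: "f \<in> borel_measurable M" "g \<in> borel_measurable M" for f g and M :: "'m measure"
    unfolding T_def by measurable
  have [measurable]: "(\<lambda>p. T (fst p) (snd p)) \<in> borel_measurable (borel \<Otimes>\<^sub>M borel)"
    by (rule T) measurable
  have "(\<integral>\<^sup>+l. \<integral>\<^sup>+v. T l v \<partial>lborel \<partial>lborel) =
      (\<integral>\<^sup>+l. (\<Sum>k. \<integral>\<^sup>+v. ennreal ((grid_jump \<phi> (k + k0) l v)\<^sup>2) * indicator {0..<1} v * indicator {1..<2} l \<partial>lborel) \<partial>lborel)"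
    unfolding T_def
    by (intro nn_integral_cong nn_integral_suminf borel_measurable_times_ennreal measurable_compose[OF _ measurable_ennreal]
        borel_measurable_power measurable_grid_jump) auto
  also have "\<dots> = (\<Sum>k. \<integral>\<^sup>+l. \<integral>\<^sup>+v. ennreal ((grid_jump \<phi> (k + k0) l v)\<^sup>2) * indicator {0..<1} v * indicator {1..<2} l \<partial>lborel \<partial>lborel)"
    by (rule nn_integral_suminf) measurable
  also have "\<dots> \<le> (\<Sum>k. \<integral>\<^sup>+u. (\<integral>\<^sup>+s. 4 * ennreal (\<bar>\<phi> s - \<phi> (s + u)\<bar>\<^sup>2 / \<bar>u\<bar>\<^sup>2) * indicator {-u<..0} s \<partial>lborel) * indicator {1 / 2 ^ (k + k0)..<2 / 2 ^ (k + k0)} u \<partial>lborel)"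
    by (intro suminf_le nn_integral_grid_jump_le \<phi>) auto
  also have "\<dots> \<le> 4 * gagliardo \<phi> \<delta>" by (rule shell_sum_le_gagliardo[OF \<phi> k0])
  also have "\<dots> < \<infinity>" using fin by (simp add: ennreal_mult_less_top)
  finally have "(\<integral>\<^sup>+l. \<integral>\<^sup>+v. T l v \<partial>lborel \<partial>lborel) \<noteq> \<infinity>" by simp
  then have "AE l in lborel. (\<integral>\<^sup>+v. T l v \<partial>lborel) \<noteq> \<infinity>"
    by (rule nn_integral_PInf_AE[rotated]) measurable
  then show ?thesis
  proof eventually_elim
    case (elim l)
    have "AE v in lborel. T l v \<noteq> \<infinity>"
      by (rule nn_integral_PInf_AE[OF _ elim]) (rule T, auto)
    then show ?case
    proof eventually_elim
      case (elim v)
      show ?case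
      proof
        assume lv: "1 \<le> l \<and> l < 2 \<and> 0 \<le> v \<and> v < 1"
        let ?g = "\<lambda>k. (grid_jump \<phi> k l v)\<^sup>2"
        have "(\<Sum>k. ennreal (?g (k + k0))) \<noteq> \<infinity>" using elim lv by (simp add: T_def)
        then have "summable (\<lambda>k. ?g (k + k0))" by (intro summable_suminf_not_top) auto
        then have "summable ?g" using summable_iff_shift[of ?g k0] by blast
        then show "(\<Sum>k. ennreal (?g k)) < \<infinity>"
          by (subst suminf_ennreal_eq[OF _ summable_sums]) auto
      qed
    qed
  qed
qed

text \<open>Also valid for \<open>p = x\<close>: there \<open>diff_quot f x 0 = 0\<close>, but it enters the convex combination with weight \<open>0\<close>.\<close>

lemma diff_quot_convex_combination:
  assumes "p \<le> x" "x < q"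
  shows "\<bar>slope f p q - diff_quot f x (p - x)\<bar> \<le> \<bar>diff_quot f x (p - x) - diff_quot f x (q - x)\<bar>"
    and "\<bar>slope f p q - diff_quot f x (q - x)\<bar> \<le> \<bar>diff_quot f x (p - x) - diff_quot f x (q - x)\<bar>"
proof -
  define \<phi> \<psi> where "\<phi> = diff_quot f x (p - x)" and "\<psi> = diff_quot f x (q - x)"
  define \<theta> where "\<theta> = (x - p) / (q - p)"
  have t: "0 \<le> \<theta>" "\<theta> \<le> 1" using assms by (auto simp: \<theta>_def field_simps)
  have 1: "f x - f p = (x - p) * \<phi>" by (cases "p = x") (auto simp: \<phi>_def diff_quot_def field_simps)
  have 2: "f q - f x = (q - x) * \<psi>" using assms by (auto simp: \<psi>_def diff_quot_def field_simps)
  have "slope f p q = ((x - p) * \<phi> + (q - x) * \<psi>) / (q - p)"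
    using 1 2 by (simp add: slope_def)
  also have "\<dots> = \<theta> * \<phi> + (1 - \<theta>) * \<psi>"
  proof -
    have "1 - \<theta> = (q - x) / (q - p)" using assms by (simp add: \<theta>_def field_simps)
    then show ?thesis by (simp add: \<theta>_def add_divide_distrib)
  qed
  finally have s: "slope f p q = \<theta> * \<phi> + (1 - \<theta>) * \<psi>" .
  have "\<bar>slope f p q - \<phi>\<bar> = (1 - \<theta>) * \<bar>\<phi> - \<psi>\<bar>"
  proof -
    have "slope f p q - \<phi> = - ((1 - \<theta>) * (\<phi> - \<psi>))" by (simp add: s algebra_simps)
    then show ?thesis using t by (simp add: abs_mult)
  qed
  also have "\<dots> \<le> 1 * \<bar>\<phi> - \<psi>\<bar>" using t by (intro mult_right_mono) auto
  finally show "\<bar>slope f p q - \<phi>\<bar> \<le> \<bar>\<phi> - \<psi>\<bar>" by simp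
  have "\<bar>slope f p q - \<psi>\<bar> = \<theta> * \<bar>\<phi> - \<psi>\<bar>"
  proof -
    have "slope f p q - \<psi> = \<theta> * (\<phi> - \<psi>)" by (simp add: s algebra_simps)
    then show ?thesis using t by (simp add: abs_mult)
  qed
  also have "\<dots> \<le> 1 * \<bar>\<phi> - \<psi>\<bar>" using t by (intro mult_right_mono) auto
  finally show "\<bar>slope f p q - \<psi>\<bar> \<le> \<bar>\<phi> - \<psi>\<bar>" by simp
qed

section \<open>Cell slopes against difference quotients at the cell ends\<close>

lemma cell_slope_near_diff_quot:
  assumes "a \<le> x" "x < a + l"
  shows "\<bar>cell_slope f k a (a + l) x - diff_quot f x (grid_pt (l / 2 ^ k) (x - a))\<bar> \<le> \<bar>grid_jump (diff_quot f x) k l (x - a)\<bar>"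
    and "\<bar>cell_slope f k a (a + l) x - diff_quot f x (grid_pt (l / 2 ^ k) (x - a) + l / 2 ^ k)\<bar> \<le> \<bar>grid_jump (diff_quot f x) k l (x - a)\<bar>"
proof -
  define w s where "w = l / 2 ^ k" and "s = grid_pt w (x - a)"
  have "0 < w" using assms by (simp add: w_def)
  then have "x + s \<le> x" "x < x + s + w" using grid_pt_bounds[of w "x - a"] by (auto simp: s_def)
  note * = diff_quot_convex_combination[OF this, of f]
  have eq: "x + s - x = s" "x + s + w - x = s + w" by auto
  show "\<bar>cell_slope f k a (a + l) x - diff_quot f x (grid_pt (l / 2 ^ k) (x - a))\<bar> \<le> \<bar>grid_jump (diff_quot f x) k l (x - a)\<bar>"
    and "\<bar>cell_slope f k a (a + l) x - diff_quot f x (grid_pt (l / 2 ^ k) (x - a) + l / 2 ^ k)\<bar> \<le> \<bar>grid_jump (diff_quot f x) k l (x - a)\<bar>"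
    using * unfolding eq cell_slope_def dyadic_cell_eq[OF assms] grid_jump_def fst_conv snd_conv add_diff_cancel_left' w_def[symmetric] s_def[symmetric]
    by simp_all
qed

text \<open>A cell and its half share an end. Both slopes are close to the difference quotient at
  that common end, so they differ by at most the sum of two jumps; which end is shared depends on
  the half.\<close>

lemma cell_slope_increment:
  assumes "a \<le> x" "x < a + l"
  shows "\<bar>cell_slope f (Suc k) a (a + l) x - cell_slope f k a (a + l) x\<bar>
    \<le> \<bar>grid_jump (diff_quot f x) (Suc k) l (x - a)\<bar> + \<bar>grid_jump (diff_quot f x) k l (x - a)\<bar>"
proof -
  define w where "w = l / 2 ^ k"
  have w: "0 < w" using assms by (simp add: w_def)
  have w2: "l / 2 ^ Suc k = w / 2" by (simp add: w_def)
  note c = cell_slope_near_diff_quot[OF assms, of f k, folded w_def]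
  note d = cell_slope_near_diff_quot[OF assms, of f "Suc k", unfolded w2]
  from grid_pt_half[OF w, of "x - a"] show ?thesis
  proof
    assume "grid_pt (w / 2) (x - a) = grid_pt w (x - a)"
    then show ?thesis using c(1) d(1) by simp
  next
    assume h: "grid_pt (w / 2) (x - a) = grid_pt w (x - a) + w / 2"
    have e: "grid_pt (w / 2) (x - a) + w / 2 = grid_pt w (x - a) + w" using h by simp
    show ?thesis using c(2) d(2)[unfolded e] by simp
  qed
qed

text \<open>A natural number as bound makes the predicate a countable union, hence measurable in
  grid and point, as the exchange of quantifiers requires.\<close>

definition grid_bounded :: "(real \<Rightarrow> real) \<Rightarrow> real \<Rightarrow> real \<Rightarrow> bool" where
  "grid_bounded \<phi> l v \<longleftrightarrow> (\<exists>B::nat. \<forall>k. \<bar>\<phi> (grid_pt (l / 2 ^ k) v)\<bar> \<le> real B \<and> \<bar>\<phi> (grid_pt (l / 2 ^ k) v + l / 2 ^ k)\<bar> \<le> real B)"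

text \<open>Square-summable jumps make the slope increments square-summable, so the slopes are
  bounded at almost every such point; the jumps are bounded too, and they control the distance from
  the slopes to the difference quotients at the cell ends.\<close>

lemma AE_grid_bounded_fixed_grid:
  assumes l: "0 < l"
  shows "AE x in lborel. a \<le> x \<and> x < a + l \<and> (\<Sum>k. ennreal ((grid_jump (diff_quot f x) k l (x - a))\<^sup>2)) < \<infinity>
    \<longrightarrow> grid_bounded (diff_quot f x) l (x - a)"
proof -
  have "a < a + l" using l by simp
  from AE_cell_slope_bounded[OF this, of f] show ?thesis
  proof eventually_elim
    case (elim x)
    show ?case
    proof
      let ?T = "\<lambda>k. grid_jump (diff_quot f x) k l (x - a)" and ?M = "\<lambda>k. cell_slope f k a (a + l) x"
      assume *: "a \<le> x \<and> x < a + l \<and> (\<Sum>k. ennreal ((?T k)\<^sup>2)) < \<infinity>"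
      then have ax: "a \<le> x" "x < a + l" by auto
      have sT: "summable (\<lambda>k. (?T k)\<^sup>2)" using * by (intro summable_suminf_not_top) auto
      have le: "(?M (Suc k) - ?M k)\<^sup>2 \<le> 2 * (?T (Suc k))\<^sup>2 + 2 * (?T k)\<^sup>2" for k
      proof -
        have "(?M (Suc k) - ?M k)\<^sup>2 \<le> (\<bar>?T (Suc k)\<bar> + \<bar>?T k\<bar>)\<^sup>2"
          using cell_slope_increment[OF ax, of f k] by (intro abs_le_square_iff[THEN iffD1]) auto
        also have "\<dots> \<le> 2 * \<bar>?T (Suc k)\<bar>\<^sup>2 + 2 * \<bar>?T k\<bar>\<^sup>2"
          using sum_squares_bound[of "\<bar>?T (Suc k)\<bar>" "\<bar>?T k\<bar>"] by (simp add: power2_sum)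
        finally show ?thesis by simp
      qed
      have "summable (\<lambda>k. (?M (Suc k) - ?M k)\<^sup>2)"
      proof (rule summable_comparison_test_ev)
        show "\<forall>\<^sub>F k in sequentially. norm ((?M (Suc k) - ?M k)\<^sup>2) \<le> 2 * (?T (Suc k))\<^sup>2 + 2 * (?T k)\<^sup>2"
          using le by simp
        show "summable (\<lambda>k. 2 * (?T (Suc k))\<^sup>2 + 2 * (?T k)\<^sup>2)"
          using sT summable_Suc_iff[of "\<lambda>k. (?T k)\<^sup>2"] by (intro summable_add summable_mult) auto
      qed
      then have "(\<Sum>k. ennreal ((?M (Suc k) - ?M k)\<^sup>2)) < \<infinity>"
        by (subst suminf_ennreal_eq[OF _ summable_sums]) auto
      then obtain B :: nat where B: "\<And>k. \<bar>?M k\<bar> \<le> real B" using elim ax by auto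
      obtain S :: nat where S: "suminf (\<lambda>k. (?T k)\<^sup>2) \<le> real S" using real_arch_simple by blast
      have T: "\<bar>?T k\<bar> \<le> 1 + real S" for k
      proof -
        have "(?T k)\<^sup>2 \<le> suminf (\<lambda>k. (?T k)\<^sup>2)"
          using sum_le_suminf[OF sT, of "{k}"] by simp
        then have "(?T k)\<^sup>2 \<le> real S" using S by simp
        also have "real S \<le> (1 + real S)\<^sup>2" by (simp add: power2_eq_square algebra_simps)
        finally show ?thesis using abs_le_square_iff[of "?T k" "1 + real S"] by simp
      qed
      show "grid_bounded (diff_quot f x) l (x - a)"
        unfolding grid_bounded_def
      proof (intro exI allI conjI)
        fix k
        show "\<bar>diff_quot f x (grid_pt (l / 2 ^ k) (x - a))\<bar> \<le> real (B + 1 + S)"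
          using cell_slope_near_diff_quot(1)[OF ax, of f k] T[of k] B[of k] by simp
        show "\<bar>diff_quot f x (grid_pt (l / 2 ^ k) (x - a) + l / 2 ^ k)\<bar> \<le> real (B + 1 + S)"
          using cell_slope_near_diff_quot(2)[OF ax, of f k] T[of k] B[of k] by simp
      qed
    qed
  qed
qed

lemma measurable_diff_quot [measurable (raw)]:
  assumes [measurable]: "f \<in> borel_measurable borel" "g \<in> borel_measurable M" "h \<in> borel_measurable M"
  shows "(\<lambda>x. diff_quot f (g x) (h x)) \<in> borel_measurable M"
  unfolding diff_quot_def by measurable

text \<open>For each grid, given by its mesh and origin a, the exceptional points are null; by
  Fubini, almost every x has a null set of exceptional grids. The reflection a = x - v then replaces
  the origin by the relative position \<open>v\<close> of x in the grid.\<close>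

lemma AE_grid_bounded:
  assumes f[measurable]: "f \<in> borel_measurable borel"
  shows "AE x in lborel. AE l in lborel. AE v in lborel.
    1 \<le> l \<and> l < 2 \<and> 0 \<le> v \<and> v < 1 \<and> (\<Sum>k. ennreal ((grid_jump (diff_quot f x) k l v)\<^sup>2)) < \<infinity>
    \<longrightarrow> grid_bounded (diff_quot f x) l v"
proof -
  define P where "P x l v \<longleftrightarrow> (1 \<le> l \<and> l < 2 \<and> 0 \<le> v \<and> v < 1 \<and> (\<Sum>k. ennreal ((grid_jump (diff_quot f x) k l v)\<^sup>2)) < \<infinity>
    \<longrightarrow> grid_bounded (diff_quot f x) l v)" for x l v :: real
  have P[measurable (raw)]: "Measurable.pred M (\<lambda>z. P (g1 z) (g2 z) (g3 z))"
    if [measurable]: "g1 \<in> borel_measurable M" "g2 \<in> borel_measurable M" "g3 \<in> borel_measurable M"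
    for g1 g2 g3 and M :: "'m measure"
    unfolding P_def grid_bounded_def grid_jump_def by measurable
  interpret pair_sigma_finite "lborel :: real measure" "lborel \<Otimes>\<^sub>M lborel :: (real \<times> real) measure"
    unfolding lborel_prod by (intro pair_sigma_finite.intro sigma_finite_lborel)
  have meas: "{p \<in> space (lborel \<Otimes>\<^sub>M (lborel \<Otimes>\<^sub>M lborel)). P (fst p) (fst (snd p)) (fst p - snd (snd p))}
      \<in> sets (lborel \<Otimes>\<^sub>M (lborel \<Otimes>\<^sub>M lborel) :: (real \<times> real \<times> real) measure)"
    by (rule predE, rule P) measurable
  have "AE z in lborel \<Otimes>\<^sub>M lborel. AE x in lborel. P x (fst z) (x - snd z)"
  proof (rule AE_I2)
    fix z :: "real \<times> real"
    show "AE x in lborel. P x (fst z) (x - snd z)"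
    proof (cases "1 \<le> fst z")
      case True
      have "AE x in lborel. snd z \<le> x \<and> x < snd z + fst z \<and> (\<Sum>k. ennreal ((grid_jump (diff_quot f x) k (fst z) (x - snd z))\<^sup>2)) < \<infinity>
        \<longrightarrow> grid_bounded (diff_quot f x) (fst z) (x - snd z)"
        using True by (intro AE_grid_bounded_fixed_grid) simp
      then show ?thesis
      proof (rule AE_mp, intro AE_I2 impI)
        fix x
        let ?S = "(\<Sum>k. ennreal ((grid_jump (diff_quot f x) k (fst z) (x - snd z))\<^sup>2)) < \<infinity>"
        assume H: "snd z \<le> x \<and> x < snd z + fst z \<and> ?S \<longrightarrow> grid_bounded (diff_quot f x) (fst z) (x - snd z)"
        show "P x (fst z) (x - snd z)"
          unfolding P_def
        proof (intro impI H[THEN mp] conjI)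
          assume a: "1 \<le> fst z \<and> fst z < 2 \<and> 0 \<le> x - snd z \<and> x - snd z < 1 \<and> ?S"
          from a have b: "0 \<le> x - snd z" "x - snd z < 1" by blast+
          show "snd z \<le> x" "x < snd z + fst z" using b True by linarith+
          show ?S using a by blast
        qed
      qed
    next
      case False
      then show ?thesis unfolding P_def by (intro AE_I2) blast
    qed
  qed
  then have "AE x in lborel. AE z in lborel \<Otimes>\<^sub>M lborel. P x (fst z) (x - snd z)"
    using AE_commute[of "\<lambda>x z. P x (fst z) (x - snd z)", OF meas] by blast
  then have "AE x in lborel. AE l in lborel. AE v in lborel. P x l v"
  proof eventually_elim
    case (elim x)
    from lborel_pair.AE_pair[OF elim] show ?case
    proof eventually_elim
      case (elim l)
      then have "AE a in lborel. P x l (x - a)" by simp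
      then have "AE v in lborel. P x l (x - (x + (-1) * v))"
        by (intro AE_borel_affine[where P = "\<lambda>a. P x l (x - a)"]) auto
      then show ?case by simp
    qed
  qed
  then show ?thesis by (simp only: P_def)
qed

text \<open>A mass \<open>m\<close> of displacements at one scale, each occurring at a cell end,
  spoils grids of total measure at least 2^k m. \<open>G\<close> depends on the mesh so that right
  ends, shifted by l/2^(k+1), can be treated like left ends.\<close>

lemma emeasure_grid_set_ge:
  fixes G :: "real \<Rightarrow> real \<Rightarrow> ennreal"
  assumes A[measurable]: "A \<in> sets (lborel \<Otimes>\<^sub>M lborel :: (real \<times> real) measure)"
    and G[measurable]: "\<And>l. G l \<in> borel_measurable borel"
    and m: "\<And>l. 1 \<le> l \<Longrightarrow> l < 2 \<Longrightarrow> m \<le> (\<integral>\<^sup>+s. G l s * indicator {-(l / 2 ^ Suc k)<..0} s \<partial>lborel)"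
    and GA: "\<And>l v. 1 \<le> l \<Longrightarrow> l < 2 \<Longrightarrow> 0 \<le> v \<Longrightarrow> v < 1 \<Longrightarrow> G l (grid_pt (l / 2 ^ Suc k) v) \<le> indicator A (l, v)"
  shows "2 ^ k * m \<le> emeasure (lborel \<Otimes>\<^sub>M lborel) A"
proof -
  have "2 ^ k * m = (\<integral>\<^sup>+l. 2 ^ k * m * indicator {1..<2} (l::real) \<partial>lborel)"
    by (subst nn_integral_cmult_indicator) auto
  also have "\<dots> \<le> (\<integral>\<^sup>+l. \<integral>\<^sup>+v. indicator A (l, v) \<partial>lborel \<partial>lborel)"
  proof (intro nn_integral_mono)
    fix l :: real
    show "2 ^ k * m * indicator {1..<2} l \<le> (\<integral>\<^sup>+v. indicator A (l, v) \<partial>lborel)"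
    proof (cases "l \<in> {1..<2}")
      case True
      then have l: "1 \<le> l" "l < 2" by auto
      have "2 ^ k * m \<le> 2 ^ k * (\<integral>\<^sup>+s. G l s * indicator {-(l / 2 ^ Suc k)<..0} s \<partial>lborel)"
        by (intro mult_left_mono m l) auto
      also have "\<dots> \<le> (\<integral>\<^sup>+v. G l (grid_pt (l / 2 ^ Suc k) v) * indicator {0..<1} v \<partial>lborel)"
        using l by (intro nn_integral_grid_pt_ge) auto
      also have "\<dots> \<le> (\<integral>\<^sup>+v. indicator A (l, v) \<partial>lborel)"
        using GA[OF l] by (intro nn_integral_mono) (auto simp: indicator_def[of "{0..<1::real}"])
      finally show ?thesis using True by simp
    qed simp
  qed
  also have "\<dots> = emeasure (lborel \<Otimes>\<^sub>M lborel) A"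
    by (rule lborel.emeasure_pair_measure[symmetric]) (rule A)
  finally show ?thesis .
qed

text \<open>\<open>C\<close> depends on \<open>e\<close> but is common to all dyadic scales, which
  is the uniformity that a density argument can use. The exceptional set occupies a proportion of at
  most e/2 of each interval.\<close>

definition approx_bounded_at_0 :: "(real \<Rightarrow> real) \<Rightarrow> bool" where
  "approx_bounded_at_0 \<phi> \<longleftrightarrow> (\<forall>e>0. \<exists>C. \<forall>k. emeasure lebesgue {s. \<bar>s\<bar> < 1 / 2 ^ Suc k \<and> C < \<bar>\<phi> s\<bar>} \<le> ennreal (e / 2 ^ Suc k))"

text \<open>The grids on which \<open>\<phi>\<close> exceeds \<open>C\<close> at some cell end
  decrease to a null set as \<open>C\<close> grows. Exceptional displacements at any scale would
  spoil a proportional amount of grids; nonpositive ones are met by left ends, positive ones by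
  right ends.\<close>

lemma approx_bounded_of_grid_bounded:
  assumes \<phi>[measurable]: "\<phi> \<in> borel_measurable borel"
    and ae: "AE l in lborel. AE v in lborel. 1 \<le> l \<and> l < 2 \<and> 0 \<le> v \<and> v < 1 \<longrightarrow> grid_bounded \<phi> l v"
  shows "approx_bounded_at_0 \<phi>"
  unfolding approx_bounded_at_0_def
proof (intro allI impI)
  fix e :: real assume e: "0 < e"
  let ?M = "lborel \<Otimes>\<^sub>M lborel :: (real \<times> real) measure"
  define Q where "Q C l v \<longleftrightarrow> (\<exists>k. real C < \<bar>\<phi> (grid_pt (l / 2 ^ k) v)\<bar> \<or> real C < \<bar>\<phi> (grid_pt (l / 2 ^ k) v + l / 2 ^ k)\<bar>)"
    for C :: nat and l v
  define A where "A C = {z \<in> space ?M. 1 \<le> fst z \<and> fst z < 2 \<and> 0 \<le> snd z \<and> snd z < 1 \<and> Q C (fst z) (snd z)}" for C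
  have A[measurable]: "A C \<in> sets ?M" for C
    unfolding A_def Q_def by measurable
  have "Q C l v" if "Q (Suc C) l v" for C l v
    using that unfolding Q_def by (elim ex_forward disj_forward) simp_all
  then have dec: "decseq A"
    by (intro decseq_SucI) (auto simp: A_def)
  have "A C \<subseteq> {1..2} \<times> {0..1}" for C by (auto simp: A_def)
  then have "emeasure ?M (A C) \<le> emeasure ?M ({1..2} \<times> {0..1})" for C
    by (intro emeasure_mono) auto
  then have "emeasure ?M (A C) \<le> 1" for C
    by (subst (asm) lborel.emeasure_pair_measure_Times) auto
  then have finA: "emeasure ?M (A C) \<noteq> \<infinity>" for C
    by (metis ennreal_one_neq_top infinity_ennreal_def top_unique)
  have "AE z in ?M. \<not> (\<forall>C. z \<in> A C)"
  proof (rule lborel_pair.AE_pair_measure)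
    show "{x \<in> space ?M. \<not> (\<forall>C. x \<in> A C)} \<in> sets ?M" by measurable
    show "AE l in lborel. AE v in lborel. \<not> (\<forall>C. (l, v) \<in> A C)"
      using ae
    proof eventually_elim
      case (elim l)
      then show ?case
        by eventually_elim (auto simp: A_def Q_def grid_bounded_def not_less[symmetric])
    qed
  qed
  then have "emeasure ?M {z \<in> space ?M. \<forall>C. z \<in> A C} = 0"
    by (rule emeasure_eq_0_AE)
  moreover have "{z \<in> space ?M. \<forall>C. z \<in> A C} = (\<Inter>C. A C)" by (auto simp: A_def)
  ultimately have "(\<lambda>C. emeasure ?M (A C)) \<longlonglongrightarrow> 0"
    using Lim_emeasure_decseq[OF _ dec finA] A by auto
  \<comment> \<open>The two halves of an interval will each contribute (e/4)/2^k, in sum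
    e/2^(k+1).\<close>
  then have "\<forall>\<^sub>F C in sequentially. emeasure ?M (A C) < ennreal (e / 4)"
    by (rule order_tendstoD) (use e in auto)
  then obtain C where C: "emeasure ?M (A C) < ennreal (e / 4)"
    by (auto simp: eventually_sequentially)
  show "\<exists>C. \<forall>k. emeasure lebesgue {s. \<bar>s\<bar> < 1 / 2 ^ Suc k \<and> C < \<bar>\<phi> s\<bar>} \<le> ennreal (e / 2 ^ Suc k)"
  proof (intro exI allI)
    fix k :: nat
    define h where "h = (1 / 2 ^ Suc k :: real)"
    have h: "0 < h" by (simp add: h_def)
    let ?B = "{s. real C < \<bar>\<phi> s\<bar>}"
    have hl: "h \<le> l / 2 ^ Suc k" if "1 \<le> l" for l using that by (simp add: h_def divide_right_mono)
    have left: "2 ^ k * emeasure lborel ({-h<..0} \<inter> ?B) \<le> emeasure ?M (A C)"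
    proof (rule emeasure_grid_set_ge[where G = "\<lambda>l. indicator ?B"])
      fix l :: real assume l: "1 \<le> l" "l < 2"
      have "emeasure lborel ({-h<..0} \<inter> ?B) = (\<integral>\<^sup>+s. indicator ({-h<..0} \<inter> ?B) s \<partial>lborel)"
        by (rule nn_integral_indicator[symmetric]) measurable
      also have "\<dots> \<le> (\<integral>\<^sup>+s. indicator ?B s * indicator {-(l / 2 ^ Suc k)<..0} s \<partial>lborel)"
        using hl[OF l(1)] by (intro nn_integral_mono) (auto simp: indicator_def)
      finally show "emeasure lborel ({-h<..0} \<inter> ?B) \<le> (\<integral>\<^sup>+s. indicator ?B s * indicator {-(l / 2 ^ Suc k)<..0} s \<partial>lborel)" .
    next
      fix l v :: real assume "1 \<le> l" "l < 2" "0 \<le> v" "v < 1"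
      then show "indicator ?B (grid_pt (l / 2 ^ Suc k) v) \<le> (indicator (A C) (l, v) :: ennreal)"
        by (auto simp: indicator_def A_def Q_def space_pair_measure intro!: exI[of _ "Suc k"])
    qed (use A[of C] in auto)
    have right: "2 ^ k * emeasure lborel ({0<..h} \<inter> ?B) \<le> emeasure ?M (A C)"
    proof (rule emeasure_grid_set_ge[where G = "\<lambda>l s. indicator ?B (s + l / 2 ^ Suc k)"])
      fix l :: real assume l: "1 \<le> l" "l < 2"
      let ?w = "l / 2 ^ Suc k"
      have "emeasure lborel ({0<..h} \<inter> ?B) = (\<integral>\<^sup>+s. indicator ({0<..h} \<inter> ?B) s \<partial>lborel)"
        by (rule nn_integral_indicator[symmetric]) measurable
      also have "\<dots> = (\<integral>\<^sup>+s. indicator ({0<..h} \<inter> ?B) (?w + 1 * s) \<partial>lborel)"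
        using nn_integral_real_affine[of "indicator ({0<..h} \<inter> ?B)" 1 ?w] by simp
      also have "\<dots> \<le> (\<integral>\<^sup>+s. indicator ?B (s + ?w) * indicator {-?w<..0} s \<partial>lborel)"
        using hl[OF l(1)] by (intro nn_integral_mono) (auto simp: indicator_def add.commute)
      finally show "emeasure lborel ({0<..h} \<inter> ?B) \<le> (\<integral>\<^sup>+s. indicator ?B (s + ?w) * indicator {-?w<..0} s \<partial>lborel)" .
    next
      fix l v :: real assume "1 \<le> l" "l < 2" "0 \<le> v" "v < 1"
      then show "indicator ?B (grid_pt (l / 2 ^ Suc k) v + l / 2 ^ Suc k) \<le> (indicator (A C) (l, v) :: ennreal)"
        by (auto simp: indicator_def A_def Q_def space_pair_measure intro!: exI[of _ "Suc k"])
    qed (use A[of C] in auto)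
    have scale: "m \<le> ennreal (e / 4 / 2 ^ k)" if "2 ^ k * m \<le> emeasure ?M (A C)" for m
    proof -
      have "m = ennreal (1 / 2 ^ k) * ennreal (2 ^ k) * m"
        by (simp add: ennreal_mult[symmetric])
      also have "\<dots> = ennreal (1 / 2 ^ k) * (2 ^ k * m)"
        by (simp add: mult.assoc ennreal_power[symmetric])
      also have "\<dots> \<le> ennreal (1 / 2 ^ k) * ennreal (e / 4)"
        using that C by (intro mult_left_mono) auto
      also have "\<dots> = ennreal (e / 4 / 2 ^ k)"
        using e by (simp add: ennreal_mult[symmetric])
      finally show ?thesis .
    qed
    have "emeasure lebesgue {s. \<bar>s\<bar> < h \<and> real C < \<bar>\<phi> s\<bar>} = emeasure lborel {s. \<bar>s\<bar> < h \<and> real C < \<bar>\<phi> s\<bar>}"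
      by (subst emeasure_completion) auto
    also have "\<dots> \<le> emeasure lborel (({-h<..0} \<inter> ?B) \<union> ({0<..h} \<inter> ?B))"
      by (rule emeasure_mono) auto
    also have "\<dots> \<le> emeasure lborel ({-h<..0} \<inter> ?B) + emeasure lborel ({0<..h} \<inter> ?B)"
      by (rule emeasure_subadditive) auto
    also have "\<dots> \<le> ennreal (e / 4 / 2 ^ k) + ennreal (e / 4 / 2 ^ k)"
      by (intro add_mono scale left right)
    also have "\<dots> = ennreal (e / 2 ^ Suc k)"
      using e by (simp add: ennreal_plus[symmetric] field_simps del: ennreal_plus)
    finally show "emeasure lebesgue {s. \<bar>s\<bar> < 1 / 2 ^ Suc k \<and> real C < \<bar>\<phi> s\<bar>} \<le> ennreal (e / 2 ^ Suc k)"
      by (simp add: h_def)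
  qed
qed

section \<open>Differentiability from the square integral\<close>

lemma square_integral_eq_gagliardo:
  assumes [measurable]: "f \<in> borel_measurable borel"
  shows "square_integral f x \<delta> = gagliardo (diff_quot f x) \<delta>"
proof -
  let ?F = "\<lambda>p. ennreal (\<bar>diff_quot f x (fst p) - diff_quot f x (snd p)\<bar>\<^sup>2 / \<bar>fst p - snd p\<bar>\<^sup>2)
      * indicator {p. \<bar>fst p\<bar> + \<bar>snd p\<bar> < \<delta>} p"
  have "square_integral f x \<delta> = (\<integral>\<^sup>+p. ?F p \<partial>(lborel \<Otimes>\<^sub>M lborel))"
    unfolding square_integral_def nn_integral_completion lborel_prod
    by (intro nn_integral_cong) (auto simp: indicator_def split: prod.split)
  also have "\<dots> = (\<integral>\<^sup>+s. \<integral>\<^sup>+t. ?F (s, t) \<partial>lborel \<partial>lborel)"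
    by (intro lborel.nn_integral_fst[symmetric]) measurable
  finally show ?thesis by (simp add: gagliardo_def)
qed

section \<open>Passage to a Borel representative\<close>

lemma AE_lborel_shift:
  assumes "AE y in lborel. P (y::real)"
  shows "AE s in lborel. P (x + s)"
proof -
  obtain N where N: "{y \<in> space lborel. \<not> P y} \<subseteq> N" "emeasure lborel N = 0" "N \<in> sets lborel"
    using assms by (rule AE_E)
  have "AE y in lborel. y \<notin> N" using N by (intro AE_not_in null_setsI)
  then have "AE s in lborel. x + 1 * s \<notin> N"
    using N(3) by (intro AE_borel_affine) auto
  then show ?thesis by eventually_elim (use N(1) in auto)
qed

text \<open>Every quotient contains the value at the base point, so equality almost everywhere has
  to be supplemented by equality at \<open>x\<close>. The remaining exceptional pairs lie over a
  null set in one of the coordinates.\<close>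

lemma square_integral_cong_AE:
  assumes ae: "AE y in lborel. f y = g y" and x: "f x = g x"
  shows "square_integral f x \<delta> = square_integral g x \<delta>"
proof -
  obtain N where N: "{s \<in> space lborel. \<not> f (x + s) = g (x + s)} \<subseteq> N" "emeasure lborel N = 0" "N \<in> sets (lborel :: real measure)"
    using AE_lborel_shift[OF ae, of x] by (rule AE_E)
  have aeN: "AE s in lborel. s \<notin> N" using N by (intro AE_not_in null_setsI)
  have [measurable]: "N \<in> sets borel" using N(3) by simp
  have "AE p in lborel \<Otimes>\<^sub>M lborel. fst p \<notin> N \<and> snd p \<notin> N"
  proof (rule lborel_pair.AE_pair_measure)
    show "AE s in lborel. AE t in lborel. fst (s, t) \<notin> N \<and> snd (s, t) \<notin> N"
      using aeN
    proof eventually_elim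
      case (elim s)
      from aeN show ?case by eventually_elim (use elim in simp)
    qed
  qed measurable
  then have aeP: "AE p in lborel. fst p \<notin> N \<and> snd p \<notin> N" by (simp only: lborel_prod)
  have eq: "diff_quot f x s = diff_quot g x s" if "s \<notin> N" for s
    using N(1) that x by (auto simp: diff_quot_def)
  show ?thesis
    unfolding square_integral_def nn_integral_completion
  proof (rule nn_integral_cong_AE, use aeP in eventually_elim)
    case (elim p)
    then show ?case using eq[of "fst p"] eq[of "snd p"] by (simp add: case_prod_beta)
  qed
qed

lemma sets_diff_quot_large [measurable]:
  assumes f: "f \<in> borel_measurable lebesgue"
  shows "{s. \<bar>s\<bar> < r \<and> C < \<bar>diff_quot f x s\<bar>} \<in> sets lebesgue"
proof -
  have [measurable]: "(\<lambda>s. f (x + s)) \<in> borel_measurable lebesgue"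
    using borel_measurable_affine[OF f, of 1 x] by simp
  have [measurable]: "(\<lambda>s::real. s) \<in> borel_measurable lebesgue" by (intro measurable_completion) simp
  have "{s \<in> space lebesgue. \<bar>s\<bar> < r \<and> C < \<bar>(f (x + s) - f x) / s\<bar>} \<in> sets lebesgue" by measurable
  then show ?thesis by (simp add: diff_quot_def)
qed

lemma approx_bounded_cong_AE:
  assumes f: "f \<in> borel_measurable lebesgue" "g \<in> borel_measurable lebesgue"
    and ae: "AE y in lborel. f y = g y" and x: "f x = g x"
  shows "approx_bounded_at_0 (diff_quot f x) \<longleftrightarrow> approx_bounded_at_0 (diff_quot g x)"
proof -
  have "AE s in lebesgue. f (x + s) = g (x + s)"
    using AE_completion[OF AE_lborel_shift[OF ae]] .
  then have "AE s in lebesgue. diff_quot f x s = diff_quot g x s"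
    by eventually_elim (use x in \<open>simp add: diff_quot_def\<close>)
  then have "emeasure lebesgue {s. \<bar>s\<bar> < r \<and> C < \<bar>diff_quot f x s\<bar>} = emeasure lebesgue {s. \<bar>s\<bar> < r \<and> C < \<bar>diff_quot g x s\<bar>}" for r C
    by (intro emeasure_eq_AE sets_diff_quot_large f) (auto elim!: eventually_mono)
  then show ?thesis by (simp add: approx_bounded_at_0_def)
qed

text \<open>The grid argument is carried out for a Borel function \<open>g\<close>. At almost every
  x this \<open>g\<close> agrees with \<open>f\<close> at x itself, and there neither the square
  integral nor approximate boundedness changes.\<close>

theorem AE_approx_bounded:
  assumes f: "f \<in> borel_measurable lebesgue"
  shows "AE x in lebesgue. (\<exists>\<delta>>0. square_integral f x \<delta> < \<infinity>) \<longrightarrow> approx_bounded_at_0 (diff_quot f x)"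
proof -
  obtain g where g: "g \<in> borel_measurable lborel" and ae: "AE y in lborel. f y = g y"
    using completion_ex_borel_measurable_real[OF f] by blast
  then have [measurable]: "g \<in> borel_measurable borel" by simp
  have gl: "g \<in> borel_measurable lebesgue" using g by (rule measurable_completion)
  have "AE x in lborel. (\<exists>\<delta>>0. square_integral f x \<delta> < \<infinity>) \<longrightarrow> approx_bounded_at_0 (diff_quot f x)"
    using ae AE_grid_bounded[OF \<open>g \<in> borel_measurable borel\<close>]
  proof eventually_elim
    case (elim x)
    note grid = elim(2)
    show ?case
    proof
      assume "\<exists>\<delta>>0. square_integral f x \<delta> < \<infinity>"
      then obtain \<delta> where d: "\<delta> > 0" "gagliardo (diff_quot g x) \<delta> < \<infinity>"
        using square_integral_cong_AE[OF ae elim(1)] square_integral_eq_gagliardo[of g x] by auto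
      have "AE l in lborel. AE v in lborel. 1 \<le> l \<and> l < 2 \<and> 0 \<le> v \<and> v < 1 \<longrightarrow> (\<Sum>k. ennreal ((grid_jump (diff_quot g x) k l v)\<^sup>2)) < \<infinity>"
        by (rule AE_grid_jump_summable[OF _ d(2,1)]) measurable
      with grid have "AE l in lborel. AE v in lborel. 1 \<le> l \<and> l < 2 \<and> 0 \<le> v \<and> v < 1 \<longrightarrow> grid_bounded (diff_quot g x) l v"
      proof eventually_elim
        case (elim l)
        then show ?case by eventually_elim blast
      qed
      then have "approx_bounded_at_0 (diff_quot g x)"
        by (intro approx_bounded_of_grid_bounded) measurable
      then show "approx_bounded_at_0 (diff_quot f x)"
        using approx_bounded_cong_AE[OF f gl ae elim(1)] by simp
    qed
  qed
  then show ?thesis by (rule AE_completion)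
qed

section \<open>Density argument with the doubling condition\<close>

lemma dyadic_scale:
  fixes c :: real
  assumes "0 < c" "c < 1 / 2"
  obtains k :: nat where "c < 1 / 2 ^ Suc k" "1 / 2 ^ Suc k \<le> 2 * c"
proof -
  define j where "j = (LEAST j. 1 / 2 ^ j \<le> c)"
  obtain m where "1 / c < 2 ^ m" using real_arch_pow[of 2 "1 / c"] by auto
  then have "1 / 2 ^ m \<le> c" using assms(1) by (simp add: field_simps)
  then have j: "1 / 2 ^ j \<le> c" unfolding j_def by (rule LeastI)
  have less: "c < 1 / 2 ^ i" if "i < j" for i using not_less_Least[OF that[unfolded j_def]] by simp
  have "j \<noteq> 0" "j \<noteq> 1" using j assms by (auto intro: ccontr)
  then obtain k where k: "j = Suc (Suc k)" by (metis One_nat_def not0_implies_Suc)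
  show ?thesis
  proof
    show "c < 1 / 2 ^ Suc k" using less[of "Suc k"] k by simp
    show "1 / 2 ^ Suc k \<le> 2 * c" using j by (simp add: k)
  qed
qed

text \<open>If \<open>y\<close> is close to \<open>x\<close> with \<open>\<bar>f y - f x\<bar>\<close> too large, then for every \<open>x'\<close> of the set near \<open>x\<close>, one of
  \<open>x'\<close> and \<open>2 y - x'\<close> lies in the small exceptional set of the difference quotient at \<open>x\<close>. So the set
  has density zero at each of its points.\<close>

lemma negligible_not_locally_lipschitz:
  assumes f: "f \<in> borel_measurable lebesgue" and r0: "0 < r0"
  shows "negligible {x. (\<forall>h. 0 < \<bar>h\<bar> \<and> \<bar>h\<bar> < r0 \<longrightarrow> \<bar>f (x + 2 * h) - 2 * f (x + h) + f x\<bar> \<le> 2 * C * \<bar>h\<bar>) \<and>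
     approx_bounded_at_0 (diff_quot f x) \<and> \<not> locally_lipschitz_at f x}" (is "negligible ?S")
  unfolding negligible_eq_zero_density
proof (intro ballI allI impI)
  fix x r e :: real assume x: "x \<in> ?S" and r: "0 < r" and e: "0 < e"
  \<comment> \<open>Two copies of an exceptional set of measure at most (e/7) * 6h have measure at
    most 12eh/7, below e times the length 2h of the ball.\<close>
  have "0 < e / 7" using e by simp
  then obtain C1 where C1: "\<And>k. emeasure lebesgue {s. \<bar>s\<bar> < 1 / 2 ^ Suc k \<and> C1 < \<bar>diff_quot f x s\<bar>} \<le> ennreal (e / 7 / 2 ^ Suc k)"
    using x unfolding approx_bounded_at_0_def by blast
  define C2 where "C2 = max C1 0"
  \<comment> \<open>With h = |y - x| < \<open>d0\<close>, the entry \<open>r0 / 2\<close> admits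
    increments up to 2h in the doubling condition, and 1/6 puts 3h in the range of
    \<open>dyadic_scale\<close>.\<close>
  define d0 where "d0 = min r (min (r0 / 2) (1 / 6))"
  have "0 < d0" using r r0 by (simp add: d0_def)
  \<comment> \<open>The factor is half of 3 C2 + C2 + 4 C: two good values at distances up to 3h and
    h, and a second difference with increment below 2h.\<close>
  then obtain y where y: "\<bar>y - x\<bar> < d0" "\<not> \<bar>f y - f x\<bar> \<le> (2 * C2 + 2 * C) * \<bar>y - x\<bar>"
    using x unfolding locally_lipschitz_at_def by blast
  define h where "h = \<bar>y - x\<bar>"
  have h: "0 < h" "h \<le> r" "2 * h < r0" "3 * h < 1 / 2"
    using y by (auto simp: h_def d0_def)
  obtain k where k: "3 * h < 1 / 2 ^ Suc k" "1 / 2 ^ Suc k \<le> 2 * (3 * h)"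
    using dyadic_scale[of "3 * h"] h by auto
  define G where "G = {s. \<bar>s\<bar> < 1 / 2 ^ Suc k \<and> C1 < \<bar>diff_quot f x s\<bar>}"
  have Gs: "G \<in> sets lebesgue" unfolding G_def by (rule sets_diff_quot_large[OF f])
  have Ge: "emeasure lebesgue G \<le> ennreal (e / 7 * (6 * h))"
  proof -
    have "emeasure lebesgue G \<le> ennreal (e / 7 * (1 / 2 ^ Suc k))" using C1[of k] by (simp add: G_def)
    also have "\<dots> \<le> ennreal (e / 7 * (6 * h))" using k(2) e by (intro ennreal_leI mult_left_mono) auto
    finally show ?thesis .
  qed
  \<comment> \<open>A point \<open>x'\<close> lies outside \<open>U\<close> exactly when neither
    \<open>x' - x\<close> nor \<open>(2 * y - x') - x\<close> is an exceptional increment.\<close>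
  define U where "U = (\<lambda>s. 1 *\<^sub>R s + x) ` G \<union> (\<lambda>s. (-1) *\<^sub>R s + (2 * y - x)) ` G"
  have im: "(\<lambda>s. m *\<^sub>R s + c) ` G \<in> sets lebesgue" for m c :: real
    by (intro differentiable_image_in_sets_lebesgue Gs) (auto intro!: derivative_intros simp: differentiable_on_def)
  have Us: "U \<in> sets lebesgue" using im[of 1 x] im[of "-1" "2 * y - x"] by (auto simp: U_def)
  have "emeasure lebesgue U \<le> emeasure lebesgue ((\<lambda>s. 1 *\<^sub>R s + x) ` G) + emeasure lebesgue ((\<lambda>s. (-1) *\<^sub>R s + (2 * y - x)) ` G)"
    unfolding U_def by (rule emeasure_subadditive[OF im im])
  also have "\<dots> = emeasure lebesgue G + emeasure lebesgue G"
    using emeasure_lebesgue_affine[of 1 x G] emeasure_lebesgue_affine[of "-1" "2 * y - x" G] by simp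
  also have "\<dots> \<le> ennreal (e / 7 * (6 * h)) + ennreal (e / 7 * (6 * h))" by (intro add_mono Ge)
  also have "\<dots> = ennreal (e / 7 * (12 * h))" using e h by (simp add: ennreal_plus[symmetric] del: ennreal_plus)
  finally have Ue: "emeasure lebesgue U \<le> ennreal (e / 7 * (12 * h))" .
  then have "U \<in> fmeasurable lebesgue" using Us by (intro fmeasurableI) (auto intro: le_less_trans)
  moreover have "measure lebesgue U < e * measure lebesgue (ball x h)"
  proof -
    have "measure lebesgue U \<le> e / 7 * (12 * h)"
      unfolding measure_def using Ue e h by (intro enn2real_leI) auto
    also have "\<dots> < e * (2 * h)" using e h by simp
    also have "2 * h = measure lebesgue (ball x h)"
      using h by (simp add: ball_eq_greaterThanLessThan)
    finally show ?thesis .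
  qed
  moreover have "?S \<inter> ball x h \<subseteq> U"
  proof
    fix x' assume x': "x' \<in> ?S \<inter> ball x h"
    then have xh: "\<bar>x' - x\<bar> < h" by (simp add: dist_real_def abs_minus_commute)
    have lin: "y - x \<le> h" "x - y \<le> h" "x' - x < h" "x - x' < h"
      using xh by (auto simp: h_def)
    have good: "\<bar>f (x + s) - f x\<bar> \<le> C2 * \<bar>s\<bar>" if "s \<notin> G" "\<bar>s\<bar> \<le> 3 * h" for s
    proof (cases "s = 0")
      case False
      have "\<bar>diff_quot f x s\<bar> \<le> C1" using that k(1) by (auto simp: G_def)
      then have "\<bar>f (x + s) - f x\<bar> \<le> C1 * \<bar>s\<bar>" using False by (simp add: diff_quot_def field_simps)
      also have "\<dots> \<le> C2 * \<bar>s\<bar>" by (intro mult_right_mono) (auto simp: C2_def)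
      finally show ?thesis .
    qed simp
    show "x' \<in> U"
    proof (rule ccontr)
      assume "x' \<notin> U"
      define \<eta> where "\<eta> = y - x'"
      have "x' - x \<notin> G" "2 * y - x - x' \<notin> G"
        using \<open>x' \<notin> U\<close> by (auto simp: U_def image_iff Bex_def)
      moreover have "\<bar>x' - x\<bar> \<le> 3 * h" using xh h(1) by linarith
      moreover have "\<bar>2 * y - x - x'\<bar> \<le> 3 * h"
      proof (rule abs_leI)
        show "2 * y - x - x' \<le> 3 * h" using lin by linarith
        show "- (2 * y - x - x') \<le> 3 * h" using lin by linarith
      qed
      ultimately have g1: "\<bar>f x' - f x\<bar> \<le> C2 * \<bar>x' - x\<bar>" and g2: "\<bar>f (2 * y - x') - f x\<bar> \<le> C2 * \<bar>2 * y - x' - x\<bar>"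
        using good[of "x' - x"] good[of "2 * y - x - x'"] by (auto simp: algebra_simps)
      have C2: "0 \<le> C2" by (simp add: C2_def)
      have b1: "\<bar>f x' - f x\<bar> \<le> C2 * h" using g1 mult_left_mono[OF less_imp_le[OF xh] C2] by linarith
      have "\<bar>2 * y - x' - x\<bar> \<le> 3 * h" using lin by (intro abs_leI; linarith)
      then have b2: "\<bar>f (2 * y - x') - f x\<bar> \<le> C2 * (3 * h)" using g2 mult_left_mono[OF _ C2] by (meson order_trans)
      have "y \<noteq> x'" using xh by (auto simp: h_def)
      then have eta: "0 < \<bar>\<eta>\<bar>" "\<bar>\<eta>\<bar> < 2 * h"
        using lin by (simp_all add: \<eta>_def abs_less_iff)
      have b3: "\<bar>f (x' + 2 * \<eta>) - 2 * f (x' + \<eta>) + f x'\<bar> \<le> 2 * C * \<bar>\<eta>\<bar>"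
        using x' eta h(3) by auto
      have "0 \<le> 2 * C * \<bar>\<eta>\<bar>" using b3 by (rule order_trans[OF abs_ge_zero])
      then have "0 \<le> C" using eta by (simp add: zero_le_mult_iff)
      then have "2 * C * \<bar>\<eta>\<bar> \<le> 2 * C * (2 * h)" using eta by (intro mult_left_mono) auto
      moreover have e1: "x' + 2 * \<eta> = 2 * y - x'" and e2: "x' + \<eta> = y" by (auto simp: \<eta>_def)
      ultimately have b4: "\<bar>f (2 * y - x') - 2 * f y + f x'\<bar> \<le> 4 * (C * h)"
        using b3[unfolded e1 e2] by simp
      have "2 * (f y - f x) = (f (2 * y - x') - f x) + (f x' - f x) - (f (2 * y - x') - 2 * f y + f x')" by simp
      then have "\<bar>2 * (f y - f x)\<bar> \<le> C2 * (3 * h) + C2 * h + 4 * (C * h)"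
        using b1 b2 b4 by linarith
      then have "\<bar>f y - f x\<bar> \<le> (2 * C2 + 2 * C) * h" by (simp add: algebra_simps)
      with y(2) show False by (simp add: h_def)
    qed
  qed
  ultimately show "\<exists>d>0. d \<le> r \<and> (\<exists>U. ?S \<inter> ball x d \<subseteq> U \<and> U \<in> lmeasurable \<and> measure lebesgue U < e * measure lebesgue (ball x d))"
    using h by blast
qed

text \<open>The doubling difference is the second difference f(x + 2h) - 2 f(x + h) + f(x) divided
  by 2h, so the \<open>Limsup\<close> condition gives the hypothesis of the density argument for
  some natural bound and some radius 1/(n + 1). Countably many negligible sets remain.\<close>

theorem AE_differentiable_of_square_integral:
  assumes f: "f \<in> borel_measurable lebesgue"
  shows "AE x in lebesgue.
            Limsup (at 0) (\<lambda>h. ereal \<bar>diff_quot f x (2 * h) - diff_quot f x h\<bar>) < \<infinity> \<and>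
            (\<exists>\<delta>>0. square_integral f x \<delta> < \<infinity>)
            \<longrightarrow> f differentiable (at x)"
proof -
  let ?S = "\<lambda>(C::nat) (n::nat). {x. (\<forall>h. 0 < \<bar>h\<bar> \<and> \<bar>h\<bar> < inverse (real (Suc n)) \<longrightarrow> \<bar>f (x + 2 * h) - 2 * f (x + h) + f x\<bar> \<le> 2 * real C * \<bar>h\<bar>) \<and>
     approx_bounded_at_0 (diff_quot f x) \<and> \<not> locally_lipschitz_at f x}"
  have "AE x in lebesgue. \<forall>C n. x \<notin> ?S C n"
    unfolding AE_all_countable
  proof (intro allI AE_not_in)
    fix C n :: nat
    have "negligible (?S C n)" by (rule negligible_not_locally_lipschitz[OF f]) simp
    then show "?S C n \<in> null_sets lebesgue" by (simp only: negligible_iff_null_sets)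
  qed
  with AE_approx_bounded[OF f] stepanov[of f] show ?thesis
  proof eventually_elim
    case (elim x)
    show ?case
    proof
      assume *: "Limsup (at 0) (\<lambda>h. ereal \<bar>diff_quot f x (2 * h) - diff_quot f x h\<bar>) < \<infinity> \<and> (\<exists>\<delta>>0. square_integral f x \<delta> < \<infinity>)"
      then obtain C :: nat where "Limsup (at 0) (\<lambda>h. ereal \<bar>diff_quot f x (2 * h) - diff_quot f x h\<bar>) < ereal (real C)"
        using less_PInf_Ex_of_nat by fastforce
      then have "\<forall>\<^sub>F h in at 0. \<bar>diff_quot f x (2 * h) - diff_quot f x h\<bar> < real C"
        using Limsup_lessD by fastforce
      then obtain d where d: "0 < d" "\<And>h. h \<noteq> 0 \<Longrightarrow> \<bar>h\<bar> < d \<Longrightarrow> \<bar>diff_quot f x (2 * h) - diff_quot f x h\<bar> < real C"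
        by (auto simp: eventually_at dist_real_def)
      obtain n where n: "inverse (real (Suc n)) < d" using reals_Archimedean[OF d(1)] by blast
      have "\<bar>f (x + 2 * h) - 2 * f (x + h) + f x\<bar> \<le> 2 * real C * \<bar>h\<bar>"
        if "0 < \<bar>h\<bar> \<and> \<bar>h\<bar> < inverse (real (Suc n))" for h
      proof -
        have h: "h \<noteq> 0" "\<bar>h\<bar> < d" using that n by auto
        have "f (x + 2 * h) - 2 * f (x + h) + f x = 2 * h * (diff_quot f x (2 * h) - diff_quot f x h)"
          using h(1) by (simp add: diff_quot_def field_simps)
        then have "\<bar>f (x + 2 * h) - 2 * f (x + h) + f x\<bar> = 2 * \<bar>h\<bar> * \<bar>diff_quot f x (2 * h) - diff_quot f x h\<bar>"
          by (simp add: abs_mult)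
        also have "\<dots> \<le> 2 * \<bar>h\<bar> * real C" using d(2)[OF h] by (intro mult_left_mono) auto
        finally show ?thesis by (simp add: mult_ac)
      qed
      then have "locally_lipschitz_at f x" using elim(1,3) * by blast
      then show "f differentiable (at x)" using elim(2) by blast
    qed
  qed
qed

section \<open>Melnikov's symmetrisation\<close>

text \<open>In terms of the increments p and q over s and t, the polarisation 2pq = p^2 + q^2 - (p -
  q)^2 removes the mixed term and leaves one square for each pair of nodes.\<close>

lemma divided_difference_square:
  fixes g :: "real \<Rightarrow> real"
  assumes "s \<noteq> 0" "t \<noteq> 0" "s \<noteq> t"
  shows "(diff_quot g x s - diff_quot g x t)\<^sup>2 / (s - t)\<^sup>2 =
    (diff_quot g (x + t) (s - t))\<^sup>2 / (s * t) - (diff_quot g x s)\<^sup>2 / (t * (s - t)) + (diff_quot g x t)\<^sup>2 / (s * (s - t))"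
proof -
  define p q where "p = g (x + s) - g x" and "q = g (x + t) - g x"
  have pq: "g (x + t + (s - t)) - g (x + t) = p - q" by (simp add: p_def q_def)
  show ?thesis
    unfolding diff_quot_def pq p_def[symmetric] q_def[symmetric]
    using assms by (simp add: divide_simps power2_eq_square) algebra
qed

definition trunc :: "real \<Rightarrow> real set" where "trunc \<eta> = {t. \<eta> \<le> \<bar>t\<bar> \<and> \<bar>t\<bar> \<le> 1}"

text \<open>The principal value of \<open>1 / (t (w - t))\<close> over the whole line is \<open>0\<close>, so the positive part of
  \<open>- kern \<eta> w\<close> comes from the inner truncation only.\<close>

definition kern :: "real \<Rightarrow> real \<Rightarrow> real" where
  "kern \<eta> w = (\<integral>t. indicator (trunc \<eta>) t * indicator (trunc \<eta>) (w - t) / (t * (w - t)) \<partial>lborel)"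

lemma measurable_trunc [measurable]: "trunc \<eta> \<in> sets borel"
  unfolding trunc_def by measurable

lemma kern_uminus: "kern \<eta> (- w) = kern \<eta> w"
proof -
  have "kern \<eta> (- w) = (\<integral>t. indicator (trunc \<eta>) (0 + (-1) * t) * indicator (trunc \<eta>) (- w - (0 + (-1) * t)) / ((0 + (-1) * t) * (- w - (0 + (-1) * t))) \<partial>lborel)"
    unfolding kern_def by (subst lborel_integral_real_affine[of "-1" _ 0]) simp_all
  also have "\<dots> = kern \<eta> w"
    unfolding kern_def
    by (intro Bochner_Integration.integral_cong)
       (auto simp: trunc_def indicator_def abs_minus_commute minus_diff_commute algebra_simps intro: arg_cong)
  finally show ?thesis .
qed

text \<open>Partial fractions give logarithms on the intervals left of 0, between 0 and w, and right
  of w. Each outer part is at most ln((w + \<eta>)/\<eta>)/w, as the cutoff at 1 only lowers it, and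
  the middle part cancels them up to 2 ln((w + \<eta>)/(w - \<eta>))/w. For w < 2\<eta> the middle
  part is empty and the outer ones together are already at most 2/\<eta>.\<close>

lemma kern_lower_bound_pos:
  assumes \<eta>: "0 < \<eta>" and w: "\<eta> \<le> w" "w \<le> 1"
  shows "- kern \<eta> w \<le> 8 * \<eta> / w\<^sup>2"
proof -
  define a where "a = ln ((w + \<eta>) / \<eta>) / w"
  have w0: "0 < w" using assms by simp
  define A where "A t = 1 / ((- t) * (w - t)) * indicator {w - 1..- \<eta>} t" for t
  define B where "B t = 1 / (t * (t - w)) * indicator {w + \<eta>..1} t" for t
  define C where "C t = 1 / (t * (w - t)) * indicator {\<eta>..w - \<eta>} t" for t
  have lnw: "ln (1 - w) / w \<le> 0" if "w < 1" using w0 that by (simp add: divide_nonpos_pos)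
  have A: "integrable lborel A \<and> integral\<^sup>L lborel A \<le> a"
  proof (cases "w - 1 \<le> - \<eta>")
    case True
    have "has_bochner_integral lborel (\<lambda>t. 1 / ((- t) * (w - t)) * indicator {w - 1..- \<eta>} t)
        ((ln (w - (- \<eta>)) - ln (- (- \<eta>))) / w - (ln (w - (w - 1)) - ln (- (w - 1))) / w)"
    proof (rule has_bochner_integral_FTC_Icc_nonneg[where F = "\<lambda>t. (ln (w - t) - ln (- t)) / w", OF _ _ _ True])
      fix t assume "t \<in> {w - 1..- \<eta>}"
      then have t: "w - 1 \<le> t" "t \<le> - \<eta>" by auto
      then show "((\<lambda>t. (ln (w - t) - ln (- t)) / w) has_real_derivative 1 / ((- t) * (w - t))) (at t)"
        using \<eta> w0 by (auto intro!: derivative_eq_intros simp: field_simps)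
      show "0 \<le> 1 / ((- t) * (w - t))" using t \<eta> w0 by (intro divide_nonneg_nonneg mult_nonneg_nonneg) auto
    qed auto
    then have hb: "has_bochner_integral lborel A ((ln (w + \<eta>) - ln \<eta>) / w - (ln 1 - ln (1 - w)) / w)"
      unfolding A_def by simp
    have "ln (w + \<eta>) - ln \<eta> = ln ((w + \<eta>) / \<eta>)" using \<eta> w0 by (simp add: ln_div)
    then have "(ln (w + \<eta>) - ln \<eta>) / w - (ln 1 - ln (1 - w)) / w \<le> a"
      using lnw True \<eta> by (simp add: a_def)
    then show ?thesis using hb by (simp add: has_bochner_integral_iff)
  next
    case False
    then have "A = (\<lambda>_. 0)" by (auto simp: A_def)
    moreover have "0 \<le> a" using \<eta> w0 by (simp add: a_def)
    ultimately show ?thesis by simp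
  qed
  have B: "integrable lborel B \<and> integral\<^sup>L lborel B \<le> a"
  proof (cases "w + \<eta> \<le> 1")
    case True
    have "has_bochner_integral lborel (\<lambda>t. 1 / (t * (t - w)) * indicator {w + \<eta>..1} t)
        ((ln (1 - w) - ln 1) / w - (ln (w + \<eta> - w) - ln (w + \<eta>)) / w)"
    proof (rule has_bochner_integral_FTC_Icc_nonneg[where F = "\<lambda>t. (ln (t - w) - ln t) / w", OF _ _ _ True])
      fix t assume "t \<in> {w + \<eta>..1}"
      then have t: "w + \<eta> \<le> t" "t \<le> 1" by auto
      then have "0 < t" "0 < t - w" using \<eta> w0 by auto
      then show "((\<lambda>t. (ln (t - w) - ln t) / w) has_real_derivative 1 / (t * (t - w))) (at t)"
        using w0 by (auto intro!: derivative_eq_intros simp: field_simps)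
      show "0 \<le> 1 / (t * (t - w))" using t \<eta> w0 by (intro divide_nonneg_nonneg mult_nonneg_nonneg) auto
    qed auto
    then have hb: "has_bochner_integral lborel B ((ln (1 - w) - ln 1) / w - (ln \<eta> - ln (w + \<eta>)) / w)"
      unfolding B_def by simp
    have "- (ln \<eta> - ln (w + \<eta>)) = ln ((w + \<eta>) / \<eta>)" using \<eta> w0 by (simp add: ln_div)
    then have "- ((ln \<eta> - ln (w + \<eta>)) / w) = a" unfolding minus_divide_left by (simp only: a_def)
    then have "(ln (1 - w) - ln 1) / w - (ln \<eta> - ln (w + \<eta>)) / w \<le> a"
      using lnw True \<eta> by simp
    then show ?thesis using hb by (simp add: has_bochner_integral_iff)
  next
    case False
    then have "B = (\<lambda>_. 0)" by (auto simp: B_def)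
    moreover have "0 \<le> a" using \<eta> w0 by (simp add: a_def)
    ultimately show ?thesis by simp
  qed
  have C: "integrable lborel C \<and> 2 * a - integral\<^sup>L lborel C \<le> 8 * \<eta> / w\<^sup>2"
  proof (cases "2 * \<eta> \<le> w")
    case True
    then have le: "\<eta> \<le> w - \<eta>" by simp
    have "has_bochner_integral lborel (\<lambda>t. 1 / (t * (w - t)) * indicator {\<eta>..w - \<eta>} t)
        ((ln (w - \<eta>) - ln (w - (w - \<eta>))) / w - (ln \<eta> - ln (w - \<eta>)) / w)"
    proof (rule has_bochner_integral_FTC_Icc_nonneg[where F = "\<lambda>t. (ln t - ln (w - t)) / w", OF _ _ _ le])
      fix t assume "t \<in> {\<eta>..w - \<eta>}"
      then have t: "\<eta> \<le> t" "t \<le> w - \<eta>" by auto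
      then have "0 < t" "0 < w - t" using \<eta> by auto
      then show "((\<lambda>t. (ln t - ln (w - t)) / w) has_real_derivative 1 / (t * (w - t))) (at t)"
        using w0 by (auto intro!: derivative_eq_intros simp: field_simps)
      show "0 \<le> 1 / (t * (w - t))" using t \<eta> w0 by (intro divide_nonneg_nonneg mult_nonneg_nonneg) auto
    qed auto
    then have hb: "has_bochner_integral lborel C ((ln (w - \<eta>) - ln \<eta>) / w - (ln \<eta> - ln (w - \<eta>)) / w)"
      unfolding C_def by simp
    have wp: "0 < w - \<eta>" using True \<eta> by simp
    have "2 * a - ((ln (w - \<eta>) - ln \<eta>) / w - (ln \<eta> - ln (w - \<eta>)) / w) = 2 * (ln ((w + \<eta>) / (w - \<eta>)) / w)"
      using \<eta> w0 wp by (simp add: a_def ln_div field_simps)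
    also have "\<dots> \<le> 2 * (((w + \<eta>) / (w - \<eta>) - 1) / w)"
      using \<eta> w0 wp by (intro mult_left_mono divide_right_mono ln_le_minus_one) auto
    also have "\<dots> = 4 * \<eta> / ((w - \<eta>) * w)" using wp w0 by (simp add: field_simps)
    also have "\<dots> \<le> 4 * \<eta> / ((w / 2) * w)"
      using True \<eta> w0 wp by (intro divide_left_mono mult_right_mono mult_pos_pos) auto
    also have "\<dots> = 8 * \<eta> / w\<^sup>2" by (simp add: power2_eq_square)
    finally show ?thesis using hb by (simp add: has_bochner_integral_iff)
  next
    case False
    then have C0: "C = (\<lambda>_. 0)" by (auto simp: C_def)
    have "2 * a \<le> 2 * (((w + \<eta>) / \<eta> - 1) / w)"
      unfolding a_def using \<eta> w0 by (intro mult_left_mono divide_right_mono ln_le_minus_one) auto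
    also have "\<dots> = 2 / \<eta>" using \<eta> w0 by (simp add: field_simps)
    also have "\<dots> \<le> 8 * \<eta> / w\<^sup>2"
    proof -
      have "w\<^sup>2 \<le> (2 * \<eta>)\<^sup>2" using False w0 by (intro power_mono) auto
      then show ?thesis using \<eta> w0 by (simp add: field_simps power2_eq_square)
    qed
    finally show ?thesis using C0 by simp
  qed
  have "indicator (trunc \<eta>) t * indicator (trunc \<eta>) (w - t) / (t * (w - t)) = C t - A t - B t" for t
  proof -
    consider "t < 0" | "0 \<le> t" "t \<le> w" | "w < t" by linarith
    then show ?thesis
    proof cases
      case 1
      have iff: "t \<in> trunc \<eta> \<and> w - t \<in> trunc \<eta> \<longleftrightarrow> t \<in> {w - 1..- \<eta>}" "t \<notin> {w + \<eta>..1}" "t \<notin> {\<eta>..w - \<eta>}"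
        using 1 \<eta> w by (auto simp: trunc_def)
      then show ?thesis by (auto simp: A_def B_def C_def indicator_def simp flip: minus_divide_right)
    next
      case 2
      have iff: "t \<in> trunc \<eta> \<and> w - t \<in> trunc \<eta> \<longleftrightarrow> t \<in> {\<eta>..w - \<eta>}" "t \<notin> {w + \<eta>..1}" "t \<notin> {w - 1..- \<eta>}"
        using 2 \<eta> w by (auto simp: trunc_def)
      then show ?thesis by (auto simp: A_def B_def C_def indicator_def)
    next
      case 3
      have iff: "t \<in> trunc \<eta> \<and> w - t \<in> trunc \<eta> \<longleftrightarrow> t \<in> {w + \<eta>..1}" "t \<notin> {\<eta>..w - \<eta>}" "t \<notin> {w - 1..- \<eta>}"
        using 3 \<eta> w by (auto simp: trunc_def)
      have "1 / (t * (w - t)) = - (1 / (t * (t - w)))"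
        by (metis minus_diff_eq minus_divide_right mult_minus_right)
      with iff show ?thesis by (auto simp: A_def B_def C_def indicator_def)
    qed
  qed
  then have "kern \<eta> w = integral\<^sup>L lborel C - integral\<^sup>L lborel A - integral\<^sup>L lborel B"
    unfolding kern_def using A B C by simp
  then show ?thesis using A B C by linarith
qed

lemma kern_lower_bound:
  assumes "0 < \<eta>" "w \<in> trunc \<eta>"
  shows "- kern \<eta> w \<le> 8 * \<eta> / w\<^sup>2"
proof (cases "0 \<le> w")
  case True
  then show ?thesis using kern_lower_bound_pos[of \<eta> w] assms by (simp add: trunc_def)
next
  case False
  then show ?thesis using kern_lower_bound_pos[of \<eta> "- w"] assms kern_uminus[of \<eta> w] by (simp add: trunc_def)
qed

section \<open>Integrated divided differences of a Lipschitz function\<close>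

definition energy :: "(real \<Rightarrow> real) \<Rightarrow> real \<Rightarrow> real" where
  "energy g w = (\<integral>x. (diff_quot g x w)\<^sup>2 \<partial>lborel)"

text \<open>Constancy outside an interval confines the difference quotients of step at most 1 to a
  bounded set, which makes their squared norms finite. Only increments matter, so the two constants
  may differ.\<close>

locale lipschitz_const_outside =
  fixes g :: "real \<Rightarrow> real" and n a b :: real
  assumes lip: "\<bar>g x - g y\<bar> \<le> n * \<bar>x - y\<bar>"
    and left_const: "x \<le> a \<Longrightarrow> g x = g a" and right_const: "b \<le> x \<Longrightarrow> g x = g b"
    and ab: "a \<le> b"
begin

lemma g_measurable [measurable]: "g \<in> borel_measurable borel"
proof -
  have "n \<ge> 0" using lip[of 0 1] abs_ge_zero[of "g 0 - g 1"] by simp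
  then have "continuous_on UNIV g"
    using lip by (intro lipschitz_on_continuous_on[of n]) (auto simp: lipschitz_on_def dist_real_def)
  then show ?thesis by (rule borel_measurable_continuous_onI)
qed

text \<open>\<open>n\<^sup>2\<close> times the length of \<open>{a - 1..b + 1}\<close>, outside of
  which the quotients of step at most 1 vanish.\<close>

definition K :: real where "K = n\<^sup>2 * (b - a + 2)"

lemma K_nonneg: "0 \<le> K" using ab by (simp add: K_def)

lemma diff_quot_le: "(diff_quot g x w)\<^sup>2 \<le> n\<^sup>2"
proof -
  have "\<bar>diff_quot g x w\<bar> \<le> n"
  proof (cases "w = 0")
    case False
    then show ?thesis using lip[of "x + w" x] by (simp add: diff_quot_def field_simps)
  next
    case True
    then show ?thesis using lip[of 0 1] abs_ge_zero[of "g 0 - g 1"] by (simp add: diff_quot_def)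
  qed
  then show ?thesis by (simp add: abs_le_square_iff[symmetric])
qed

lemma diff_quot_outside:
  assumes "\<bar>w\<bar> \<le> 1" "x \<notin> {a - 1..b + 1}"
  shows "diff_quot g x w = 0"
proof -
  consider "x < a - 1" | "b + 1 < x" using assms by fastforce
  then show ?thesis
  proof cases
    case 1
    then show ?thesis using left_const[of x] left_const[of "x + w"] assms by (simp add: diff_quot_def)
  next
    case 2
    then show ?thesis using right_const[of x] right_const[of "x + w"] assms by (simp add: diff_quot_def)
  qed
qed

lemma integrable_diff_quot:
  assumes "\<bar>w\<bar> \<le> 1"
  shows "integrable lborel (\<lambda>x. (diff_quot g x w)\<^sup>2)"
proof (rule integrableI_bounded_set[where A = "{a - 1..b + 1}" and B = "n\<^sup>2"])
  show "AE x in lborel. x \<notin> {a - 1..b + 1} \<longrightarrow> (diff_quot g x w)\<^sup>2 = 0"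
    using diff_quot_outside[OF assms] by auto
qed (use diff_quot_le in \<open>auto simp: emeasure_lborel_Icc_eq\<close>)

lemma energy_nonneg: "0 \<le> energy g w"
  by (simp add: energy_def)

lemma energy_le:
  assumes "\<bar>w\<bar> \<le> 1"
  shows "energy g w \<le> K"
proof -
  have "energy g w \<le> (\<integral>x. n\<^sup>2 * indicator {a - 1..b + 1} x \<partial>lborel)"
    unfolding energy_def
  proof (rule integral_mono[OF integrable_diff_quot[OF assms]])
    show "integrable lborel (\<lambda>x. n\<^sup>2 * indicator {a - 1..b + 1} x :: real)"
      by (intro integrable_mult_right integrable_real_indicator) (auto simp: emeasure_lborel_Icc_eq)
    fix x
    show "(diff_quot g x w)\<^sup>2 \<le> n\<^sup>2 * indicator {a - 1..b + 1} x"
      using diff_quot_le[of x w] diff_quot_outside[OF assms, of x] by (auto simp: indicator_def)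
  qed
  also have "\<dots> = K" using ab by (simp add: K_def)
  finally show ?thesis .
qed

lemma measurable_energy [measurable]: "energy g \<in> borel_measurable borel"
proof -
  have "(\<lambda>w. \<integral>x. (diff_quot g x w)\<^sup>2 \<partial>lborel) \<in> borel_measurable borel" by measurable
  then show ?thesis by (simp add: energy_def[abs_def])
qed

text \<open>Integration of the algebraic identity in x; translation invariance moves the base point
  x + t of the first square to x. The signed combination is nonnegative because it is the integral
  of a square.\<close>

lemma nn_integral_divided_difference:
  assumes st: "s \<noteq> 0" "t \<noteq> 0" "s \<noteq> t" "\<bar>s\<bar> \<le> 1" "\<bar>t\<bar> \<le> 1" "\<bar>s - t\<bar> \<le> 1"
  shows "(\<integral>\<^sup>+x. ennreal ((diff_quot g x s - diff_quot g x t)\<^sup>2 / (s - t)\<^sup>2) \<partial>lborel) =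
    ennreal (energy g (s - t) / (s * t) - energy g s / (t * (s - t)) + energy g t / (s * (s - t)))"
    and "0 \<le> energy g (s - t) / (s * t) - energy g s / (t * (s - t)) + energy g t / (s * (s - t))"
proof -
  have shift: "integrable lborel (\<lambda>x. (diff_quot g (x + t) (s - t))\<^sup>2)"
    using lborel_integrable_real_affine[OF integrable_diff_quot[OF st(6)], of 1 t] by (simp add: add.commute)
  have shiftI: "(\<integral>x. (diff_quot g (x + t) (s - t))\<^sup>2 \<partial>lborel) = energy g (s - t)"
    unfolding energy_def by (subst (2) lborel_integral_real_affine[of 1 _ t]) (simp_all add: add.commute)
  note I = integrable_diff_quot[OF st(4)] integrable_diff_quot[OF st(5)] shift
  have int: "integrable lborel (\<lambda>x. (diff_quot g x s - diff_quot g x t)\<^sup>2 / (s - t)\<^sup>2)"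
    unfolding divided_difference_square[OF st(1-3)] using I by simp
  have eq: "(\<integral>x. (diff_quot g x s - diff_quot g x t)\<^sup>2 / (s - t)\<^sup>2 \<partial>lborel) =
      energy g (s - t) / (s * t) - energy g s / (t * (s - t)) + energy g t / (s * (s - t))"
    unfolding divided_difference_square[OF st(1-3)] using I shiftI by (simp add: energy_def)
  show "(\<integral>\<^sup>+x. ennreal ((diff_quot g x s - diff_quot g x t)\<^sup>2 / (s - t)\<^sup>2) \<partial>lborel) =
    ennreal (energy g (s - t) / (s * t) - energy g s / (t * (s - t)) + energy g t / (s * (s - t)))"
    unfolding eq[symmetric] by (rule nn_integral_eq_integral[OF int]) simp
  show "0 \<le> energy g (s - t) / (s * t) - energy g s / (t * (s - t)) + energy g t / (s * (s - t))"
    unfolding eq[symmetric] by simp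
qed

end

text \<open>Up to sign s, t and s - t are the differences of the three nodes, and
  \<open>trunc\<close> is even, so \<open>cut\<close> is invariant under permutations of the nodes.
  This symmetry makes the three terms contribute equally.\<close>

definition cut :: "real \<Rightarrow> real \<Rightarrow> real \<Rightarrow> real" where
  "cut \<eta> s t = indicator (trunc \<eta>) s * indicator (trunc \<eta>) t * indicator (trunc \<eta>) (s - t)"

lemma measurable_cut [measurable (raw)]:
  assumes [measurable]: "p \<in> borel_measurable M" "q \<in> borel_measurable M"
  shows "(\<lambda>x. cut \<eta> (p x) (q x)) \<in> borel_measurable M"
  unfolding cut_def by measurable

lemma cut_nonneg [simp]: "0 \<le> cut \<eta> s t"
  by (simp add: cut_def)

lemma integrable_cut:
  assumes [measurable]: "F \<in> borel_measurable (lborel \<Otimes>\<^sub>M lborel)" and B0: "0 \<le> B"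
    and B: "\<And>s t. s \<in> trunc \<eta> \<Longrightarrow> t \<in> trunc \<eta> \<Longrightarrow> s - t \<in> trunc \<eta> \<Longrightarrow> \<bar>F (s, t)\<bar> \<le> B"
  shows "integrable (lborel \<Otimes>\<^sub>M lborel) (\<lambda>z. cut \<eta> (fst z) (snd z) * F z)"
proof (rule integrableI_bounded_set[where A = "{-1..1} \<times> {-1..1}" and B = B])
  show "(\<lambda>z. cut \<eta> (fst z) (snd z) * F z) \<in> borel_measurable (lborel \<Otimes>\<^sub>M lborel)" by measurable
  show "emeasure (lborel \<Otimes>\<^sub>M lborel) ({-1..1::real} \<times> {-1..1::real}) < \<infinity>"
    by (subst lborel.emeasure_pair_measure_Times) (auto simp: ennreal_mult_less_top)
  have "norm (cut \<eta> (fst z) (snd z) * F z) \<le> B" for z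
    using B[of "fst z" "snd z"] B0 by (auto simp: cut_def indicator_def)
  then show "AE z in lborel \<Otimes>\<^sub>M lborel. z \<in> {- 1..1} \<times> {- 1..1} \<longrightarrow> norm (cut \<eta> (fst z) (snd z) * F z) \<le> B"
    by simp
  have "cut \<eta> (fst z) (snd z) * F z = 0" if "z \<notin> {- 1..1} \<times> {- 1..1}" for z
    using that by (cases z) (auto simp: cut_def indicator_def trunc_def)
  then show "AE z in lborel \<Otimes>\<^sub>M lborel. z \<notin> {- 1..1} \<times> {- 1..1} \<longrightarrow> cut \<eta> (fst z) (snd z) * F z = 0"
    by simp
qed auto

text \<open>The integral is 16 - 16\<eta>, so the inner cutoff costs a bounded amount however small
  \<eta> is.\<close>

lemma integral_inverse_square_trunc:
  assumes "0 < \<eta>" "\<eta> \<le> 1"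
  shows "integrable lborel (\<lambda>w. indicator (trunc \<eta>) w * (8 * \<eta> / w\<^sup>2))"
    and "(\<integral>w. indicator (trunc \<eta>) w * (8 * \<eta> / w\<^sup>2) \<partial>lborel) \<le> 16"
proof -
  have p: "has_bochner_integral lborel (\<lambda>w. (8 * \<eta> / w\<^sup>2) * indicator {\<eta>..1} w) (- 8 * \<eta> / 1 - (- 8 * \<eta> / \<eta>))"
  proof (rule has_bochner_integral_FTC_Icc_nonneg[where F = "\<lambda>w. - 8 * \<eta> / w"])
    fix w assume "w \<in> {\<eta>..1}"
    then have "0 < w" using assms by auto
    then show "((\<lambda>w. - 8 * \<eta> / w) has_real_derivative 8 * \<eta> / w\<^sup>2) (at w)"
      by (auto intro!: derivative_eq_intros simp: power2_eq_square)
  qed (use assms in auto)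
  have m: "has_bochner_integral lborel (\<lambda>w. (8 * \<eta> / w\<^sup>2) * indicator {-1..-\<eta>} w) (- 8 * \<eta> / (- \<eta>) - (- 8 * \<eta> / (- 1)))"
  proof (rule has_bochner_integral_FTC_Icc_nonneg[where F = "\<lambda>w. - 8 * \<eta> / w"])
    fix w assume "w \<in> {-1..-\<eta>}"
    then have "w < 0" using assms by auto
    then show "((\<lambda>w. - 8 * \<eta> / w) has_real_derivative 8 * \<eta> / w\<^sup>2) (at w)"
      by (auto intro!: derivative_eq_intros simp: power2_eq_square)
  qed (use assms in auto)
  have eq: "indicator (trunc \<eta>) w * (8 * \<eta> / w\<^sup>2) = (8 * \<eta> / w\<^sup>2) * indicator {\<eta>..1} w + (8 * \<eta> / w\<^sup>2) * indicator {-1..-\<eta>} w" for w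
    using assms by (auto simp: trunc_def indicator_def)
  from has_bochner_integral_add[OF p m]
  have "has_bochner_integral lborel (\<lambda>w. indicator (trunc \<eta>) w * (8 * \<eta> / w\<^sup>2)) (16 - 16 * \<eta>)"
    unfolding eq using assms by (simp add: field_simps)
  then show "integrable lborel (\<lambda>w. indicator (trunc \<eta>) w * (8 * \<eta> / w\<^sup>2))"
    and "(\<integral>w. indicator (trunc \<eta>) w * (8 * \<eta> / w\<^sup>2) \<partial>lborel) \<le> 16"
    using assms by (auto simp: has_bochner_integral_iff)
qed

context lipschitz_const_outside
begin

text \<open>For admissible s and t this is the integral over x of the squared second divided
  difference, by \<open>nn_integral_divided_difference\<close>.\<close>

definition cross :: "real \<Rightarrow> real \<Rightarrow> real" where
  "cross s t = energy g (s - t) / (s * t) - energy g s / (t * (s - t)) + energy g t / (s * (s - t))"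

lemma energy_quotient_bound:
  assumes "0 < \<eta>" "p \<in> trunc \<eta>" "q \<in> trunc \<eta>" "w \<in> trunc \<eta>"
  shows "\<bar>energy g w / (p * q)\<bar> \<le> K / \<eta>\<^sup>2"
proof -
  have "\<eta> * \<eta> \<le> \<bar>p\<bar> * \<bar>q\<bar>" using assms by (intro mult_mono) (auto simp: trunc_def)
  moreover have "energy g w \<le> K" using assms by (intro energy_le) (auto simp: trunc_def)
  ultimately show ?thesis
    using energy_nonneg[of w] K_nonneg assms
    by (simp add: abs_divide abs_mult power2_eq_square) (intro frac_le, auto)
qed

text \<open>Fixing the variable in the energy and integrating out the other one turns the second and
  third terms into T and -T, with \<open>T\<close> the energy times \<open>kern\<close> on
  \<open>trunc\<close>. The substitution t -> s - t maps the first term to the third. With the signs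
  of \<open>cross\<close> the total is -3 times the integral of \<open>T\<close>, and 48 = 3 * 16 by
  the one-sided bound for \<open>kern\<close>.\<close>

lemma integral_cut_cross:
  assumes \<eta>: "0 < \<eta>" "\<eta> \<le> 1"
  shows "integrable (lborel \<Otimes>\<^sub>M lborel) (\<lambda>z. cut \<eta> (fst z) (snd z) * cross (fst z) (snd z))"
    and "(\<integral>z. cut \<eta> (fst z) (snd z) * cross (fst z) (snd z) \<partial>(lborel \<Otimes>\<^sub>M lborel)) \<le> 48 * K"
proof -
  let ?I = "\<lambda>w. indicator (trunc \<eta>) w :: real" and ?M = "lborel \<Otimes>\<^sub>M lborel :: (real \<times> real) measure"
  define T where "T w = ?I w * energy g w * kern \<eta> w" for w
  define F1 F2 F3 where "F1 = (\<lambda>z::real \<times> real. cut \<eta> (fst z) (snd z) * (energy g (fst z - snd z) / (fst z * snd z)))"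
    and "F2 = (\<lambda>z::real \<times> real. cut \<eta> (fst z) (snd z) * (energy g (fst z) / (snd z * (fst z - snd z))))"
    and "F3 = (\<lambda>z::real \<times> real. cut \<eta> (fst z) (snd z) * (energy g (snd z) / (fst z * (fst z - snd z))))"
  have KB: "0 \<le> K / \<eta>\<^sup>2" using K_nonneg by simp
  have i1: "integrable ?M F1" and i2: "integrable ?M F2" and i3: "integrable ?M F3"
    unfolding F1_def F2_def F3_def
    by (rule integrable_cut[OF _ KB], measurable, simp add: energy_quotient_bound[OF \<eta>(1)] del: abs_divide)+
  have F: "cut \<eta> (fst z) (snd z) * cross (fst z) (snd z) = F1 z - F2 z + F3 z" for z
    by (simp add: F1_def F2_def F3_def cross_def algebra_simps)
  show int: "integrable ?M (\<lambda>z. cut \<eta> (fst z) (snd z) * cross (fst z) (snd z))"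
    unfolding F using i1 i2 i3 by simp
  have in2: "(\<integral>t. F2 (s, t) \<partial>lborel) = T s" for s
  proof -
    have "(\<integral>t. F2 (s, t) \<partial>lborel) = (\<integral>t. (?I s * energy g s) * (?I t * ?I (s - t) / (t * (s - t))) \<partial>lborel)"
      by (intro Bochner_Integration.integral_cong) (simp_all add: F2_def cut_def)
    then show ?thesis by (simp only: integral_mult_right_zero T_def kern_def)
  qed
  have in3: "(\<integral>s. F3 (s, t) \<partial>lborel) = - T t" for t
  proof -
    have "F3 (s, t) = (- (?I t * energy g t)) * (?I s * ?I (t - s) / (s * (t - s)))" for s
    proof -
      have e1: "?I (s - t) = ?I (t - s)" by (simp add: trunc_def indicator_def abs_minus_commute)
      have e2: "energy g t / (s * (s - t)) = - (energy g t / (s * (t - s)))"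
        by (metis minus_diff_eq minus_divide_right mult_minus_right)
      show ?thesis unfolding F3_def cut_def fst_conv snd_conv e1 e2 by simp
    qed
    then have "(\<integral>s. F3 (s, t) \<partial>lborel) = (\<integral>s. (- (?I t * energy g t)) * (?I s * ?I (t - s) / (s * (t - s))) \<partial>lborel)"
      by simp
    then show ?thesis by (simp only: integral_mult_right_zero T_def kern_def) simp
  qed
  have in1: "(\<integral>t. F1 (s, t) \<partial>lborel) = (\<integral>w. F3 (s, w) \<partial>lborel)" for s
  proof -
    have "(\<integral>t. F1 (s, t) \<partial>lborel) = (\<integral>w. F1 (s, s + (-1) * w) \<partial>lborel)"
      by (subst lborel_integral_real_affine[of "-1" _ s]) simp_all
    also have "\<dots> = (\<integral>w. F3 (s, w) \<partial>lborel)"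
      by (intro Bochner_Integration.integral_cong) (simp_all add: F1_def F3_def cut_def mult_ac)
    finally show ?thesis .
  qed
  have S2: "integral\<^sup>L ?M F2 = integral\<^sup>L lborel T" and Ti: "integrable lborel T"
    using lborel_pair.integral_fst'[OF i2] lborel_pair.integrable_fst'[OF i2] by (simp_all add: in2)
  have S3': "(\<integral>t. (\<integral>s. F3 (s, t) \<partial>lborel) \<partial>lborel) = (\<integral>s. (\<integral>t. F3 (s, t) \<partial>lborel) \<partial>lborel)"
    using i3 by (intro lborel_pair.Fubini_integral) simp
  have S3: "integral\<^sup>L ?M F3 = - integral\<^sup>L lborel T"
    using lborel_pair.integral_fst'[OF i3] S3' by (simp add: in3)
  have S1: "integral\<^sup>L ?M F1 = - integral\<^sup>L lborel T"
    using lborel_pair.integral_fst'[OF i1] lborel_pair.integral_fst'[OF i3] S3 by (simp add: in1)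
  have "- integral\<^sup>L lborel T = (\<integral>w. - T w \<partial>lborel)" by simp
  also have "\<dots> \<le> (\<integral>w. K * (?I w * (8 * \<eta> / w\<^sup>2)) \<partial>lborel)"
  proof (rule integral_mono)
    show "integrable lborel (\<lambda>w. - T w)" using Ti by simp
    show "integrable lborel (\<lambda>w. K * (?I w * (8 * \<eta> / w\<^sup>2)))"
      by (intro integrable_mult_right integral_inverse_square_trunc \<eta>)
    fix w
    show "- T w \<le> K * (?I w * (8 * \<eta> / w\<^sup>2))"
    proof (cases "w \<in> trunc \<eta>")
      case True
      have "- T w = energy g w * (- kern \<eta> w)" using True by (simp add: T_def)
      also have "\<dots> \<le> energy g w * (8 * \<eta> / w\<^sup>2)"
        by (intro mult_left_mono kern_lower_bound \<eta>(1) True energy_nonneg)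
      also have "\<dots> \<le> K * (8 * \<eta> / w\<^sup>2)"
        using True \<eta> by (intro mult_right_mono energy_le) (auto simp: trunc_def)
      finally show ?thesis using True by simp
    qed (simp add: T_def)
  qed
  also have "\<dots> = K * (\<integral>w. ?I w * (8 * \<eta> / w\<^sup>2) \<partial>lborel)"
    by (rule integral_mult_right_zero)
  also have "\<dots> \<le> K * 16" by (intro mult_left_mono integral_inverse_square_trunc \<eta> K_nonneg)
  finally have "- integral\<^sup>L lborel T \<le> K * 16" .
  then show "(\<integral>z. cut \<eta> (fst z) (snd z) * cross (fst z) (snd z) \<partial>?M) \<le> 48 * K"
    unfolding F using i1 i2 i3 S1 S2 S3 by simp
qed

definition dd :: "real \<Rightarrow> real \<times> real \<Rightarrow> ennreal" where
  "dd x z = ennreal ((diff_quot g x (fst z) - diff_quot g x (snd z))\<^sup>2 / (fst z - snd z)\<^sup>2)"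

lemma measurable_dd [measurable (raw)]:
  assumes [measurable]: "p \<in> borel_measurable M" "q \<in> M \<rightarrow>\<^sub>M borel \<Otimes>\<^sub>M borel"
  shows "(\<lambda>x. dd (p x) (q x)) \<in> borel_measurable M"
  unfolding dd_def by measurable

text \<open>After Tonelli the integrand in (s, t) is nonnegative, being an integral of squares; this
  converts the signed bound into one for a nonnegative integral, independent of \<eta>.\<close>

lemma nn_integral_cut_dd:
  assumes \<eta>: "0 < \<eta>" "\<eta> \<le> 1"
  shows "(\<integral>\<^sup>+x. \<integral>\<^sup>+z. ennreal (cut \<eta> (fst z) (snd z)) * dd x z \<partial>(lborel \<Otimes>\<^sub>M lborel) \<partial>lborel) \<le> ennreal (48 * K)"
proof -
  let ?M = "lborel \<Otimes>\<^sub>M lborel :: (real \<times> real) measure"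
  interpret pair_sigma_finite "lborel :: real measure" ?M
    unfolding lborel_prod by (intro pair_sigma_finite.intro sigma_finite_lborel)
  have "(\<integral>\<^sup>+x. \<integral>\<^sup>+z. ennreal (cut \<eta> (fst z) (snd z)) * dd x z \<partial>?M \<partial>lborel)
      = (\<integral>\<^sup>+z. \<integral>\<^sup>+x. ennreal (cut \<eta> (fst z) (snd z)) * dd x z \<partial>lborel \<partial>?M)"
    by (rule Fubini'[symmetric]) measurable
  also have "\<dots> = (\<integral>\<^sup>+z. ennreal (cut \<eta> (fst z) (snd z) * cross (fst z) (snd z)) \<partial>?M)"
  proof (rule nn_integral_cong)
    fix z :: "real \<times> real"
    obtain s t where z: "z = (s, t)" by (cases z)
    show "(\<integral>\<^sup>+x. ennreal (cut \<eta> (fst z) (snd z)) * dd x z \<partial>lborel) = ennreal (cut \<eta> (fst z) (snd z) * cross (fst z) (snd z))"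
    proof (cases "cut \<eta> s t = 0")
      case False
      then have st: "s \<in> trunc \<eta>" "t \<in> trunc \<eta>" "s - t \<in> trunc \<eta>"
        by (auto simp: cut_def indicator_def split: if_splits)
      then have "s \<noteq> 0" "t \<noteq> 0" "s \<noteq> t" "\<bar>s\<bar> \<le> 1" "\<bar>t\<bar> \<le> 1" "\<bar>s - t\<bar> \<le> 1"
        using \<eta> by (auto simp: trunc_def)
      note * = nn_integral_divided_difference[OF this]
      have "(\<integral>\<^sup>+x. ennreal (cut \<eta> s t) * dd x (s, t) \<partial>lborel) = ennreal (cut \<eta> s t) * (\<integral>\<^sup>+x. dd x (s, t) \<partial>lborel)"
        by (rule nn_integral_cmult) measurable
      also have "\<dots> = ennreal (cut \<eta> s t) * ennreal (cross s t)"
        using *(1) by (simp add: dd_def cross_def)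
      also have "\<dots> = ennreal (cut \<eta> s t * cross s t)"
        using *(2) by (simp add: ennreal_mult cross_def)
      finally show ?thesis by (simp add: z)
    qed (simp add: z)
  qed
  also have "\<dots> = ennreal (\<integral>z. cut \<eta> (fst z) (snd z) * cross (fst z) (snd z) \<partial>?M)"
  proof (rule nn_integral_eq_integral[OF integral_cut_cross(1)[OF \<eta>]], rule AE_I2)
    fix z :: "real \<times> real"
    obtain s t where z: "z = (s, t)" by (cases z)
    show "0 \<le> cut \<eta> (fst z) (snd z) * cross (fst z) (snd z)"
    proof (cases "cut \<eta> s t = 0")
      case False
      then have st: "s \<in> trunc \<eta>" "t \<in> trunc \<eta>" "s - t \<in> trunc \<eta>"
        by (auto simp: cut_def indicator_def split: if_splits)
      then have "s \<noteq> 0" "t \<noteq> 0" "s \<noteq> t" "\<bar>s\<bar> \<le> 1" "\<bar>t\<bar> \<le> 1" "\<bar>s - t\<bar> \<le> 1"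
        using \<eta> by (auto simp: trunc_def)
      note * = nn_integral_divided_difference(2)[OF this]
      then show ?thesis by (simp add: z cross_def)
    qed (simp add: z)
  qed
  also have "\<dots> \<le> ennreal (48 * K)" by (intro ennreal_leI integral_cut_cross \<eta>)
  finally show ?thesis .
qed

text \<open>The bound 48K holds for all truncations at 1/(i + 1), which increase to the full domain
  up to a null set, so monotone convergence bounds the integral of the supremum.\<close>

theorem AE_square_integral_finite: "AE x in lborel. square_integral g x 1 < \<infinity>"
proof -
  let ?M = "lborel \<Otimes>\<^sub>M lborel :: (real \<times> real) measure"
  interpret S: sigma_finite_measure ?M
    unfolding lborel_prod by (rule sigma_finite_lborel)
  define h where "h i = inverse (real (Suc i))" for i
  have h: "0 < h i" "h i \<le> 1" for i by (auto simp: h_def inverse_le_1_iff)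
  have hdec: "h (Suc i) \<le> h i" for i by (simp add: h_def le_imp_inverse_le)
  define c where "c i z = ennreal (cut (h i) (fst z) (snd z))" for i and z :: "real \<times> real"
  have [measurable]: "c i \<in> borel_measurable ?M" for i unfolding c_def by measurable
  have trm: "indicator (trunc (h i)) s \<le> (indicator (trunc (h (Suc i))) s :: real)" for i s
    using hdec[of i] by (auto simp: trunc_def indicator_def)
  have cinc: "c i z \<le> c (Suc i) z" for i z
    unfolding c_def cut_def by (intro ennreal_leI mult_mono trm) auto
  define \<Phi> where "\<Phi> i x = (\<integral>\<^sup>+z. c i z * dd x z \<partial>?M)" for i x
  have [measurable]: "\<Phi> i \<in> borel_measurable lborel" for i
    unfolding \<Phi>_def by measurable
  have \<Phi>inc: "incseq \<Phi>"
    unfolding \<Phi>_def by (intro incseq_SucI le_funI nn_integral_mono mult_right_mono cinc) auto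
  have "(\<integral>\<^sup>+x. (SUP i. \<Phi> i x) \<partial>lborel) = (SUP i. \<integral>\<^sup>+x. \<Phi> i x \<partial>lborel)"
    by (rule nn_integral_monotone_convergence_SUP[OF \<Phi>inc]) measurable
  also have "\<dots> \<le> ennreal (48 * K)"
    unfolding \<Phi>_def c_def by (intro SUP_least nn_integral_cut_dd h)
  also have "\<dots> < \<infinity>" by simp
  finally have "AE x in lborel. (SUP i. \<Phi> i x) \<noteq> \<infinity>"
    by (intro nn_integral_PInf_AE) auto
  then show ?thesis
  proof eventually_elim
    case (elim x)
    have "(SUP i. \<Phi> i x) = (\<integral>\<^sup>+z. (SUP i. c i z * dd x z) \<partial>?M)"
      unfolding \<Phi>_def
      by (rule nn_integral_monotone_convergence_SUP[symmetric])
         (auto intro!: incseq_SucI le_funI mult_right_mono cinc)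
    moreover have "square_integral g x 1 \<le> (\<integral>\<^sup>+z. (SUP i. c i z * dd x z) \<partial>?M)"
      unfolding square_integral_def nn_integral_completion lborel_prod[symmetric]
    proof (rule nn_integral_mono_AE)
      \<comment> \<open>No truncation reaches the axes, which are null. On the diagonal s = t the
        integrand is 0 because of division by zero, and elsewhere |s| + |t| < 1 keeps all three
        differences below 1.\<close>
      have "AE z in ?M. fst z \<noteq> 0 \<and> snd z \<noteq> 0"
      proof (rule lborel_pair.AE_pair_measure)
        show "AE s in lborel. AE t in lborel. fst (s, t) \<noteq> (0::real) \<and> snd (s, t) \<noteq> (0::real)"
          using AE_lborel_singleton[of "0::real"]
        proof eventually_elim
          case (elim s)
          from AE_lborel_singleton[of "0::real"] show ?case by eventually_elim (use elim in simp)
        qed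
      qed measurable
      then show "AE z in ?M. (case z of (s, t) \<Rightarrow> ennreal (\<bar>diff_quot g x s - diff_quot g x t\<bar>\<^sup>2 / \<bar>s - t\<bar>\<^sup>2)) *
           indicator {(s, t). \<bar>s\<bar> + \<bar>t\<bar> < 1} z \<le> (SUP i. c i z * dd x z)"
      proof (rule AE_mp, intro AE_I2 impI)
        fix z :: "real \<times> real" assume z0: "fst z \<noteq> 0 \<and> snd z \<noteq> 0"
        obtain s t where z: "z = (s, t)" by (cases z)
        show "(case z of (s, t) \<Rightarrow> ennreal (\<bar>diff_quot g x s - diff_quot g x t\<bar>\<^sup>2 / \<bar>s - t\<bar>\<^sup>2)) *
           indicator {(s, t). \<bar>s\<bar> + \<bar>t\<bar> < 1} z \<le> (SUP i. c i z * dd x z)"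
        proof (cases "\<bar>s\<bar> + \<bar>t\<bar> < 1 \<and> s \<noteq> t")
          case True
          define m where "m = min \<bar>s\<bar> (min \<bar>t\<bar> \<bar>s - t\<bar>)"
          have "0 < m" using True z0 by (auto simp: m_def z)
          then obtain i where "h i < m" using reals_Archimedean unfolding h_def by blast
          then have "c i z = 1"
            using True by (auto simp: c_def cut_def m_def z trunc_def indicator_def)
          then have "c i z * dd x z = dd x z" by simp
          then have "dd x z \<le> (SUP i. c i z * dd x z)" by (metis SUP_upper UNIV_I)
          then show ?thesis using True by (simp add: z dd_def)
        qed (auto simp: z indicator_def)
      qed
    qed
    ultimately show ?case using elim by (simp add: less_top[symmetric] top_unique) (metis neq_top_trans top.not_eq_extremum)
  qed
qed

end

section \<open>Marcinkiewicz integrals\<close>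

lemma nn_integral_even_le:
  fixes H :: "real \<Rightarrow> ennreal"
  assumes [measurable]: "H \<in> borel_measurable borel"
  shows "(\<integral>\<^sup>+z. H \<bar>z\<bar> \<partial>lborel) \<le> 2 * (\<integral>\<^sup>+z. indicator {0..} z * H z \<partial>lborel)"
proof -
  have "(\<integral>\<^sup>+z. H \<bar>z\<bar> \<partial>lborel) \<le> (\<integral>\<^sup>+z. indicator {0..} z * H z + indicator {0..} (0 + (-1) * z) * H (0 + (-1) * z) \<partial>lborel)"
    by (intro nn_integral_mono) (auto simp: indicator_def)
  also have "\<dots> = (\<integral>\<^sup>+z. indicator {0..} z * H z \<partial>lborel) + (\<integral>\<^sup>+z. indicator {0..} (0 + (-1) * z) * H (0 + (-1) * z) \<partial>lborel)"
    by (rule nn_integral_add) measurable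
  also have "(\<integral>\<^sup>+z. indicator {0..} (0 + (-1) * z) * H (0 + (-1) * z) \<partial>lborel) = (\<integral>\<^sup>+z. indicator {0..} z * H z \<partial>lborel)"
    using nn_integral_real_affine[of "\<lambda>z. indicator {0..} z * H z" "-1" 0] by simp
  finally show ?thesis by (simp add: mult_2)
qed

lemma nn_integral_powr_near_0:
  assumes "- 1 < p" "0 \<le> c"
  shows "(\<integral>\<^sup>+z. indicator {0..c} \<bar>z\<bar> * ennreal (\<bar>z\<bar> powr p) \<partial>lborel) \<le> ennreal (2 * (c powr (p + 1) / (p + 1)))"
proof -
  have "(\<integral>\<^sup>+z. indicator {0..c} \<bar>z\<bar> * ennreal (\<bar>z\<bar> powr p) \<partial>lborel) \<le>
      2 * (\<integral>\<^sup>+z. indicator {0..} z * (indicator {0..c} z * ennreal (z powr p)) \<partial>lborel)"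
    by (rule nn_integral_even_le) measurable
  also have "(\<integral>\<^sup>+z. indicator {0..} z * (indicator {0..c} z * ennreal (z powr p)) \<partial>lborel) = (\<integral>\<^sup>+z. ennreal (indicator {0..c} z * z powr p) \<partial>lborel)"
    by (intro nn_integral_cong) (auto simp: indicator_def)
  also have "\<dots> = ennreal (c powr (p + 1) / (p + 1))"
    by (rule nn_integral_has_integral_lebesgue[OF _ has_integral_powr_from_0[OF assms]]) auto
  also have "2 * ennreal (c powr (p + 1) / (p + 1)) = ennreal (2 * (c powr (p + 1) / (p + 1)))"
    using assms by (subst ennreal_mult) auto
  finally show ?thesis .
qed

lemma nn_integral_powr_near_infinity:
  assumes "p < - 1" "0 < c"
  shows "(\<integral>\<^sup>+z. indicator {c..} \<bar>z\<bar> * ennreal (\<bar>z\<bar> powr p) \<partial>lborel) \<le> ennreal (2 * (- (c powr (p + 1)) / (p + 1)))"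
proof -
  have "(\<integral>\<^sup>+z. indicator {c..} \<bar>z\<bar> * ennreal (\<bar>z\<bar> powr p) \<partial>lborel) \<le>
      2 * (\<integral>\<^sup>+z. indicator {0..} z * (indicator {c..} z * ennreal (z powr p)) \<partial>lborel)"
    by (rule nn_integral_even_le) measurable
  also have "(\<integral>\<^sup>+z. indicator {0..} z * (indicator {c..} z * ennreal (z powr p)) \<partial>lborel) = (\<integral>\<^sup>+z. ennreal (indicator {c..} z * z powr p) \<partial>lborel)"
    using assms by (intro nn_integral_cong) (auto simp: indicator_def)
  also have "\<dots> = ennreal (- (c powr (p + 1)) / (p + 1))"
    by (rule nn_integral_has_integral_lebesgue[OF _ has_integral_powr_to_inf[OF assms]]) auto
  also have "2 * ennreal (- (c powr (p + 1)) / (p + 1)) = ennreal (2 * (- (c powr (p + 1)) / (p + 1)))"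
    using assms by (subst ennreal_mult) (auto intro: divide_nonneg_neg)
  finally show ?thesis .
qed

text \<open>A Marcinkiewicz integral of exponent 1/2, the general integrand being d^a / |t|^(1 + a).
  Later \<open>d\<close> is the distance to a set and \<open>x\<close> a point of that set.\<close>

definition marcinkiewicz :: "(real \<Rightarrow> real) \<Rightarrow> real \<Rightarrow> ennreal" where
  "marcinkiewicz d x = (\<integral>\<^sup>+t. indicator {-1<..<1} t * ennreal (d (x + t) powr (1/2) * \<bar>t\<bar> powr (-3/2)) \<partial>lborel)"

text \<open>Tonelli with y = x + t. If d x = 0 then d y \<le> |y - x|, so for fixed y only z with
  |z| \<ge> d y occur, over which |z| powr (-3/2) integrates to 4 * d y powr (-1/2): the powers
  cancel and 4 is left for every y.\<close>

lemma AE_marcinkiewicz_finite: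
  assumes d: "continuous_on UNIV d" and d0: "\<And>y. 0 \<le> d y"
    and lip: "\<And>x y. d y \<le> d x + \<bar>y - x\<bar>"
  shows "AE x in lborel. x \<in> {a<..<b} \<and> d x = 0 \<longrightarrow> marcinkiewicz d x < \<infinity>"
proof -
  have [measurable]: "d \<in> borel_measurable borel" using d by (rule borel_measurable_continuous_onI)
  let ?h = "\<lambda>y t. ennreal (d y powr (1/2) * \<bar>t\<bar> powr (-3/2))"
  let ?ind = "\<lambda>x. if x \<in> {a<..<b} \<and> d x = 0 then 1 else 0 :: ennreal"
  have "(\<integral>\<^sup>+x. ?ind x * marcinkiewicz d x \<partial>lborel)
      \<le> (\<integral>\<^sup>+x. \<integral>\<^sup>+y. indicator {a - 1..b + 1} y * (?ind x * ?h y (y - x)) \<partial>lborel \<partial>lborel)"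
  proof (rule nn_integral_mono)
    fix x
    have "?ind x * marcinkiewicz d x = (\<integral>\<^sup>+t. ?ind x * (indicator {-1<..<1} t * ?h (x + t) t) \<partial>lborel)"
      unfolding marcinkiewicz_def by (rule nn_integral_cmult[symmetric]) measurable
    also have "\<dots> \<le> (\<integral>\<^sup>+t. indicator {a - 1..b + 1} (x + 1 * t) * (?ind x * ?h (x + 1 * t) ((x + 1 * t) - x)) \<partial>lborel)"
      by (intro nn_integral_mono) (auto simp: indicator_def)
    also have "\<dots> = (\<integral>\<^sup>+y. indicator {a - 1..b + 1} y * (?ind x * ?h y (y - x)) \<partial>lborel)"
      using nn_integral_real_affine[of "\<lambda>y. indicator {a - 1..b + 1} y * (?ind x * ?h y (y - x))" 1 x] by simp
    finally show "?ind x * marcinkiewicz d x \<le> (\<integral>\<^sup>+y. indicator {a - 1..b + 1} y * (?ind x * ?h y (y - x)) \<partial>lborel)" .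
  qed
  also have "\<dots> = (\<integral>\<^sup>+y. \<integral>\<^sup>+x. indicator {a - 1..b + 1} y * (?ind x * ?h y (y - x)) \<partial>lborel \<partial>lborel)"
    by (rule lborel_pair.Fubini'[symmetric]) measurable
  also have "\<dots> \<le> (\<integral>\<^sup>+y. 4 * indicator {a - 1..b + 1} y \<partial>lborel)"
  proof (rule nn_integral_mono)
    fix y
    have "(\<integral>\<^sup>+x. indicator {a - 1..b + 1} y * (?ind x * ?h y (y - x)) \<partial>lborel) =
        indicator {a - 1..b + 1} y * (\<integral>\<^sup>+x. ?ind x * ?h y (y - x) \<partial>lborel)"
      by (rule nn_integral_cmult) measurable
    also have "(\<integral>\<^sup>+x. ?ind x * ?h y (y - x) \<partial>lborel) \<le> 4"
    proof (cases "d y = 0")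
      case False
      then have dy: "0 < d y" using d0[of y] by simp
      have "(\<integral>\<^sup>+x. ?ind x * ?h y (y - x) \<partial>lborel) \<le>
          (\<integral>\<^sup>+x. ennreal (d y powr (1/2)) * (indicator {d y..} \<bar>y + (-1) * x\<bar> * ennreal (\<bar>y + (-1) * x\<bar> powr (-3/2))) \<partial>lborel)"
      proof (rule nn_integral_mono)
        fix x
        show "?ind x * ?h y (y - x) \<le> ennreal (d y powr (1/2)) * (indicator {d y..} \<bar>y + (-1) * x\<bar> * ennreal (\<bar>y + (-1) * x\<bar> powr (-3/2)))"
          using lip[of y x] by (auto simp: indicator_def ennreal_mult)
      qed
      also have "\<dots> = ennreal (d y powr (1/2)) * (\<integral>\<^sup>+x. indicator {d y..} \<bar>y + (-1) * x\<bar> * ennreal (\<bar>y + (-1) * x\<bar> powr (-3/2)) \<partial>lborel)"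
        by (rule nn_integral_cmult) measurable
      also have "(\<integral>\<^sup>+x. indicator {d y..} \<bar>y + (-1) * x\<bar> * ennreal (\<bar>y + (-1) * x\<bar> powr (-3/2)) \<partial>lborel) =
          (\<integral>\<^sup>+z. indicator {d y..} \<bar>z\<bar> * ennreal (\<bar>z\<bar> powr (-3/2)) \<partial>lborel)"
        using nn_integral_real_affine[of "\<lambda>z. indicator {d y..} \<bar>z\<bar> * ennreal (\<bar>z\<bar> powr (-3/2))" "-1" y] by simp
      also have "ennreal (d y powr (1/2)) * \<dots> \<le> ennreal (d y powr (1/2)) * ennreal (2 * (- (d y powr (-3/2 + 1)) / (-3/2 + 1)))"
        by (intro mult_left_mono nn_integral_powr_near_infinity dy) auto
      also have "\<dots> = ennreal (d y powr (1/2) * (4 * d y powr (-1/2)))"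
        by (subst ennreal_mult[symmetric]) auto
      also have "d y powr (1/2) * (4 * d y powr (-1/2)) = 4"
        using dy by (simp add: powr_add[symmetric])
      finally show ?thesis by simp
    qed simp
    finally show "(\<integral>\<^sup>+x. indicator {a - 1..b + 1} y * (?ind x * ?h y (y - x)) \<partial>lborel) \<le> 4 * indicator {a - 1..b + 1} y"
      by (auto simp: indicator_def mult.commute split: if_splits)
  qed
  also have "\<dots> = 4 * emeasure lborel {a - 1..b + 1}" by (rule nn_integral_cmult_indicator) simp
  also have "\<dots> < \<infinity>" by (simp add: ennreal_mult_less_top emeasure_lborel_Icc_eq)
  finally have "(\<integral>\<^sup>+x. ?ind x * marcinkiewicz d x \<partial>lborel) \<noteq> \<infinity>" by simp
  then have "AE x in lborel. ?ind x * marcinkiewicz d x \<noteq> \<infinity>"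
    by (rule nn_integral_PInf_AE[rotated]) (simp add: marcinkiewicz_def)
  then show ?thesis
    by eventually_elim (auto simp: less_top)
qed

text \<open>Substituting \<open>\<theta> = q\<^sup>4\<close> turns \<open>ln (1/\<theta>) = 4 ln (1/q) \<le> 4 (1/q - 1)\<close> into the estimate.\<close>

lemma log_modulus_le:
  fixes \<theta> :: real
  assumes "0 < \<theta>" "\<theta> \<le> 1"
  shows "(\<theta> * (1 + \<bar>ln (1 / \<theta>)\<bar>))\<^sup>2 \<le> 16 * \<theta> powr (3/2)"
proof -
  define q where "q = \<theta> powr (1/4)"
  have q: "0 < q" using assms by (simp add: q_def)
  have pw: "q ^ k = \<theta> powr (real k / 4)" for k
    using assms by (simp add: q_def powr_realpow[symmetric] powr_powr)
  have th: "\<theta> = q ^ 4" using assms pw[of 4] by simp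
  have q1: "q \<le> 1" using assms by (simp add: q_def powr_le1)
  have "0 \<le> ln (1 / \<theta>)" using assms by simp
  moreover have "ln (1 / \<theta>) = 4 * ln (1 / q)"
    using q by (simp add: th ln_div ln_realpow)
  moreover have "ln (1 / q) \<le> 1 / q - 1" using q by (intro ln_le_minus_one) auto
  ultimately have "1 + \<bar>ln (1 / \<theta>)\<bar> \<le> 4 / q" using q1 q by simp
  then have "\<theta> * (1 + \<bar>ln (1 / \<theta>)\<bar>) \<le> \<theta> * (4 / q)" using assms by (intro mult_left_mono) auto
  also have "\<dots> = 4 * q ^ 3" using q by (simp add: th power_def eval_nat_numeral)
  finally have "(\<theta> * (1 + \<bar>ln (1 / \<theta>)\<bar>))\<^sup>2 \<le> (4 * q ^ 3)\<^sup>2"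
    using assms by (intro power_mono) auto
  also have "\<dots> = 16 * q ^ 6" by (simp add: power_mult_distrib power_mult[symmetric])
  also have "\<dots> = 16 * \<theta> powr (3/2)" using pw[of 6] by simp
  finally show ?thesis .
qed

text \<open>\<open>\<rho>\<close> will be the distance from x + t to the good set. Close to the
  diagonal the regularity hypothesis supplies the first kernel, elsewhere the size of the error
  supplies the second; 12 n^2 is 3 * (2n)^2, with 3 from the square of a sum of three. The
  thresholds 2 and 3 overlap because exchanging s and t changes \<open>\<rho>\<close> by at most |s
  - t|.\<close>

definition bad_kernel :: "real \<Rightarrow> real \<Rightarrow> real \<Rightarrow> real \<Rightarrow> real \<Rightarrow> ennreal" where
  "bad_kernel c n \<rho> s t =
     (if 2 * \<bar>s - t\<bar> < \<rho> then ennreal (c * \<bar>s - t\<bar> powr (-1/2) * \<bar>t\<bar> powr (-3/2)) else 0) +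
     (if \<rho> \<le> 3 * \<bar>s - t\<bar> then ennreal (12 * n\<^sup>2 * \<rho>\<^sup>2 / (t\<^sup>2 * (s - t)\<^sup>2)) else 0)"

lemma measurable_bad_kernel [measurable (raw)]:
  assumes [measurable]: "r \<in> borel_measurable M" "p \<in> borel_measurable M" "q \<in> borel_measurable M"
  shows "(\<lambda>x. bad_kernel c n (r x) (p x) (q x)) \<in> borel_measurable M"
  unfolding bad_kernel_def by measurable

text \<open>Near the diagonal |s - t| powr (-1/2) integrates to at most 4 * \<rho> powr (1/2); away
  from it 1/(s - t)^2 integrates to at most 6/\<rho>, leaving 72 n^2 \<rho>/t^2, and \<rho> \<le>
  |t| trades half a power of \<rho> for one of |t|. Both parts take the form of the Marcinkiewicz
  integrand.\<close>

lemma nn_integral_bad_kernel_le: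
  assumes \<rho>: "0 \<le> \<rho>" "\<rho> \<le> \<bar>t\<bar>" and c: "0 \<le> c"
  shows "(\<integral>\<^sup>+s. bad_kernel c n \<rho> s t \<partial>lborel) \<le> ennreal (4 * c + 72 * n\<^sup>2) * ennreal (\<rho> powr (1/2) * \<bar>t\<bar> powr (-3/2))"
proof -
  let ?D = "\<rho> powr (1/2) * \<bar>t\<bar> powr (-3/2)"
  have "(\<integral>\<^sup>+s. bad_kernel c n \<rho> s t \<partial>lborel) =
      (\<integral>\<^sup>+s. (if 2 * \<bar>s - t\<bar> < \<rho> then ennreal (c * \<bar>s - t\<bar> powr (-1/2) * \<bar>t\<bar> powr (-3/2)) else 0) \<partial>lborel) +
      (\<integral>\<^sup>+s. (if \<rho> \<le> 3 * \<bar>s - t\<bar> then ennreal (12 * n\<^sup>2 * \<rho>\<^sup>2 / (t\<^sup>2 * (s - t)\<^sup>2)) else 0) \<partial>lborel)"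
    unfolding bad_kernel_def by (rule nn_integral_add) measurable
  also have "\<dots> \<le> ennreal (4 * c * ?D) + ennreal (72 * n\<^sup>2 * ?D)"
  proof (rule add_mono)
    have "(\<integral>\<^sup>+s. (if 2 * \<bar>s - t\<bar> < \<rho> then ennreal (c * \<bar>s - t\<bar> powr (-1/2) * \<bar>t\<bar> powr (-3/2)) else 0) \<partial>lborel)
        \<le> (\<integral>\<^sup>+s. ennreal (c * \<bar>t\<bar> powr (-3/2)) * (indicator {0..\<rho>/2} \<bar>- t + 1 * s\<bar> * ennreal (\<bar>- t + 1 * s\<bar> powr (-1/2))) \<partial>lborel)"
      using c by (intro nn_integral_mono) (auto simp: indicator_def ennreal_mult[symmetric] mult_ac)
    also have "\<dots> = ennreal (c * \<bar>t\<bar> powr (-3/2)) * (\<integral>\<^sup>+s. indicator {0..\<rho>/2} \<bar>- t + 1 * s\<bar> * ennreal (\<bar>- t + 1 * s\<bar> powr (-1/2)) \<partial>lborel)"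
      by (rule nn_integral_cmult) measurable
    also have "(\<integral>\<^sup>+s. indicator {0..\<rho>/2} \<bar>- t + 1 * s\<bar> * ennreal (\<bar>- t + 1 * s\<bar> powr (-1/2)) \<partial>lborel) =
        (\<integral>\<^sup>+z. indicator {0..\<rho>/2} \<bar>z\<bar> * ennreal (\<bar>z\<bar> powr (-1/2)) \<partial>lborel)"
      using nn_integral_real_affine[of "\<lambda>z. indicator {0..\<rho>/2} \<bar>z\<bar> * ennreal (\<bar>z\<bar> powr (-1/2))" 1 "- t"] by simp
    also have "\<dots> \<le> ennreal (2 * ((\<rho>/2) powr (-1/2 + 1) / (-1/2 + 1)))"
      using \<rho> by (intro nn_integral_powr_near_0) auto
    also have "\<dots> \<le> ennreal (4 * \<rho> powr (1/2))"
      using \<rho> by (intro ennreal_leI) (auto intro!: powr_mono2)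
    also have "ennreal (c * \<bar>t\<bar> powr (-3/2)) * ennreal (4 * \<rho> powr (1/2)) = ennreal (4 * c * ?D)"
      using c by (simp add: ennreal_mult[symmetric] mult_ac)
    finally show "(\<integral>\<^sup>+s. (if 2 * \<bar>s - t\<bar> < \<rho> then ennreal (c * \<bar>s - t\<bar> powr (-1/2) * \<bar>t\<bar> powr (-3/2)) else 0) \<partial>lborel) \<le> ennreal (4 * c * ?D)"
      by (simp add: mult_left_mono)
  next
    show "(\<integral>\<^sup>+s. (if \<rho> \<le> 3 * \<bar>s - t\<bar> then ennreal (12 * n\<^sup>2 * \<rho>\<^sup>2 / (t\<^sup>2 * (s - t)\<^sup>2)) else 0) \<partial>lborel) \<le> ennreal (72 * n\<^sup>2 * ?D)"
    proof (cases "\<rho> = 0")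
      case False
      then have p: "0 < \<rho>" "0 < \<bar>t\<bar>" using \<rho> by auto
      let ?c = "12 * n\<^sup>2 * \<rho>\<^sup>2 / t\<^sup>2"
      have "(\<integral>\<^sup>+s. (if \<rho> \<le> 3 * \<bar>s - t\<bar> then ennreal (12 * n\<^sup>2 * \<rho>\<^sup>2 / (t\<^sup>2 * (s - t)\<^sup>2)) else 0) \<partial>lborel)
          \<le> (\<integral>\<^sup>+s. ennreal ?c * (indicator {\<rho>/3..} \<bar>- t + 1 * s\<bar> * ennreal (\<bar>- t + 1 * s\<bar> powr (-2))) \<partial>lborel)"
      proof (rule nn_integral_mono)
        fix s
        show "(if \<rho> \<le> 3 * \<bar>s - t\<bar> then ennreal (12 * n\<^sup>2 * \<rho>\<^sup>2 / (t\<^sup>2 * (s - t)\<^sup>2)) else 0) \<le>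
            ennreal ?c * (indicator {\<rho>/3..} \<bar>- t + 1 * s\<bar> * ennreal (\<bar>- t + 1 * s\<bar> powr (-2)))"
        proof (cases "\<rho> \<le> 3 * \<bar>s - t\<bar>")
          case True
          then have "0 < \<bar>s - t\<bar>" using p by auto
          then have "\<bar>s - t\<bar> powr (-2) = 1 / (s - t)\<^sup>2"
            using powr_realpow[of "\<bar>s - t\<bar>" 2] by (simp add: powr_minus_divide)
          then have "12 * n\<^sup>2 * \<rho>\<^sup>2 / (t\<^sup>2 * (s - t)\<^sup>2) = ?c * \<bar>- t + 1 * s\<bar> powr (-2)" by simp
          then have "ennreal (12 * n\<^sup>2 * \<rho>\<^sup>2 / (t\<^sup>2 * (s - t)\<^sup>2)) = ennreal ?c * ennreal (\<bar>- t + 1 * s\<bar> powr (-2))"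
            by (simp only:) (rule ennreal_mult, simp_all)
          moreover have "indicator {\<rho>/3..} \<bar>- t + 1 * s\<bar> = (1::ennreal)" using True by simp
          ultimately show ?thesis using True by (simp only: if_True mult_1 order_refl)
        qed simp
      qed
      also have "\<dots> = ennreal ?c * (\<integral>\<^sup>+s. indicator {\<rho>/3..} \<bar>- t + 1 * s\<bar> * ennreal (\<bar>- t + 1 * s\<bar> powr (-2)) \<partial>lborel)"
        by (rule nn_integral_cmult) measurable
      also have "(\<integral>\<^sup>+s. indicator {\<rho>/3..} \<bar>- t + 1 * s\<bar> * ennreal (\<bar>- t + 1 * s\<bar> powr (-2)) \<partial>lborel) =
          (\<integral>\<^sup>+z. indicator {\<rho>/3..} \<bar>z\<bar> * ennreal (\<bar>z\<bar> powr (-2)) \<partial>lborel)"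
        using nn_integral_real_affine[of "\<lambda>z. indicator {\<rho>/3..} \<bar>z\<bar> * ennreal (\<bar>z\<bar> powr (-2))" 1 "- t"] by simp
      also have "ennreal ?c * \<dots> \<le> ennreal ?c * ennreal (2 * (- ((\<rho>/3) powr (-2 + 1)) / (-2 + 1)))"
        using p by (intro mult_left_mono nn_integral_powr_near_infinity) auto
      also have "\<dots> = ennreal (72 * n\<^sup>2 * (\<rho> / t\<^sup>2))"
      proof -
        have "2 * (- ((\<rho>/3) powr (-2 + 1)) / (-2 + 1)) = 6 / \<rho>"
          using p by (simp add: powr_minus_divide)
        then show ?thesis using p by (simp add: ennreal_mult[symmetric] power2_eq_square)
      qed
      also have "\<dots> \<le> ennreal (72 * n\<^sup>2 * ?D)"
      proof (intro ennreal_leI mult_left_mono)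
        have "\<rho> = \<rho> powr (1/2) * \<rho> powr (1/2)" using p by (simp add: powr_add[symmetric])
        also have "\<dots> \<le> \<rho> powr (1/2) * \<bar>t\<bar> powr (1/2)" using \<rho> by (intro mult_left_mono powr_mono2) auto
        finally have "\<rho> / t\<^sup>2 \<le> \<rho> powr (1/2) * \<bar>t\<bar> powr (1/2) / t\<^sup>2" by (rule divide_right_mono) simp
        also have "\<dots> = \<rho> powr (1/2) * (\<bar>t\<bar> powr (1/2) * \<bar>t\<bar> powr (-2))"
          using p powr_realpow[of "\<bar>t\<bar>" 2] by (simp add: powr_minus_divide)
        also have "\<bar>t\<bar> powr (1/2) * \<bar>t\<bar> powr (-2) = \<bar>t\<bar> powr (-3/2)"
          by (simp add: powr_add[symmetric])
        finally show "\<rho> / t\<^sup>2 \<le> ?D" .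
      qed simp
      finally show ?thesis .
    qed simp
  qed
  also have "\<dots> = ennreal ((4 * c + 72 * n\<^sup>2) * ?D)"
    using c by (subst ennreal_plus[symmetric]) (auto simp: distrib_right)
  also have "\<dots> = ennreal (4 * c + 72 * n\<^sup>2) * ennreal ?D" using c by (subst ennreal_mult) auto
  finally show ?thesis .
qed

text \<open>The hypothesis is used with \<open>m\<close> the quotient of the longer by the shorter
  increment, which has absolute value in (1, 2]; equal lengths would force s = -t, far from the
  diagonal. For \<theta> = |m - 1| \<le> 2|s - t|/|t| the squared modulus is at most 16 \<theta>
  powr (3/2), and 48 = 16 * 3 with 2 powr (3/2) \<le> 3.\<close>

lemma near_diagonal_bound:
  fixes \<phi> :: "real \<Rightarrow> real"
  assumes reg: "\<And>t m. 0 < \<bar>t\<bar> \<Longrightarrow> \<bar>t\<bar> < \<delta> \<Longrightarrow> 1 < \<bar>m\<bar> \<Longrightarrow> \<bar>m\<bar> \<le> 2 \<Longrightarrow>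
      \<bar>\<phi> (m * t) - \<phi> t\<bar> \<le> A * (\<bar>m - 1\<bar> * (1 + \<bar>ln (1 / \<bar>m - 1\<bar>)\<bar>))"
    and st: "2 * \<bar>s - t\<bar> < \<bar>t\<bar>" "\<bar>s\<bar> < \<delta>" "\<bar>t\<bar> < \<delta>"
  shows "(\<phi> s - \<phi> t)\<^sup>2 / (s - t)\<^sup>2 \<le> 48 * A\<^sup>2 * \<bar>s - t\<bar> powr (-1/2) * \<bar>t\<bar> powr (-3/2)"
proof (cases "s = t")
  case False
  define D where "D = \<bar>s - t\<bar>"
  have D: "0 < D" "2 * D < \<bar>t\<bar>" using False st by (auto simp: D_def)
  have t0: "0 < \<bar>t\<bar>" using D by simp
  have s0: "\<bar>t\<bar> / 2 < \<bar>s\<bar>" using D unfolding D_def by (auto simp: abs_if split: if_splits)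
  obtain \<theta> where \<theta>: "0 < \<theta>" "\<theta> \<le> 1" "\<theta> \<le> 2 * D / \<bar>t\<bar>"
    and le: "\<bar>\<phi> s - \<phi> t\<bar> \<le> A * (\<theta> * (1 + \<bar>ln (1 / \<theta>)\<bar>))"
  proof -
    consider "\<bar>t\<bar> < \<bar>s\<bar>" | "\<bar>s\<bar> < \<bar>t\<bar>" | "\<bar>s\<bar> = \<bar>t\<bar>" by linarith
    then show ?thesis
    proof cases
      case 1
      define m where "m = s / t"
      have "m - 1 = (s - t) / t" using t0 by (simp add: m_def diff_divide_distrib)
      then have m: "m * t = s" "\<bar>m - 1\<bar> = D / \<bar>t\<bar>" "\<bar>m\<bar> = \<bar>s\<bar> / \<bar>t\<bar>"
        using t0 by (simp_all add: m_def D_def)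
      have "\<bar>s\<bar> \<le> D + \<bar>t\<bar>" using abs_triangle_ineq[of "s - t" t] by (simp add: D_def)
      then have "\<bar>s\<bar> \<le> 2 * \<bar>t\<bar>" using D by linarith
      then have "1 < \<bar>m\<bar>" "\<bar>m\<bar> \<le> 2"
        unfolding m(3) using 1 t0 by (simp_all add: divide_le_eq less_divide_eq)
      from reg[OF t0 st(3) this] show ?thesis
        unfolding m(1) using that[of "\<bar>m - 1\<bar>"] D t0 unfolding m(2) by (simp add: divide_right_mono)
    next
      case 2
      have sp: "0 < \<bar>s\<bar>" using s0 t0 by simp
      define m where "m = t / s"
      have "m - 1 = (t - s) / s" using sp by (simp add: m_def diff_divide_distrib)
      then have m: "m * s = t" "\<bar>m - 1\<bar> = D / \<bar>s\<bar>" "\<bar>m\<bar> = \<bar>t\<bar> / \<bar>s\<bar>"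
        using sp by (simp_all add: m_def D_def abs_minus_commute)
      have "1 < \<bar>m\<bar>" "\<bar>m\<bar> \<le> 2"
        unfolding m(3) using 2 s0 sp by (simp_all add: divide_le_eq less_divide_eq)
      from reg[OF sp st(2) this]
      have "\<bar>\<phi> s - \<phi> t\<bar> \<le> A * (\<bar>m - 1\<bar> * (1 + \<bar>ln (1 / \<bar>m - 1\<bar>)\<bar>))" by (simp add: m abs_minus_commute)
      moreover have "0 < \<bar>m - 1\<bar>" using D sp by (simp add: m)
      moreover have "\<bar>m - 1\<bar> \<le> 2 * D / \<bar>t\<bar>"
      proof -
        have "D / \<bar>s\<bar> \<le> D / (\<bar>t\<bar> / 2)" using D s0 t0 sp by (intro divide_left_mono) auto
        also have "\<dots> = 2 * D / \<bar>t\<bar>" by simp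
        finally show ?thesis unfolding m(2) .
      qed
      moreover have "2 * D / \<bar>t\<bar> \<le> 1" using D t0 by simp
      ultimately show ?thesis using that[of "\<bar>m - 1\<bar>"] by linarith
    next
      case 3
      then have False using False D unfolding D_def by (auto simp: abs_if split: if_splits)
      then show ?thesis ..
    qed
  qed
  have "(\<phi> s - \<phi> t)\<^sup>2 \<le> (A * (\<theta> * (1 + \<bar>ln (1 / \<theta>)\<bar>)))\<^sup>2"
    using le by (intro abs_le_square_iff[THEN iffD1]) simp
  also have "\<dots> = A\<^sup>2 * (\<theta> * (1 + \<bar>ln (1 / \<theta>)\<bar>))\<^sup>2" by (rule power_mult_distrib)
  also have "\<dots> \<le> A\<^sup>2 * (16 * \<theta> powr (3/2))" by (intro mult_left_mono log_modulus_le \<theta>) auto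
  also have "\<dots> \<le> A\<^sup>2 * (16 * (3 * (D / \<bar>t\<bar>) powr (3/2)))"
  proof (intro mult_left_mono)
    have "\<theta> powr (3/2) \<le> (2 * (D / \<bar>t\<bar>)) powr (3/2)" using \<theta> by (intro powr_mono2) auto
    also have "\<dots> = 2 powr (3/2) * (D / \<bar>t\<bar>) powr (3/2)" by (rule powr_mult)
    also have "\<dots> \<le> 3 * (D / \<bar>t\<bar>) powr (3/2)"
    proof (intro mult_right_mono)
      have "(2 powr (3/2))\<^sup>2 = (2::real) powr 3"
        by (simp add: powr_realpow[symmetric] powr_powr)
      also have "\<dots> \<le> 3\<^sup>2" using powr_realpow[of 2 3] by simp
      finally show "2 powr (3/2) \<le> (3::real)" by (rule power2_le_imp_le) simp
    qed simp
    finally show "\<theta> powr (3/2) \<le> 3 * (D / \<bar>t\<bar>) powr (3/2)" .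
  qed auto
  finally have "(\<phi> s - \<phi> t)\<^sup>2 \<le> 48 * A\<^sup>2 * (D / \<bar>t\<bar>) powr (3/2)" by simp
  then have "(\<phi> s - \<phi> t)\<^sup>2 / (s - t)\<^sup>2 \<le> 48 * A\<^sup>2 * (D / \<bar>t\<bar>) powr (3/2) / (s - t)\<^sup>2"
    by (rule divide_right_mono) simp
  also have "\<dots> = 48 * A\<^sup>2 * (D powr (3/2) * D powr (-2)) * \<bar>t\<bar> powr (-3/2)"
  proof -
    have "(s - t)\<^sup>2 = D powr 2" using D(1) powr_realpow[of D 2] by (simp add: D_def)
    then show ?thesis using D t0 by (simp add: powr_divide powr_minus_divide)
  qed
  also have "D powr (3/2) * D powr (-2) = D powr (-1/2)" by (simp add: powr_add[symmetric])
  finally show ?thesis by (simp add: D_def)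
qed simp

lemma square_sum3_le: "(a + b + c)\<^sup>2 \<le> 3 * (a\<^sup>2 + b\<^sup>2 + c\<^sup>2)" for a b c :: real
  using sum_squares_bound[of a b] sum_squares_bound[of b c] sum_squares_bound[of a c]
  by (simp add: power2_eq_square algebra_simps)

text \<open>Where 2|s - t| < d (x + t) the regularity of \<open>f\<close> is applied directly;
  elsewhere \<open>f\<close> is split into \<open>g\<close> and an error whose quotient at t is at
  most 2n d(x + t)/|t|. The errors at s and at t are dominated by the kernel \<open>W\<close> in one
  order of its arguments or the other.\<close>

lemma square_integral_finite_of_decomposition:
  assumes [measurable]: "g \<in> borel_measurable borel" and d: "continuous_on UNIV d" "\<And>y. 0 \<le> d y"
    and lip: "\<And>x y. d y \<le> d x + \<bar>y - x\<bar>"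
    and x: "f x = g x" "d x = 0"
    and b: "\<And>y. \<bar>y - x\<bar> < \<delta> \<Longrightarrow> \<bar>f y - g y\<bar> \<le> 2 * n * d y"
    and reg: "\<And>t m. 0 < \<bar>t\<bar> \<Longrightarrow> \<bar>t\<bar> < \<delta> \<Longrightarrow> 1 < \<bar>m\<bar> \<Longrightarrow> \<bar>m\<bar> \<le> 2 \<Longrightarrow>
      \<bar>diff_quot f x (m * t) - diff_quot f x t\<bar> \<le> A * (\<bar>m - 1\<bar> * (1 + \<bar>ln (1 / \<bar>m - 1\<bar>)\<bar>))"
    and \<delta>: "\<delta> \<le> 1"
    and fin: "square_integral g x 1 < \<infinity>" "marcinkiewicz d x < \<infinity>"
  shows "square_integral f x \<delta> < \<infinity>"
proof -
  have [measurable]: "d \<in> borel_measurable borel" using d(1) by (rule borel_measurable_continuous_onI)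
  let ?M = "lborel \<Otimes>\<^sub>M lborel :: (real \<times> real) measure"
  define W where "W s t = (if \<bar>t\<bar> < 1 then bad_kernel (48 * A\<^sup>2) n (d (x + t)) s t else 0)" for s t
  have W[measurable]: "(\<lambda>z. W (fst z) (snd z)) \<in> borel_measurable ?M" "(\<lambda>z. W (snd z) (fst z)) \<in> borel_measurable ?M"
    unfolding W_def by measurable
  define Qg where "Qg z = (case z of (s, t) \<Rightarrow> ennreal (\<bar>diff_quot g x s - diff_quot g x t\<bar>\<^sup>2 / \<bar>s - t\<bar>\<^sup>2)) * indicator {(s, t). \<bar>s\<bar> + \<bar>t\<bar> < 1} z" for z
  have Qg_eq: "Qg = (\<lambda>z. if \<bar>fst z\<bar> + \<bar>snd z\<bar> < 1 then ennreal (\<bar>diff_quot g x (fst z) - diff_quot g x (snd z)\<bar>\<^sup>2 / \<bar>fst z - snd z\<bar>\<^sup>2) else 0)"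
    by (auto simp: Qg_def fun_eq_iff)
  have [measurable]: "Qg \<in> borel_measurable ?M"
    unfolding Qg_eq by measurable
  have Qfin: "(\<integral>\<^sup>+z. Qg z \<partial>?M) < \<infinity>"
    using fin(1) unfolding square_integral_def nn_integral_completion lborel_prod Qg_def .
  have dt: "d (x + t) \<le> \<bar>t\<bar>" for t using lip[of "x + t" x] x(2) by simp
  have Wfin: "(\<integral>\<^sup>+t. \<integral>\<^sup>+s. W s t \<partial>lborel \<partial>lborel) < \<infinity>"
  proof -
    have "(\<integral>\<^sup>+t. \<integral>\<^sup>+s. W s t \<partial>lborel \<partial>lborel) \<le>
        (\<integral>\<^sup>+t. ennreal (4 * (48 * A\<^sup>2) + 72 * n\<^sup>2) * (indicator {-1<..<1} t * ennreal (d (x + t) powr (1/2) * \<bar>t\<bar> powr (-3/2))) \<partial>lborel)"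
    proof (rule nn_integral_mono)
      fix t
      show "(\<integral>\<^sup>+s. W s t \<partial>lborel) \<le> ennreal (4 * (48 * A\<^sup>2) + 72 * n\<^sup>2) * (indicator {-1<..<1} t * ennreal (d (x + t) powr (1/2) * \<bar>t\<bar> powr (-3/2)))"
      proof (cases "\<bar>t\<bar> < 1")
        case True
        then have "indicator {-1<..<1} t = (1::ennreal)" by (simp add: abs_less_iff)
        then show ?thesis
          using nn_integral_bad_kernel_le[OF d(2) dt, where c = "48 * A\<^sup>2" and n = n and t = t] True
          by (simp only: W_def if_True mult_1) simp
      qed (simp add: W_def)
    qed
    also have "\<dots> = ennreal (4 * (48 * A\<^sup>2) + 72 * n\<^sup>2) * marcinkiewicz d x"
      unfolding marcinkiewicz_def by (rule nn_integral_cmult) measurable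
    also have "\<dots> < \<infinity>" using fin(2) by (simp add: ennreal_mult_less_top)
    finally show ?thesis .
  qed
  have W1: "(\<integral>\<^sup>+z. W (snd z) (fst z) \<partial>?M) < \<infinity>"
    using Wfin lborel.nn_integral_fst[OF W(2)] by simp
  have W2: "(\<integral>\<^sup>+z. W (fst z) (snd z) \<partial>?M) < \<infinity>"
    using Wfin lborel_pair.nn_integral_snd[OF W(1)] by simp
  have pointwise: "ennreal (\<bar>diff_quot f x s - diff_quot f x t\<bar>\<^sup>2 / \<bar>s - t\<bar>\<^sup>2) \<le> 3 * Qg (s, t) + W s t + W t s"
    if st: "\<bar>s\<bar> + \<bar>t\<bar> < \<delta>" for s t
  proof (cases "2 * \<bar>s - t\<bar> < d (x + t)")
    case True
    have "\<bar>s\<bar> < \<delta>" "\<bar>t\<bar> < \<delta>" using st by linarith+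
    then have "(diff_quot f x s - diff_quot f x t)\<^sup>2 / (s - t)\<^sup>2 \<le> 48 * A\<^sup>2 * \<bar>s - t\<bar> powr (-1/2) * \<bar>t\<bar> powr (-3/2)"
      using True dt[of t] by (intro near_diagonal_bound[where \<delta> = \<delta>] reg) auto
    then have "ennreal (\<bar>diff_quot f x s - diff_quot f x t\<bar>\<^sup>2 / \<bar>s - t\<bar>\<^sup>2) \<le> ennreal (48 * A\<^sup>2 * \<bar>s - t\<bar> powr (-1/2) * \<bar>t\<bar> powr (-3/2))"
      by (intro ennreal_leI) simp
    also have "\<dots> \<le> W s t"
      using True \<open>\<bar>t\<bar> < \<delta>\<close> \<delta> by (simp add: W_def bad_kernel_def)
    also have "\<dots> \<le> 3 * Qg (s, t) + W s t + W t s" by (simp add: add_increasing add_increasing2)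
    finally show ?thesis .
  next
    case False
    have st1: "\<bar>s\<bar> < 1" "\<bar>t\<bar> < 1" "\<bar>s\<bar> + \<bar>t\<bar> < 1" using st \<delta> by linarith+
    define B where "B t = diff_quot f x t - diff_quot g x t" for t
    have B: "(B t)\<^sup>2 / (s - t)\<^sup>2 \<le> 4 * n\<^sup>2 * (d (x + t))\<^sup>2 / (t\<^sup>2 * (s - t)\<^sup>2)" if "\<bar>t\<bar> < \<delta>" for s t
    proof -
      have "B t = (f (x + t) - g (x + t)) / t" using x(1) by (simp add: B_def diff_quot_def diff_divide_distrib)
      then have "(B t)\<^sup>2 = (f (x + t) - g (x + t))\<^sup>2 / t\<^sup>2" by (simp add: power_divide)
      moreover have "(f (x + t) - g (x + t))\<^sup>2 \<le> (2 * n * d (x + t))\<^sup>2"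
        using b[of "x + t"] that by (intro abs_le_square_iff[THEN iffD1]) simp
      ultimately have "(B t)\<^sup>2 \<le> (2 * n * d (x + t))\<^sup>2 / t\<^sup>2" by (simp add: divide_right_mono)
      then have "(B t)\<^sup>2 / (s - t)\<^sup>2 \<le> (2 * n * d (x + t))\<^sup>2 / t\<^sup>2 / (s - t)\<^sup>2" by (rule divide_right_mono) simp
      then show ?thesis by (simp add: power_mult_distrib)
    qed
    have BW: "ennreal (3 * ((B t)\<^sup>2 / (s - t)\<^sup>2)) \<le> W s t" if "\<bar>t\<bar> < \<delta>" "d (x + t) \<le> 3 * \<bar>s - t\<bar>" for s t
    proof -
      have "3 * ((B t)\<^sup>2 / (s - t)\<^sup>2) \<le> 12 * n\<^sup>2 * (d (x + t))\<^sup>2 / (t\<^sup>2 * (s - t)\<^sup>2)"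
        using B[OF that(1), of s] by simp
      then have "ennreal (3 * ((B t)\<^sup>2 / (s - t)\<^sup>2)) \<le> ennreal (12 * n\<^sup>2 * (d (x + t))\<^sup>2 / (t\<^sup>2 * (s - t)\<^sup>2))"
        by (rule ennreal_leI)
      then show ?thesis using that \<delta> by (simp add: W_def bad_kernel_def add_increasing)
    qed
    have "d (x + t) \<le> 2 * \<bar>s - t\<bar>" using False by (rule leI)
    also have "\<dots> \<le> 3 * \<bar>s - t\<bar>" by simp
    finally have d1: "d (x + t) \<le> 3 * \<bar>s - t\<bar>" .
    have d2: "d (x + s) \<le> 3 * \<bar>t - s\<bar>" using False lip[of "x + s" "x + t"] by (simp add: abs_minus_commute)
    have "(diff_quot f x s - diff_quot f x t)\<^sup>2 = ((diff_quot g x s - diff_quot g x t) + B s + (- B t))\<^sup>2"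
      by (simp add: B_def)
    also have "\<dots> \<le> 3 * ((diff_quot g x s - diff_quot g x t)\<^sup>2 + (B s)\<^sup>2 + (- B t)\<^sup>2)" by (rule square_sum3_le)
    finally have "(diff_quot f x s - diff_quot f x t)\<^sup>2 / (s - t)\<^sup>2 \<le>
        3 * ((diff_quot g x s - diff_quot g x t)\<^sup>2 + (B s)\<^sup>2 + (- B t)\<^sup>2) / (s - t)\<^sup>2"
      by (rule divide_right_mono) simp
    also have "\<dots> = 3 * ((diff_quot g x s - diff_quot g x t)\<^sup>2 / (s - t)\<^sup>2) + 3 * ((B t)\<^sup>2 / (s - t)\<^sup>2) + 3 * ((B s)\<^sup>2 / (t - s)\<^sup>2)"
      by (simp add: add_divide_distrib power2_commute[of s t])
    finally have "ennreal (\<bar>diff_quot f x s - diff_quot f x t\<bar>\<^sup>2 / \<bar>s - t\<bar>\<^sup>2) \<le>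
        ennreal (3 * ((diff_quot g x s - diff_quot g x t)\<^sup>2 / (s - t)\<^sup>2) + 3 * ((B t)\<^sup>2 / (s - t)\<^sup>2) + 3 * ((B s)\<^sup>2 / (t - s)\<^sup>2))"
      by (intro ennreal_leI) simp
    also have "\<dots> = ennreal (3 * ((diff_quot g x s - diff_quot g x t)\<^sup>2 / (s - t)\<^sup>2)) + ennreal (3 * ((B t)\<^sup>2 / (s - t)\<^sup>2)) + ennreal (3 * ((B s)\<^sup>2 / (t - s)\<^sup>2))"
      by (subst ennreal_plus, simp, simp)+ simp
    also have "\<dots> \<le> 3 * Qg (s, t) + W s t + W t s"
    proof (intro add_mono)
      show "ennreal (3 * ((diff_quot g x s - diff_quot g x t)\<^sup>2 / (s - t)\<^sup>2)) \<le> 3 * Qg (s, t)"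
        using st1 by (subst ennreal_mult) (auto simp: Qg_def)
      show "ennreal (3 * ((B t)\<^sup>2 / (s - t)\<^sup>2)) \<le> W s t" using st d1 by (intro BW) auto
      show "ennreal (3 * ((B s)\<^sup>2 / (t - s)\<^sup>2)) \<le> W t s" using st d2 by (intro BW) auto
    qed
    finally show ?thesis .
  qed
  have "square_integral f x \<delta> \<le> (\<integral>\<^sup>+z. 3 * Qg z + W (fst z) (snd z) + W (snd z) (fst z) \<partial>?M)"
    unfolding square_integral_def nn_integral_completion lborel_prod
  proof (rule nn_integral_mono)
    fix z :: "real \<times> real"
    obtain s t where z: "z = (s, t)" by (cases z)
    show "(case z of (s, t) \<Rightarrow> ennreal (\<bar>diff_quot f x s - diff_quot f x t\<bar>\<^sup>2 / \<bar>s - t\<bar>\<^sup>2)) * indicator {(s, t). \<bar>s\<bar> + \<bar>t\<bar> < \<delta>} z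
        \<le> 3 * Qg z + W (fst z) (snd z) + W (snd z) (fst z)"
      using pointwise[of s t] by (cases "\<bar>s\<bar> + \<bar>t\<bar> < \<delta>") (simp_all add: z)
  qed
  also have "\<dots> = 3 * (\<integral>\<^sup>+z. Qg z \<partial>?M) + (\<integral>\<^sup>+z. W (fst z) (snd z) \<partial>?M) + (\<integral>\<^sup>+z. W (snd z) (fst z) \<partial>?M)"
    by (subst nn_integral_add, measurable)+ (simp add: nn_integral_cmult)
  also have "\<dots> < \<infinity>" using Qfin W1 W2 by (simp add: ennreal_mult_less_top)
  finally show ?thesis .
qed

section \<open>Finiteness of the square integral\<close>

lemma regularity_of_Limsup:
  assumes "Limsup (at 0) (\<lambda>t. SUP m\<in>{m::real. 1 < \<bar>m\<bar> \<and> \<bar>m\<bar> \<le> 2}.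
               ereal (\<bar>\<phi> (m * t) - \<phi> t\<bar> / (\<bar>m - 1\<bar> * (1 + \<bar>ln (1 / \<bar>m - 1\<bar>)\<bar>)))) < \<infinity>"
  obtains A \<delta> where "0 < \<delta>" "\<And>t m. 0 < \<bar>t\<bar> \<Longrightarrow> \<bar>t\<bar> < \<delta> \<Longrightarrow> 1 < \<bar>m\<bar> \<Longrightarrow> \<bar>m\<bar> \<le> 2 \<Longrightarrow>
      \<bar>\<phi> (m * t) - \<phi> t\<bar> \<le> A * (\<bar>m - 1\<bar> * (1 + \<bar>ln (1 / \<bar>m - 1\<bar>)\<bar>))"
proof -
  let ?q = "\<lambda>t m. \<bar>\<phi> (m * t) - \<phi> t\<bar> / (\<bar>m - 1\<bar> * (1 + \<bar>ln (1 / \<bar>m - 1\<bar>)\<bar>))"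
  let ?S = "{m::real. 1 < \<bar>m\<bar> \<and> \<bar>m\<bar> \<le> 2}"
  obtain A :: nat where "Limsup (at 0) (\<lambda>t. SUP m\<in>?S. ereal (?q t m)) < ereal (real A)"
    using less_PInf_Ex_of_nat assms by fastforce
  then have "\<forall>\<^sub>F t in at 0. (SUP m\<in>?S. ereal (?q t m)) < ereal (real A)" by (rule Limsup_lessD)
  then obtain \<delta> where \<delta>: "0 < \<delta>" "\<And>t. t \<noteq> 0 \<Longrightarrow> \<bar>t\<bar> < \<delta> \<Longrightarrow> (SUP m\<in>?S. ereal (?q t m)) < ereal (real A)"
    unfolding eventually_at dist_real_def by auto
  have "\<bar>\<phi> (m * t) - \<phi> t\<bar> \<le> real A * (\<bar>m - 1\<bar> * (1 + \<bar>ln (1 / \<bar>m - 1\<bar>)\<bar>))"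
    if "0 < \<bar>t\<bar>" "\<bar>t\<bar> < \<delta>" "1 < \<bar>m\<bar>" "\<bar>m\<bar> \<le> 2" for t m
  proof -
    have "ereal (?q t m) \<le> (SUP m\<in>?S. ereal (?q t m))" using that by (intro SUP_upper) auto
    also have "\<dots> < ereal (real A)" using that by (intro \<delta>) auto
    finally have "?q t m < real A" by simp
    moreover have "0 < \<bar>m - 1\<bar> * (1 + \<bar>ln (1 / \<bar>m - 1\<bar>)\<bar>)"
      using that by (intro mult_pos_pos) auto
    ultimately show ?thesis by (simp add: pos_divide_less_eq)
  qed
  with \<delta>(1) show ?thesis using that by blast
qed

text \<open>\<open>F\<close> collects the points with the uniform bound, \<open>d\<close> is the
  distance to it, and \<open>g\<close> is the Lipschitz minorant, clamped so as to be constant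
  outside the interval. At y in the interval both \<open>f\<close> and \<open>g\<close> differ from
  their common value at any x of \<open>F\<close> by at most n|y - x|, so the infimum over
  \<open>F\<close> bounds their difference by 2 n d(y).\<close>

lemma AE_square_integral_finite_uniform:
  assumes n: "0 \<le> n"
  shows "AE x in lebesgue. x \<in> {a<..<b} \<and> (\<forall>z\<in>{a<..<b}. \<bar>f z - f x\<bar> \<le> n * \<bar>z - x\<bar>) \<and>
     Limsup (at 0) (\<lambda>t. SUP m\<in>{m::real. 1 < \<bar>m\<bar> \<and> \<bar>m\<bar> \<le> 2}.
               ereal (\<bar>diff_quot f x (m * t) - diff_quot f x t\<bar> / (\<bar>m - 1\<bar> * (1 + \<bar>ln (1 / \<bar>m - 1\<bar>)\<bar>)))) < \<infinity>
     \<longrightarrow> (\<exists>\<delta>>0. square_integral f x \<delta> < \<infinity>)"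
proof -
  define J where "J = {a<..<b}"
  define F where "F = {x\<in>J. \<forall>z\<in>J. \<bar>f z - f x\<bar> \<le> n * \<bar>z - x\<bar>}"
  show ?thesis
  proof (cases "F = {}")
    case True
    then show ?thesis by (intro AE_I2) (auto simp: F_def J_def)
  next
    case False
    then obtain x0 where x0: "x0 \<in> J" "\<And>z. z \<in> J \<Longrightarrow> \<bar>f z - f x0\<bar> \<le> n * \<bar>z - x0\<bar>"
      by (auto simp: F_def)
    obtain u where u: "\<And>y y'. \<bar>u y - u y'\<bar> \<le> n * \<bar>y - y'\<bar>"
      "\<And>y. y \<in> J \<Longrightarrow> u y \<le> f y"
      "\<And>x. x \<in> J \<Longrightarrow> (\<And>z. z \<in> J \<Longrightarrow> \<bar>f z - f x\<bar> \<le> n * \<bar>z - x\<bar>) \<Longrightarrow> u x = f x"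
      by (rule lipschitz_minorant[OF x0 n]) blast+
    have ab: "a < b" using x0(1) by (auto simp: J_def)
    define g where "g y = u (max a (min b y))" for y
    define d where "d y = infdist y F" for y
    interpret g: lipschitz_const_outside g n a b
    proof
      fix x y
      have "\<bar>g x - g y\<bar> \<le> n * \<bar>max a (min b x) - max a (min b y)\<bar>" unfolding g_def by (rule u(1))
      also have "\<dots> \<le> n * \<bar>x - y\<bar>" by (intro mult_left_mono n) (auto simp: max_def min_def)
      finally show "\<bar>g x - g y\<bar> \<le> n * \<bar>x - y\<bar>" .
    qed (use ab in \<open>auto simp: g_def max_def min_def\<close>)
    have gu: "g y = u y" if "y \<in> J" for y using that by (simp add: g_def J_def max_def min_def)
    have uF: "u x = f x" if "x \<in> F" for x using u(3)[of x] that by (auto simp: F_def)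
    have close: "\<bar>f y - g y\<bar> \<le> 2 * n * d y" if y: "y \<in> J" for y
    \<comment> \<open>The infimum is taken after division by 2n, which excludes n = 0; in that case
      \<open>f\<close> and \<open>u\<close> are both constant on the interval.\<close>
    proof (cases "n = 0")
      case True
      obtain x where x: "x \<in> F" using False by blast
      then have "\<bar>f y - f x\<bar> \<le> n * \<bar>y - x\<bar>" using y unfolding F_def by blast
      then have "f y = f x" using True by simp
      moreover have "u y = u x" using u(1)[of y x] True by simp
      ultimately show ?thesis using True gu[OF y] uF[OF x] by simp
    next
      case n0: False
      have "\<bar>f y - g y\<bar> / (2 * n) \<le> d y"
        unfolding d_def infdist_notempty[OF False]
      proof (rule cINF_greatest[OF False])
        fix x assume x: "x \<in> F"
        have "\<bar>f y - f x\<bar> \<le> n * \<bar>y - x\<bar>" using x y unfolding F_def by blast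
        moreover have "\<bar>u y - u x\<bar> \<le> n * \<bar>y - x\<bar>" by (rule u(1))
        ultimately have "\<bar>f y - g y\<bar> \<le> 2 * n * \<bar>y - x\<bar>" using uF[OF x] gu[OF y] by linarith
        then show "\<bar>f y - g y\<bar> / (2 * n) \<le> dist y x" using n n0 by (simp add: dist_real_def divide_le_eq mult.commute)
      qed
      then show ?thesis using n n0 by (simp add: divide_le_eq mult.commute)
    qed
    have d: "continuous_on UNIV d" "\<And>y. 0 \<le> d y" "\<And>x y. d y \<le> d x + \<bar>y - x\<bar>"
      unfolding d_def by (auto intro!: continuous_intros infdist_nonneg simp flip: dist_real_def intro: infdist_triangle)
    have "AE x in lebesgue. square_integral g x 1 < \<infinity>"
      by (rule AE_completion[OF g.AE_square_integral_finite])
    moreover have "AE x in lebesgue. x \<in> {a<..<b} \<and> d x = 0 \<longrightarrow> marcinkiewicz d x < \<infinity>"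
      by (rule AE_completion[OF AE_marcinkiewicz_finite[OF d]])
    ultimately show ?thesis
    proof eventually_elim
      case (elim x)
      show ?case
      proof
        assume *: "x \<in> {a<..<b} \<and> (\<forall>z\<in>{a<..<b}. \<bar>f z - f x\<bar> \<le> n * \<bar>z - x\<bar>) \<and>
           Limsup (at 0) (\<lambda>t. SUP m\<in>{m::real. 1 < \<bar>m\<bar> \<and> \<bar>m\<bar> \<le> 2}.
               ereal (\<bar>diff_quot f x (m * t) - diff_quot f x t\<bar> / (\<bar>m - 1\<bar> * (1 + \<bar>ln (1 / \<bar>m - 1\<bar>)\<bar>)))) < \<infinity>"
        then have xF: "x \<in> F" and xJ: "x \<in> J" by (simp_all add: F_def J_def)
        obtain A \<delta>0 where \<delta>0: "0 < \<delta>0" and A: "\<And>t m. 0 < \<bar>t\<bar> \<Longrightarrow> \<bar>t\<bar> < \<delta>0 \<Longrightarrow> 1 < \<bar>m\<bar> \<Longrightarrow> \<bar>m\<bar> \<le> 2 \<Longrightarrow>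
            \<bar>diff_quot f x (m * t) - diff_quot f x t\<bar> \<le> A * (\<bar>m - 1\<bar> * (1 + \<bar>ln (1 / \<bar>m - 1\<bar>)\<bar>))"
          by (rule regularity_of_Limsup[OF *[THEN conjunct2, THEN conjunct2]]) blast
        \<comment> \<open>The radius keeps x + s and x + t in the interval where
          \<open>f - g\<close> is controlled, stays in the range of the regularity bound, and is at
          most 1, the radius of the square integral of \<open>g\<close>.\<close>
        define \<delta> where "\<delta> = min (min \<delta>0 1) (min (x - a) (b - x))"
        have \<delta>: "0 < \<delta>" "\<delta> \<le> 1" "\<delta> \<le> \<delta>0" using \<delta>0 xJ by (auto simp: \<delta>_def J_def)
        have inJ: "y \<in> J" if "\<bar>y - x\<bar> < \<delta>" for y
        proof -
          have "\<delta> \<le> x - a" "\<delta> \<le> b - x" by (auto simp: \<delta>_def)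
          then show ?thesis using that by (simp add: J_def abs_less_iff)
        qed
        have dx: "d x = 0" using xF by (simp add: d_def)
        have "square_integral f x \<delta> < \<infinity>"
        proof (rule square_integral_finite_of_decomposition[OF g.g_measurable d _ dx, where A = A and n = n])
          show "f x = g x" using gu[OF xJ] uF[OF xF] by simp
          show "\<bar>f y - g y\<bar> \<le> 2 * n * d y" if "\<bar>y - x\<bar> < \<delta>" for y by (rule close[OF inJ[OF that]])
          show "marcinkiewicz d x < \<infinity>" using elim(2) dx xJ by (simp add: J_def)
        qed (use A \<delta> elim(1) in auto)
        then show "\<exists>\<delta>>0. square_integral f x \<delta> < \<infinity>" using \<delta>(1) by blast
      qed
    qed
  qed
qed

lemma differentiable_imp_locally_lipschitz_at:
  assumes "f differentiable (at x)"
  shows "locally_lipschitz_at f x"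
proof -
  obtain D where "(f has_real_derivative D) (at x)" using assms by (auto simp: real_differentiable_def)
  then have "(\<lambda>h. (f (x + h) - f x) / h) \<midarrow>0\<rightarrow> D" by (simp add: DERIV_def)
  then obtain d where d: "0 < d" "\<And>h. h \<noteq> 0 \<Longrightarrow> \<bar>h\<bar> < d \<Longrightarrow> \<bar>(f (x + h) - f x) / h - D\<bar> < 1"
    unfolding LIM_eq by (metis diff_zero real_norm_def zero_less_one)
  have "\<bar>f z - f x\<bar> \<le> (\<bar>D\<bar> + 1) * \<bar>z - x\<bar>" if "\<bar>z - x\<bar> < d" for z
  proof (cases "z = x")
    case False
    then have "\<bar>(f z - f x) / (z - x) - D\<bar> < 1" using d(2)[of "z - x"] that by simp
    then have "\<bar>(f z - f x) / (z - x)\<bar> \<le> \<bar>D\<bar> + 1" by linarith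
    then show ?thesis using False by (simp add: divide_le_eq)
  qed simp
  then show ?thesis using d(1) unfolding locally_lipschitz_at_def by blast
qed

text \<open>Differentiability yields a local Lipschitz bound at x; rational intervals and natural
  constants then reduce the claim to countably many uniform cases.\<close>

theorem AE_square_integral_of_differentiable:
  "AE x in lebesgue.
            f differentiable (at x) \<and>
            Limsup (at 0) (\<lambda>t. SUP m\<in>{m::real. 1 < \<bar>m\<bar> \<and> \<bar>m\<bar> \<le> 2}.
               ereal (\<bar>diff_quot f x (m * t) - diff_quot f x t\<bar> /
                      (\<bar>m - 1\<bar> * (1 + \<bar>ln (1 / \<bar>m - 1\<bar>)\<bar>)))) < \<infinity>
            \<longrightarrow> (\<exists>\<delta>>0. square_integral f x \<delta> < \<infinity>)"
proof -
  let ?L = "\<lambda>x. Limsup (at 0) (\<lambda>t. SUP m\<in>{m::real. 1 < \<bar>m\<bar> \<and> \<bar>m\<bar> \<le> 2}.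
               ereal (\<bar>diff_quot f x (m * t) - diff_quot f x t\<bar> / (\<bar>m - 1\<bar> * (1 + \<bar>ln (1 / \<bar>m - 1\<bar>)\<bar>)))) < \<infinity>"
  have "AE x in lebesgue. \<forall>a\<in>\<rat>. \<forall>b\<in>\<rat>. \<forall>n::nat. x \<in> {a<..<b} \<and> (\<forall>z\<in>{a<..<b}. \<bar>f z - f x\<bar> \<le> real n * \<bar>z - x\<bar>) \<and> ?L x
    \<longrightarrow> (\<exists>\<delta>>0. square_integral f x \<delta> < \<infinity>)"
    by (intro AE_ball_countable' AE_all_countable[THEN iffD2] allI AE_square_integral_finite_uniform countable_rat) auto
  then show ?thesis
  proof (rule AE_mp, intro AE_I2 impI)
    fix x
    assume H: "\<forall>a\<in>\<rat>. \<forall>b\<in>\<rat>. \<forall>n::nat. x \<in> {a<..<b} \<and> (\<forall>z\<in>{a<..<b}. \<bar>f z - f x\<bar> \<le> real n * \<bar>z - x\<bar>) \<and> ?L x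
      \<longrightarrow> (\<exists>\<delta>>0. square_integral f x \<delta> < \<infinity>)" and D: "f differentiable (at x) \<and> ?L x"
    obtain a b :: real and n :: nat where "a \<in> \<rat>" "b \<in> \<rat>" "x \<in> {a<..<b}"
        "\<forall>z\<in>{a<..<b}. \<bar>f z - f x\<bar> \<le> real n * \<bar>z - x\<bar>"
      by (rule locally_lipschitz_at_rational_interval[of f x 1]) (use D differentiable_imp_locally_lipschitz_at in auto)
    then show "\<exists>\<delta>>0. square_integral f x \<delta> < \<infinity>" using H D by blast
  qed
qed

theorem theorem9p3:
  fixes f :: "real \<Rightarrow> real"
  assumes "locally_L2 f"
  shows "(AE x in lebesgue.
            Limsup (at 0) (\<lambda>h. ereal \<bar>diff_quot f x (2 * h) - diff_quot f x h\<bar>) < \<infinity> \<and>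
            (\<exists>\<delta>>0. square_integral f x \<delta> < \<infinity>)
            \<longrightarrow> f differentiable (at x)) \<and>
         (AE x in lebesgue.
            f differentiable (at x) \<and>
            Limsup (at 0) (\<lambda>t. SUP m\<in>{m::real. 1 < \<bar>m\<bar> \<and> \<bar>m\<bar> \<le> 2}.
               ereal (\<bar>diff_quot f x (m * t) - diff_quot f x t\<bar> /
                      (\<bar>m - 1\<bar> * (1 + \<bar>ln (1 / \<bar>m - 1\<bar>)\<bar>)))) < \<infinity>
            \<longrightarrow> (\<exists>\<delta>>0. square_integral f x \<delta> < \<infinity>))"
  using assms unfolding locally_L2_def
  by (intro conjI AE_differentiable_of_square_integral AE_square_integral_of_differentiable) (rule conjunct1)

end
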